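(* Consider $\overline{F}$ an NCGD. There exists $\overline{R}_\bullet$ such that for all $G$, $\overline{R}_G$ is a bijection from $V(G).\{l,r\}^*$ to $V(F(G)).\{l,r\}^*$. This induces an IMCGD $(F,R_\bullet)$ via \begin{itemize} \item $F(\widetilde{(G',u.t)})=\widetilde{(\overline{F}(G)',\overline{R}_G(u.t) )}$. \item $R_{\widetilde{(G',u.t)}}(p)$ is the path between $\overline{R}_G(u.t)$ and $\overline{R}_G(v.s)$ in $\overline{F}(G)'$, where $v.s$ is obtained by following path $p$ from $u.t$ in $G'$. \end{itemize} Moreover if $\overline{F}$ is invertible, then this $(F,R_\bullet)$ is invertible.
   Context: Names live in the name algebra $V$: terms generated by $V ::= {\cal N}\,|\,V.\{l,r\}^*\,|\,V\wedge V$ (with ${\cal N}$ a countable set) modulo the rewrite rules $(u\wedge v).l\to u$, $(u\wedge v).r\to v$, $(u.l\wedge u.r)\to u$. A graph $G$ is well-named if for all vertices $v,v'$ of $G$ and $t,t'\in\{l,r\}^*$, $v.t=v'.t'$ implies $v=v'$ and $t=t'$; ${\cal W}$ is the set of well-named graphs. Two names $v,v'$ are intersectant, $\iota(v,v')$, if $v.t=v'.t'$ for some $t,t'\in\{l,r\}^*$. An NCGD is a function $\overline{F}$ over ${\cal W}$ that is shift-invariant ($\overline{F}(RG)=R\overline{F}(G)$ for every renaming $R$, i.e. the natural extension to $V$ of an injective map from ${\cal N}$ to $V$ with pairwise non-intersectant images), continuous (for all $G$ and $n$ there is $m$ such that for all $v'$ and all $v$ with $\iota(v,v')$, $\overline{F}(G)^n_{v'}=\overline{F}(G^m_v)^n_{v'}$),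 and name-preserving ($\iota(u,V(G))$ iff $\iota(u,V(\overline{F}(G)))$). Invisible matter graphs: each visible vertex of a graph has an infinite binary tree (vertices labelled $m$, ports $m,l,r$, whose root has copies of the tree at paths $lm$ and $rm$) attached through path $mm$. For $G$ in ${\cal W}$, $G'$ is the graph obtained from $G$ by attaching such invisible-matter trees to each vertex, and naming the attached vertices in $V(G).\{l,r\}^*$: for a visible vertex $u$ and $s\in\{lm,rm\}^*$, the vertex reached from $u$ by path $mms$ is named $u.\eta(mms)$, where $\eta(mms)=r^{n+1}$ if $s=(rm)^n$, and otherwise $\eta(mms)$ is $s$ with the letters $m$ removed. $\widetilde{(H,w)}$ denotes the pointed graph modulo isomorphism obtained from graph $H$ pointed at vertex $w$. An IMCGD is a causal graph dynamics (shift-invariant, continuous, bounded dynamics $(F,R_\bullet)$ on pointed graphs modulo) over invisible matter graphs that is vertex-preserving ($R_Y$ bijective for all $Y$) and invisible-matter quiescent (there is $b$ such that if the pointer is at depth $|s|\geq b$ in an invisible tree then $R(t)=t$ for all $t\in\{lm,rm\}^*$).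
   Formalization: Continuity of the NCGD is required for all well-named H having the same disk H^m_v = G^m_v (not only H = G), and the NCGD is assumed to map finite graphs to finite graphs; without either of these the claim is false. *)

theory Defs
  imports Main
begin

section \<open>The name algebra\<close>

datatype dir = Lft | Rgt

datatype nterm = TAtom nat | TApp nterm dir | TConj nterm nterm

inductive name_eq :: "nterm \<Rightarrow> nterm \<Rightarrow> bool" where
  left: "name_eq (TApp (TConj u v) Lft) u"
| right: "name_eq (TApp (TConj u v) Rgt) v"
| merge: "name_eq (TConj (TApp u Lft) (TApp u Rgt)) u"
| app: "name_eq u v \<Longrightarrow> name_eq (TApp u d) (TApp v d)"
| conj: "name_eq u u' \<Longrightarrow> name_eq v v' \<Longrightarrow> name_eq (TConj u v) (TConj u' v')"
| refl: "name_eq u u"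
| sym: "name_eq u v \<Longrightarrow> name_eq v u"
| trans: "name_eq u v \<Longrightarrow> name_eq v w \<Longrightarrow> name_eq u w"

quotient_type name = nterm / name_eq
  by (intro equivpI reflpI sympI transpI) (blast intro: name_eq.intros)+

lift_definition atom :: "nat \<Rightarrow> name" is TAtom .

lift_definition napp :: "name \<Rightarrow> dir \<Rightarrow> name" is TApp
  by (rule name_eq.app)

lift_definition nconj :: "name \<Rightarrow> name \<Rightarrow> name"  (infixr "\<sqinter>\<^sub>n" 65) is TConj
  by (rule name_eq.conj)

definition nword :: "name \<Rightarrow> dir list \<Rightarrow> name"  (infixl "\<cdot>" 75) where
  "u \<cdot> t = foldl napp u t"

definition iota :: "name \<Rightarrow> name \<Rightarrow> bool" where
  "iota u v \<longleftrightarrow> (\<exists>t t'. u \<cdot> t = v \<cdot> t')"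

definition iota_set :: "name \<Rightarrow> name set \<Rightarrow> bool" where
  "iota_set u S \<longleftrightarrow> (\<exists>v\<in>S. iota u v)"

text \<open>\<open>cone S\<close> is the set written $S.\{l,r\}^*$.\<close>

definition cone :: "name set \<Rightarrow> name set" where
  "cone S = {u \<cdot> t |u t. u \<in> S}"

definition is_renaming :: "(nat \<Rightarrow> name) \<Rightarrow> bool" where
  "is_renaming \<rho> \<longleftrightarrow> inj \<rho> \<and> (\<forall>x y. x \<noteq> y \<longrightarrow> \<not> iota (\<rho> x) (\<rho> y))"

primrec term_rename :: "(nat \<Rightarrow> name) \<Rightarrow> nterm \<Rightarrow> name" where
  "term_rename \<rho> (TAtom x) = \<rho> x"
| "term_rename \<rho> (TApp u d) = napp (term_rename \<rho> u) d"
| "term_rename \<rho> (TConj u v) = term_rename \<rho> u \<sqinter>\<^sub>n term_rename \<rho> v"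

lemma napp_nconj [simp]: "napp (u \<sqinter>\<^sub>n v) Lft = u" "napp (u \<sqinter>\<^sub>n v) Rgt = v"
  by (transfer, rule name_eq.intros)+

lemma nconj_napp [simp]: "napp u Lft \<sqinter>\<^sub>n napp u Rgt = u"
  by (transfer, rule name_eq.merge)

lift_definition rename :: "(nat \<Rightarrow> name) \<Rightarrow> name \<Rightarrow> name" is term_rename
proof -
  fix \<rho> u v assume "name_eq u v"
  then show "term_rename \<rho> u = term_rename \<rho> v"
    by induction simp_all
qed

section \<open>Graphs\<close>

text \<open>The partial labellings of vertices and edges are kept as single-valued relations, so that
  renaming the vertices of a graph is taking images componentwise.\<close>

record ('v, 'p, 's, 'd) graph =
  verts :: "'v set"
  edges :: "('v \<times> 'p) set set"
  vlabels :: "('v \<times> 's) set"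
  elabels :: "(('v \<times> 'p) set \<times> 'd) set"

fun walk :: "('v, 'p, 's, 'd) graph \<Rightarrow> 'v \<Rightarrow> ('p \<times> 'p) list \<Rightarrow> 'v \<Rightarrow> bool" where
  "walk G u [] v \<longleftrightarrow> u = v \<and> u \<in> verts G"
| "walk G u ((a, b) # p) v \<longleftrightarrow> (\<exists>w. {(u, a), (w, b)} \<in> edges G \<and> walk G w p v)"

definition wf_graph :: "('v, 'p, 's, 'd) graph \<Rightarrow> bool" where
  "wf_graph G \<longleftrightarrow>
     (\<forall>e\<in>edges G. e \<subseteq> verts G \<times> UNIV \<and> card e = 2) \<and>
     (\<forall>e\<in>edges G. \<forall>e'\<in>edges G. e \<noteq> e' \<longrightarrow> e \<inter> e' = {}) \<and>
     vlabels G \<subseteq> verts G \<times> UNIV \<and> single_valued (vlabels G) \<and>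
     elabels G \<subseteq> edges G \<times> UNIV \<and> single_valued (elabels G) \<and>
     (\<forall>u\<in>verts G. \<forall>v\<in>verts G. \<exists>p. walk G u p v)"

definition gmap :: "('v \<Rightarrow> 'w) \<Rightarrow> ('v, 'p, 's, 'd) graph \<Rightarrow> ('w, 'p, 's, 'd) graph" where
  "gmap f G =
     \<lparr>verts = f ` verts G,
      edges = image (map_prod f id) ` edges G,
      vlabels = map_prod f id ` vlabels G,
      elabels = map_prod (image (map_prod f id)) id ` elabels G\<rparr>"

definition gball :: "('v, 'p, 's, 'd) graph \<Rightarrow> nat \<Rightarrow> 'v \<Rightarrow> 'v set" where
  "gball G n v = {w \<in> verts G. \<exists>p. walk G v p w \<and> length p \<le> n}"

definition disk :: "('v, 'p, 's, 'd) graph \<Rightarrow> nat \<Rightarrow> 'v \<Rightarrow> ('v, 'p, 's, 'd) graph" where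
  "disk G n v =
     \<lparr>verts = gball G n v,
      edges = {e \<in> edges G. fst ` e \<subseteq> gball G n v},
      vlabels = {(w, s) \<in> vlabels G. w \<in> gball G n v},
      elabels = {(e, d) \<in> elabels G. fst ` e \<subseteq> gball G n v}\<rparr>"

section \<open>Name-preserving dynamics over well-named graphs\<close>

type_synonym ('p, 's, 'd) ngraph = "(name, 'p, 's, 'd) graph"

definition well_named :: "('p, 's, 'd) ngraph \<Rightarrow> bool" where
  "well_named G \<longleftrightarrow>
     (\<forall>v\<in>verts G. \<forall>v'\<in>verts G. \<forall>t t'. v \<cdot> t = v' \<cdot> t' \<longrightarrow> v = v' \<and> t = t')"

definition WN :: "('p, 's, 'd) ngraph set" where
  "WN = {G. wf_graph G \<and> well_named G}"

text \<open>An injective map with non-intersectant images may still send an atom \<open>x\<close> to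
  \<open>y \<sqinter>\<^sub>n y\<close>, and then the renamed graph need not be well-named. The dynamics is a function
  over \<open>WN\<close> only, hence the second membership condition.\<close>

definition named_shift_invariant ::
  "(('p, 's, 'd) ngraph \<Rightarrow> ('p, 's, 'd) ngraph) \<Rightarrow> bool" where
  "named_shift_invariant F \<longleftrightarrow>
     (\<forall>\<rho>. is_renaming \<rho> \<longrightarrow>
        (\<forall>G\<in>WN. gmap (rename \<rho>) G \<in> WN \<longrightarrow>
           F (gmap (rename \<rho>) G) = gmap (rename \<rho>) (F G)))"

text \<open>For \<open>H = G\<close> the equation says that \<open>F G\<close> around \<open>v'\<close> is computed from the disk of \<open>G\<close>
  around \<open>v\<close>. Demanding it for all \<open>H\<close> with that same disk makes this continuity in the usual sense
  (nearby graphs have nearby images). The instance \<open>H = G\<close> alone only compares \<open>G\<close> with its own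
  truncations; it is void on finite graphs, where the radius may be taken to be the diameter.\<close>

definition named_continuous ::
  "(('p, 's, 'd) ngraph \<Rightarrow> ('p, 's, 'd) ngraph) \<Rightarrow> bool" where
  "named_continuous F \<longleftrightarrow>
     (\<forall>G\<in>WN. \<forall>n. \<exists>m. \<forall>H\<in>WN. \<forall>v\<in>verts G. \<forall>v'\<in>verts (F H).
        iota v v' \<longrightarrow> disk H m v = disk G m v \<longrightarrow>
        disk (F H) n v' = disk (F (disk G m v)) n v')"

definition name_preserving ::
  "(('p, 's, 'd) ngraph \<Rightarrow> ('p, 's, 'd) ngraph) \<Rightarrow> bool" where
  "name_preserving F \<longleftrightarrow>
     (\<forall>G\<in>WN. \<forall>u. iota_set u (verts G) \<longleftrightarrow> iota_set u (verts (F G)))"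

definition NCGD :: "(('p, 's, 'd) ngraph \<Rightarrow> ('p, 's, 'd) ngraph) \<Rightarrow> bool" where
  "NCGD F \<longleftrightarrow> (\<forall>G\<in>WN. F G \<in> WN) \<and>
     named_shift_invariant F \<and> named_continuous F \<and> name_preserving F"

definition NCGD_invertible :: "(('p, 's, 'd) ngraph \<Rightarrow> ('p, 's, 'd) ngraph) \<Rightarrow> bool" where
  "NCGD_invertible F \<longleftrightarrow> bij_betw F WN WN"

text \<open>Not a consequence of \<open>NCGD\<close>: sending every graph with a single vertex \<open>u\<close> to an infinite ray
  with vertices \<open>u.l, u.rl, u.rrl, \<dots>\<close> (joined through two fixed ports), and every other graph
  to itself, is shift-invariant,
  continuous and name-preserving.\<close>

definition preserves_finiteness ::
  "(('p, 's, 'd) ngraph \<Rightarrow> ('p, 's, 'd) ngraph) \<Rightarrow> bool" where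
  "preserves_finiteness F \<longleftrightarrow> (\<forall>G\<in>WN. finite (verts G) \<longrightarrow> finite (verts (F G)))"

section \<open>Pointed graphs modulo isomorphism\<close>

text \<open>A pointed graph modulo is the class of all isomorphic pointed graphs with vertices in
  \<open>name\<close>. Graphs are countable, so every one of them has a copy there. A vertex of a pointed graph
  modulo is an equivalence class of paths from the pointer, two paths being equivalent when they
  lead to the same vertex.\<close>

type_synonym ('p, 's, 'd) pgm = "(('p, 's, 'd) ngraph \<times> name) set"
type_synonym 'p vertex = "('p \<times> 'p) list set"

definition tilde :: "('v, 'p, 's, 'd) graph \<times> 'v \<Rightarrow> ('p, 's, 'd) pgm" where
  "tilde = (\<lambda>(H, w). {(gmap f H, f w) |f. inj_on f (verts H)})"

definition paths :: "('p, 's, 'd) pgm \<Rightarrow> ('p \<times> 'p) list set" where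
  "paths X = {p. \<exists>(G, v)\<in>X. \<exists>w. walk G v p w}"

definition vtx :: "('p, 's, 'd) pgm \<Rightarrow> ('p \<times> 'p) list \<Rightarrow> 'p vertex" where
  "vtx X p = {q. \<exists>(G, v)\<in>X. \<exists>w. walk G v p w \<and> walk G v q w}"

definition pverts :: "('p, 's, 'd) pgm \<Rightarrow> 'p vertex set" where
  "pverts X = vtx X ` paths X"

definition shift :: "('p, 's, 'd) pgm \<Rightarrow> 'p vertex \<Rightarrow> ('p, 's, 'd) pgm" where
  "shift X u = {(G, w) |G v w p. (G, v) \<in> X \<and> p \<in> u \<and> walk G v p w}"

definition vconcat :: "('p, 's, 'd) pgm \<Rightarrow> 'p vertex \<Rightarrow> 'p vertex \<Rightarrow> 'p vertex" where
  "vconcat X u v = (\<Union>p\<in>u. \<Union>q\<in>v. vtx X (p @ q))"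

definition pdisk :: "('p, 's, 'd) pgm \<Rightarrow> nat \<Rightarrow> ('p, 's, 'd) pgm" where
  "pdisk X n = (\<Union>(G, v)\<in>X. tilde (disk G n v, v))"

text \<open>The image of the vertices of \<open>pdisk X n\<close> under the inclusion into those of \<open>X\<close>.\<close>

definition near :: "('p, 's, 'd) pgm \<Rightarrow> nat \<Rightarrow> 'p vertex set" where
  "near X n = {x \<in> pverts X. \<exists>p\<in>x. length p \<le> n}"

section \<open>Causal graph dynamics over a set of pointed graphs modulo\<close>

type_synonym ('p, 's, 'd) gfun = "('p, 's, 'd) pgm \<Rightarrow> ('p, 's, 'd) pgm"
type_synonym ('p, 's, 'd) vfun = "('p, 's, 'd) pgm \<Rightarrow> 'p vertex \<Rightarrow> 'p vertex"

definition dynamics_over ::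
  "('p, 's, 'd) pgm set \<Rightarrow> ('p, 's, 'd) gfun \<Rightarrow> ('p, 's, 'd) vfun \<Rightarrow> bool" where
  "dynamics_over D F R \<longleftrightarrow> (\<forall>X\<in>D. F X \<in> D \<and> R X ` pverts X \<subseteq> pverts (F X))"

definition shift_invariant ::
  "('p, 's, 'd) pgm set \<Rightarrow> ('p, 's, 'd) gfun \<Rightarrow> ('p, 's, 'd) vfun \<Rightarrow> bool" where
  "shift_invariant D F R \<longleftrightarrow>
     (\<forall>X\<in>D. \<forall>u\<in>pverts X.
        F (shift X u) = shift (F X) (R X u) \<and>
        (\<forall>v\<in>pverts (shift X u).
           R X (vconcat X u v) = vconcat (F X) (R X u) (R (shift X u) v)))"

text \<open>Let \<open>R\<^sup>m\<close> be the restriction of \<open>R X\<close> to the codomain \<open>pdisk (F X) m\<close>. The last three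
  conjuncts say that its domain, for \<open>X\<close> and for \<open>X'\<close>, is contained in the disk of radius \<open>n\<close>, and
  that the two restrictions agree once vertices of \<open>X\<close> and of \<open>X'\<close> (and of their images) are
  identified through the common disk.\<close>

definition continuous_dyn ::
  "('p, 's, 'd) pgm set \<Rightarrow> ('p, 's, 'd) gfun \<Rightarrow> ('p, 's, 'd) vfun \<Rightarrow> bool" where
  "continuous_dyn D F R \<longleftrightarrow>
     (\<forall>X\<in>D. \<forall>m. \<exists>n. \<forall>X'\<in>D. pdisk X' n = pdisk X n \<longrightarrow>
        pdisk (F X') m = pdisk (F X) m \<and>
        (\<forall>x\<in>pverts X. R X x \<in> near (F X) m \<longrightarrow> x \<in> near X n) \<and>
        (\<forall>x\<in>pverts X'. R X' x \<in> near (F X') m \<longrightarrow> x \<in> near X' n) \<and>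
        (\<forall>p\<in>paths (pdisk X n). \<forall>q\<in>paths (pdisk (F X) m).
           R X (vtx X p) = vtx (F X) q \<longleftrightarrow> R X' (vtx X' p) = vtx (F X') q))"

definition bounded_dyn ::
  "('p, 's, 'd) pgm set \<Rightarrow> ('p, 's, 'd) gfun \<Rightarrow> ('p, 's, 'd) vfun \<Rightarrow> bool" where
  "bounded_dyn D F R \<longleftrightarrow>
     (\<exists>b. \<forall>X\<in>D. \<forall>w\<in>pverts (F X).
        \<exists>u\<in>R X ` pverts X. \<exists>v\<in>near (shift (F X) u) b. w = vconcat (F X) u v)"

definition CGD_over ::
  "('p, 's, 'd) pgm set \<Rightarrow> ('p, 's, 'd) gfun \<Rightarrow> ('p, 's, 'd) vfun \<Rightarrow> bool" where
  "CGD_over D F R \<longleftrightarrow> dynamics_over D F R \<and>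
     shift_invariant D F R \<and> continuous_dyn D F R \<and> bounded_dyn D F R"

definition vertex_preserving ::
  "('p, 's, 'd) pgm set \<Rightarrow> ('p, 's, 'd) gfun \<Rightarrow> ('p, 's, 'd) vfun \<Rightarrow> bool" where
  "vertex_preserving D F R \<longleftrightarrow> (\<forall>X\<in>D. bij_betw (R X) (pverts X) (pverts (F X)))"

text \<open>Bijectivity of \<open>R\<close> is not part of invertibility.\<close>

definition invertible_over ::
  "('p, 's, 'd) pgm set \<Rightarrow> ('p, 's, 'd) gfun \<Rightarrow> ('p, 's, 'd) vfun \<Rightarrow> bool" where
  "invertible_over D F R \<longleftrightarrow> bij_betw F D D"

section \<open>Invisible matter\<close>

datatype 'p xport = VPort 'p | PM | PL | PR
datatype 's xlabel = VLabel 's | Matter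

fun dport :: "dir \<Rightarrow> 'p xport" where
  "dport Lft = PL"
| "dport Rgt = PR"

text \<open>Vertex \<open>(u, None)\<close> is the visible vertex \<open>u\<close>, and \<open>(u, Some s)\<close> is the tree vertex reached
  from \<open>u\<close> by the path \<open>mm\<close> followed by the path in $\{lm, rm\}^*$ spelt by \<open>s\<close>.\<close>

definition attach ::
  "('v, 'p, 's, 'd) graph \<Rightarrow> ('v \<times> dir list option, 'p xport, 's xlabel, 'd) graph" where
  "attach G =
     (let vis = image (map_prod (\<lambda>u. (u, None)) VPort) in
     \<lparr>verts = verts G \<times> UNIV,
      edges = vis ` edges G
        \<union> {{((u, None), PM), ((u, Some []), PM)} |u. u \<in> verts G}
        \<union> {{((u, Some s), dport d), ((u, Some (s @ [d])), PM)} |u s d. u \<in> verts G},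
      vlabels = {((u, None), VLabel a) |u a. (u, a) \<in> vlabels G}
        \<union> {((u, Some s), Matter) |u s. u \<in> verts G},
      elabels = {(vis e, c) |e c. (e, c) \<in> elabels G}\<rparr>)"

fun eta :: "dir list option \<Rightarrow> dir list" where
  "eta None = []"
| "eta (Some s) =
     (if s = replicate (length s) Rgt then replicate (Suc (length s)) Rgt else s)"

text \<open>The graph written $G'$.\<close>

definition prime :: "('p, 's, 'd) ngraph \<Rightarrow> ('p xport, 's xlabel, 'd) ngraph" where
  "prime G = gmap (\<lambda>(u, s). u \<cdot> eta s) (attach G)"

definition IM :: "('p xport, 's xlabel, 'd) pgm set" where
  "IM = {tilde (attach G, x) |(G :: ('p, 's, 'd) ngraph) x. wf_graph G \<and> x \<in> verts (attach G)}"

definition tree_path :: "dir list \<Rightarrow> ('p xport \<times> 'p xport) list" where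
  "tree_path t = map (\<lambda>d. (dport d, PM)) t"

definition IM_quiescent ::
  "('p xport, 's xlabel, 'd) gfun \<Rightarrow> ('p xport, 's xlabel, 'd) vfun \<Rightarrow> bool" where
  "IM_quiescent F R \<longleftrightarrow>
     (\<exists>b. \<forall>G :: ('p, 's, 'd) ngraph. \<forall>u s t.
        wf_graph G \<longrightarrow> u \<in> verts G \<longrightarrow> length s \<ge> b \<longrightarrow>
        (let X = tilde (attach G, (u, Some s))
         in R X (vtx X (tree_path t)) = vtx (F X) (tree_path t)))"

definition IMCGD ::
  "('p xport, 's xlabel, 'd) gfun \<Rightarrow> ('p xport, 's xlabel, 'd) vfun \<Rightarrow> bool" where
  "IMCGD F R \<longleftrightarrow> CGD_over IM F R \<and> vertex_preserving IM F R \<and> IM_quiescent F R"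

text \<open>The path between two vertices is determined up to equivalence of paths, that is, as a vertex
  of the graph pointed at the first one.\<close>

definition path_between :: "('v, 'p, 's, 'd) graph \<Rightarrow> 'v \<Rightarrow> 'v \<Rightarrow> 'p vertex" where
  "path_between H x y = {q. walk H x q y}"

definition induced_by ::
  "(('p, 's, 'd) ngraph \<Rightarrow> ('p, 's, 'd) ngraph) \<Rightarrow> (('p, 's, 'd) ngraph \<Rightarrow> name \<Rightarrow> name) \<Rightarrow>
   ('p xport, 's xlabel, 'd) gfun \<Rightarrow> ('p xport, 's xlabel, 'd) vfun \<Rightarrow> bool" where
  "induced_by Fn Rn F R \<longleftrightarrow>
     (\<forall>G\<in>WN. \<forall>x\<in>cone (verts G).
        F (tilde (prime G, x)) = tilde (prime (Fn G), Rn G x) \<and>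
        (\<forall>p y. walk (prime G) x p y \<longrightarrow>
           R (tilde (prime G, x)) (vtx (tilde (prime G, x)) p) =
             path_between (prime (Fn G)) (Rn G x) (Rn G y)))"

end

theory Submission
  imports Defs "HOL-Library.Stream" "HOL-Library.Countable_Set" "HOL-Library.Infinite_Set"
begin

text \<open>
  A name is a homeomorphism from the Cantor space of infinite words over \<open>{l, r}\<close> onto a clopen set of
  points \<open>(atom, infinite word)\<close>, and two names are intersectant iff these sets meet. Continuity reduces
  name preservation to finite disks, where preservation of finiteness and compactness of clopen sets
  show that deep words below the vertices of \<open>G\<close> are also words below the vertices of \<open>F G\<close>, and conversely.

  A position in the invisible tree of \<open>u\<close> corresponds to a point of \<open>u\<close> that ends in \<open>r r r \<dots>\<close>: the tree
  vertex reached by \<open>s\<close> to \<open>u.s l r r r \<dots>\<close>, and \<open>u\<close> itself to \<open>u.r r r \<dots>\<close>. The graphs \<open>G\<close> and \<open>F G\<close> have the same such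
  points, which yields the bijection between positions. It does not depend on the graphs beyond
  their vertex names, hence is local and commutes with renamings, and it maps subtrees to subtrees
  as soon as \<open>u.s = v.t\<close> for a vertex \<open>v\<close> of \<open>F G\<close>.

  Naming vertices by least shortest paths from a base vertex makes isomorphic pointed graphs equal, so the dynamics on
  pointed graphs modulo is well defined. Since disks in these names range over a finite set, a limit
  graph (Koenig's lemma) bounds the depth at which \<open>u.s\<close> becomes a word below \<open>F G\<close> uniformly in \<open>G\<close>.
\<close>

section \<open>The name algebra\<close>

text \<open>Preservation of finiteness guards against a gap. If a vertex \<open>u\<close> became the
  infinite family \<open>u.l\<close>, \<open>u.rl\<close>, \<open>u.rrl\<close>, ..., every name
  meeting \<open>u\<close> would still meet a vertex, but no vertex would cover the point
  \<open>u.r r r ...\<close>, and the position of \<open>u\<close> itself would have no partner. A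
  cover of a compact set by finitely many clopen sets leaves no such gap. Points ending in
  \<open>r r r ...\<close> are chosen because they have a normal form: a word that is empty or ends
  in \<open>l\<close>, followed by \<open>r\<close> forever. These normal forms are exactly the
  visible vertex and the vertices of its tree. Shift invariance speaks of maps on atoms, whereas an
  isomorphism of graphs is a map on vertex names, which may be composite. Isomorphic graphs are
  therefore compared through a third graph named by atoms. Continuity gives one radius for each
  graph, while quiescence asks for one depth for all graphs at once; only this uniformity calls for
  a limit graph.\<close>

lemma nword_Nil [simp]: "u \<cdot> [] = u"
  by (simp add: nword_def)

lemma nword_Cons: "u \<cdot> (d # t) = napp u d \<cdot> t"
  by (simp add: nword_def)

lemma nword_append: "u \<cdot> (s @ t) = u \<cdot> s \<cdot> t"
  by (simp add: nword_def)

lemma nword_nconj [simp]: "(u \<sqinter>\<^sub>n v) \<cdot> (Lft # t) = u \<cdot> t" "(u \<sqinter>\<^sub>n v) \<cdot> (Rgt # t) = v \<cdot> t"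
  by (simp_all add: nword_Cons)

text \<open>Names act on points of the Cantor space \<open>dir stream\<close>; this model shows that atoms are free.\<close>

primrec tpoint :: "nterm \<Rightarrow> dir stream \<Rightarrow> nat \<times> dir stream" where
  "tpoint (TAtom x) \<alpha> = (x, \<alpha>)"
| "tpoint (TApp u d) \<alpha> = tpoint u (d ## \<alpha>)"
| "tpoint (TConj u v) \<alpha> = (if shd \<alpha> = Lft then tpoint u (stl \<alpha>) else tpoint v (stl \<alpha>))"

lift_definition npoint :: "name \<Rightarrow> dir stream \<Rightarrow> nat \<times> dir stream" is tpoint
proof -
  fix u v assume "name_eq u v"
  then show "tpoint u = tpoint v"
  proof induction
    case (merge u)
    have "shd \<alpha> \<noteq> Lft \<Longrightarrow> Rgt = shd \<alpha>" for \<alpha> by (cases "shd \<alpha>") auto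
    then show ?case by (auto simp: fun_eq_iff) (metis stream.collapse)+
  qed (auto simp: fun_eq_iff)
qed

lemma npoint_atom [simp]: "npoint (atom x) \<alpha> = (x, \<alpha>)"
  by transfer simp

lemma npoint_napp [simp]: "npoint (napp u d) \<alpha> = npoint u (d ## \<alpha>)"
  by transfer simp

lemma npoint_nword [simp]: "npoint (u \<cdot> t) \<alpha> = npoint u (t @- \<alpha>)"
  by (induction t arbitrary: u) (auto simp: nword_Cons)

text \<open>If one word ended first, the next letter of the other would be the head of every stream;
  the two constant streams refute this.\<close>

lemma stream_prefix_inj:
  assumes "\<And>\<alpha> :: dir stream. s @- \<alpha> = t @- \<alpha>"
  shows "s = t"
  using assms
proof (induction s arbitrary: t)
  case Nil
  show ?case
  proof (cases t)
    case (Cons d t')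
    have "shd \<alpha> = d" for \<alpha> :: "dir stream"
      using Nil[of \<alpha>] Cons by (metis shift.simps(1,2) stream.sel(1))
    from this[of "sconst Lft"] this[of "sconst Rgt"] show ?thesis by simp
  qed simp
next
  case (Cons d s)
  show ?case
  proof (cases t)
    case Nil
    have "shd \<alpha> = d" for \<alpha> :: "dir stream"
      using Cons.prems[of \<alpha>] Nil by (metis shift.simps(1,2) stream.sel(1))
    from this[of "sconst Lft"] this[of "sconst Rgt"] show ?thesis by simp
  next
    case (Cons d' t')
    then have "d = d'" "\<And>\<alpha>. s @- \<alpha> = t' @- \<alpha>"
      using Cons.prems by auto
    with Cons.IH Cons show ?thesis by auto
  qed
qed

lemma atom_nword_eq_iff [simp]: "atom x \<cdot> s = atom y \<cdot> t \<longleftrightarrow> x = y \<and> s = t"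
proof
  assume "atom x \<cdot> s = atom y \<cdot> t"
  then have "npoint (atom x \<cdot> s) \<alpha> = npoint (atom y \<cdot> t) \<alpha>" for \<alpha> by simp
  then show "x = y \<and> s = t" by (auto intro: stream_prefix_inj)
qed simp

lemma atom_eq_iff [simp]: "atom x = atom y \<longleftrightarrow> x = y"
  using atom_nword_eq_iff[of x "[]" y "[]"] by simp

section \<open>Deep words below a name, and coverage by finite sets\<close>

lemma name_induct [case_names atom napp nconj]:
  assumes "\<And>x. P (atom x)" "\<And>u d. P u \<Longrightarrow> P (napp u d)"
    "\<And>u v. P u \<Longrightarrow> P v \<Longrightarrow> P (u \<sqinter>\<^sub>n v)"
  shows "P u"
proof -
  have "P (abs_name t)" for t
  proof (induction t)
    case (TAtom x)
    show ?case using assms(1)[of x] by (simp add: atom.abs_eq)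
  next
    case (TApp t d)
    then show ?case using assms(2)[of "abs_name t" d] by (simp add: napp.abs_eq)
  next
    case (TConj t u)
    then show ?case using assms(3)[of "abs_name t" "abs_name u"] by (simp add: nconj.abs_eq)
  qed
  then show ?thesis by (metis Quotient_abs_rep Quotient_name)
qed

text \<open>Each pair consumes a letter and \<open>napp\<close> merely prepends one, so every
  sufficiently long word runs out of pairs. In the Cantor picture this cuts the clopen set of
  \<open>u\<close> into cylinders.\<close>

lemma deep_nword_atomic:
  "\<exists>n. \<forall>t. length t \<ge> n \<longrightarrow> (\<exists>x w. u \<cdot> t = atom x \<cdot> w)"
proof (induction u rule: name_induct)
  case (atom x)
  then show ?case by blast
next
  case (napp u d)
  then obtain n where n: "\<And>t. length t \<ge> n \<Longrightarrow> \<exists>x w. u \<cdot> t = atom x \<cdot> w" by blast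
  have "\<exists>x w. napp u d \<cdot> t = atom x \<cdot> w" if "length t \<ge> n" for t
    using n[of "d # t"] that by (simp add: nword_Cons)
  then show ?case by blast
next
  case (nconj u v)
  then obtain n m where n: "\<And>t. length t \<ge> n \<Longrightarrow> \<exists>x w. u \<cdot> t = atom x \<cdot> w"
    and m: "\<And>t. length t \<ge> m \<Longrightarrow> \<exists>x w. v \<cdot> t = atom x \<cdot> w" by metis
  have "\<exists>x w. (u \<sqinter>\<^sub>n v) \<cdot> t = atom x \<cdot> w" if "length t \<ge> Suc (n + m)" for t
  proof (cases t)
    case Nil
    with that show ?thesis by simp
  next
    case (Cons d s)
    with that n[of s] m[of s] show ?thesis by (cases d) auto
  qed
  then show ?case by blast
qed

text \<open>The merge rule rebuilds a name from its two halves, so a name is determined by its words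
  of any one length. Equations between names can thus be checked at whatever depth is
  convenient.\<close>

lemma nword_ext:
  assumes "\<And>t. length t = n \<Longrightarrow> u \<cdot> t = v \<cdot> t"
  shows "u = v"
  using assms
proof (induction n arbitrary: u v)
  case 0
  then show ?case by fastforce
next
  case (Suc n)
  have "napp u d = napp v d" for d
    by (rule Suc.IH) (use Suc.prems[of "d # _"] in \<open>simp add: nword_Cons\<close>)
  then show ?case by (metis nconj_napp)
qed

lemma iota_sym: "iota u v \<Longrightarrow> iota v u"
  by (auto simp: iota_def) metis

lemma iota_refl: "iota u u"
  by (auto simp: iota_def)

lemma iotaI: "u \<cdot> s = v \<cdot> t \<Longrightarrow> iota u v"
  by (auto simp: iota_def)

lemma iota_setI: "v \<in> S \<Longrightarrow> u \<cdot> s = v \<cdot> t \<Longrightarrow> iota_set u S"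
  by (auto simp: iota_set_def iota_def)

lemma coneI: "v \<in> S \<Longrightarrow> v \<cdot> t \<in> cone S"
  by (auto simp: cone_def)

lemma coneE:
  assumes "x \<in> cone S"
  obtains v t where "v \<in> S" "x = v \<cdot> t"
  using assms by (auto simp: cone_def)

lemma cone_mono: "S \<subseteq> T \<Longrightarrow> cone S \<subseteq> cone T"
  by (auto simp: cone_def)

lemma uniform_atomic_depth:
  assumes "finite S"
  shows "\<exists>n. \<forall>u\<in>S. \<forall>t. length t \<ge> n \<longrightarrow> (\<exists>x w. u \<cdot> t = atom x \<cdot> w)"
proof -
  obtain f where f: "\<And>u t. length t \<ge> f u \<Longrightarrow> \<exists>x w. u \<cdot> t = atom x \<cdot> w"
    using deep_nword_atomic by metis
  have "f u \<le> Max (f ` S)" if "u \<in> S" for u using assms that by simp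
  then show ?thesis using f by (metis le_trans)
qed

lemma finite_dir_UNIV: "finite (UNIV :: dir set)"
proof -
  have "d \<in> {Lft, Rgt}" for d by (cases d) auto
  then have "(UNIV :: dir set) = {Lft, Rgt}" by auto
  then show ?thesis by (metis finite.emptyI finite_insert)
qed

lemma finite_words: "finite {t :: dir list. length t = n}"
  using finite_lists_length_eq[OF finite_dir_UNIV, of n] by simp

text \<open>Every branch below \<open>v\<close> has entered the cone of \<open>T\<close> by a
  bounded depth: the form in which coverage of the clopen set of \<open>v\<close> by
  \<open>T\<close> is used. The depth may depend on \<open>v\<close>, since \<open>S\<close> may be
  infinite.\<close>

definition absorbs :: "name set \<Rightarrow> name set \<Rightarrow> bool" where
  "absorbs S T \<longleftrightarrow> (\<forall>v\<in>S. \<exists>b. \<forall>s. length s \<ge> b \<longrightarrow> v \<cdot> s \<in> cone T)"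

text \<open>All words issuing from a finite set eventually have the form \<open>x.w\<close> with an atom \<open>x\<close>, where
  intersection means comparability of prefixes.\<close>

lemma finite_iota_absorbs:
  assumes "finite S" "finite T" and iota: "\<And>u. iota_set u S \<Longrightarrow> iota_set u T"
  shows "absorbs S T"
proof -
  obtain n where n: "\<And>u t. u \<in> S \<union> T \<Longrightarrow> length t \<ge> n \<Longrightarrow> \<exists>x w. u \<cdot> t = atom x \<cdot> w"
    using uniform_atomic_depth[of "S \<union> T"] assms by blast
  then obtain X W where XW: "\<And>u t. u \<in> S \<union> T \<Longrightarrow> length t \<ge> n \<Longrightarrow> u \<cdot> t = atom (X u t) \<cdot> (W u t)"
    by metis
  \<comment> \<open>\<open>M\<close> bounds the remainders behind the atoms for the names of
    \<open>T\<close> at depth \<open>n\<close>. A word of \<open>S\<close> with \<open>M\<close>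
    letters to spare has a remainder at least as long, so of two comparable remainders the one from
    \<open>T\<close> is the prefix.\<close>
  define M where "M = Max ((\<lambda>(u, t). length (W u t)) ` (T \<times> {t. length t = n}))"
  have M: "length (W u t) \<le> M" if "u \<in> T" "length t = n" for u t
    unfolding M_def using that assms finite_words[of n] by (intro Max_ge) auto
  have "v \<cdot> s \<in> cone T" if v: "v \<in> S" and s: "length s \<ge> n + M" for v s
  proof -
    define a c where "a = take n s" and "c = drop n s"
    have ac: "s = a @ c" "length a = n" "length c \<ge> M" using s by (auto simp: a_def c_def)
    have vs: "v \<cdot> s = atom (X v a) \<cdot> (W v a @ c)"
      using ac XW[of v a] v by (simp add: nword_append)
    have "iota_set (v \<cdot> s) S" using v by (intro iota_setI[of v _ _ "[]" "s"]) auto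
    then have "iota_set (v \<cdot> s) T" by (rule iota)
    then obtain u t t' where u: "u \<in> T" "v \<cdot> s \<cdot> t = u \<cdot> t'" by (auto simp: iota_set_def iota_def)
    \<comment> \<open>Padding by \<open>n\<close> letters makes the word below \<open>u\<close> long
      enough to be split at depth \<open>n\<close>, where an atom appears.\<close>
    define e where "e = t' @ replicate n Lft"
    have e: "v \<cdot> s \<cdot> (t @ replicate n Lft) = u \<cdot> e" "length e \<ge> n"
      using u by (auto simp: e_def nword_append)
    define f g where "f = take n e" and "g = drop n e"
    have fg: "e = f @ g" "length f = n" using e by (auto simp: f_def g_def)
    have "atom (X v a) \<cdot> (W v a @ c @ t @ replicate n Lft) = atom (X u f) \<cdot> (W u f @ g)"
      using e fg XW[of u f] u vs by (simp add: nword_append)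
    then have eq: "X v a = X u f" "W v a @ c @ t @ replicate n Lft = W u f @ g" by auto
    have "length (W u f) \<le> length (W v a @ c)" using M[OF u(1) fg(2)] ac by simp
    then have "\<exists>k. W v a @ c = W u f @ k"
      using eq(2) by (metis append_assoc append_eq_append_conv_if append_take_drop_id)
    then obtain k where "W v a @ c = W u f @ k" by blast
    then have "v \<cdot> s = u \<cdot> (f @ k)"
      using vs eq(1) XW[of u f] u fg by (simp add: nword_append)
    then show ?thesis using u by (simp add: coneI)
  qed
  then show ?thesis by (auto simp: absorbs_def)
qed

text \<open>The atoms met by \<open>u\<close> are those occurring in its words of length
  \<open>n\<close>. Finitely many names thus leave infinitely many atoms free, which is the room
  needed to complete a renaming.\<close>

lemma finite_iota_atoms: "finite {x. iota u (atom x)}"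
proof -
  obtain n where "\<And>t. length t \<ge> n \<Longrightarrow> \<exists>x w. u \<cdot> t = atom x \<cdot> w"
    using deep_nword_atomic by blast
  then obtain X W where XW: "\<And>t. length t \<ge> n \<Longrightarrow> u \<cdot> t = atom (X t) \<cdot> (W t)" by metis
  have "{x. iota u (atom x)} \<subseteq> X ` {t. length t = n}"
  proof
    fix x assume "x \<in> {x. iota u (atom x)}"
    then obtain t t' where "u \<cdot> t = atom x \<cdot> t'" by (auto simp: iota_def)
    then have e: "u \<cdot> (t @ replicate n Lft) = atom x \<cdot> (t' @ replicate n Lft)"
      by (simp add: nword_append)
    define a c where "a = take n (t @ replicate n Lft)" and "c = drop n (t @ replicate n Lft)"
    have ac: "t @ replicate n Lft = a @ c" "length a = n" by (simp_all add: a_def c_def del: take_append drop_append)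
    have "atom (X a) \<cdot> (W a @ c) = atom x \<cdot> (t' @ replicate n Lft)"
      using e XW[of a] unfolding ac(1) by (simp add: nword_append ac(2))
    then have "X a = x" by simp
    then show "x \<in> X ` {t. length t = n}" using ac by auto
  qed
  then show ?thesis using finite_words finite_surj by blast
qed

section \<open>Independent sets of names and renamings\<close>

definition independent :: "name set \<Rightarrow> bool" where
  "independent S \<longleftrightarrow> (\<forall>v\<in>S. \<forall>v'\<in>S. \<forall>t t'. v \<cdot> t = v' \<cdot> t' \<longrightarrow> v = v' \<and> t = t')"

lemma well_named_iff: "well_named G \<longleftrightarrow> independent (verts G)"
  by (simp add: well_named_def independent_def)

lemma independentD:
  "independent S \<Longrightarrow> v \<cdot> t = v' \<cdot> t' \<Longrightarrow> v \<in> S \<Longrightarrow> v' \<in> S \<Longrightarrow> v = v' \<and> t = t'"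
  by (auto simp: independent_def)

lemma independent_atoms: "S \<subseteq> range atom \<Longrightarrow> independent S"
  unfolding independent_def by (metis atom_nword_eq_iff imageE subsetD)

lemma independent_subset: "independent T \<Longrightarrow> S \<subseteq> T \<Longrightarrow> independent S"
  unfolding independent_def by blast

lemma rename_atom [simp]: "rename \<rho> (atom x) = \<rho> x"
  by transfer simp

lemma rename_napp [simp]: "rename \<rho> (napp u d) = napp (rename \<rho> u) d"
  by transfer simp

lemma rename_nword [simp]: "rename \<rho> (u \<cdot> t) = rename \<rho> u \<cdot> t"
  by (induction t arbitrary: u) (auto simp: nword_Cons)

text \<open>The map \<open>rename \<rho>\<close> is not assumed injective on all names. Injectivity
  on \<open>T\<close> passes to words below \<open>S\<close> by prolonging both words into the cone
  of \<open>T\<close> and returning with \<open>nword_ext\<close>.\<close>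

lemma absorbs_rename_inj:
  assumes ab: "absorbs S T" and T: "independent (rename \<rho> ` T)" "inj_on (rename \<rho>) T"
    and uv: "u \<in> cone S" "v \<in> cone S" "rename \<rho> u = rename \<rho> v"
  shows "u = v"
proof -
  obtain u0 v0 s t where st: "u0 \<in> S" "u = u0 \<cdot> s" "v0 \<in> S" "v = v0 \<cdot> t"
    using uv by (auto elim!: coneE)
  then obtain b b' where b: "\<And>s. length s \<ge> b \<Longrightarrow> u0 \<cdot> s \<in> cone T" "\<And>s. length s \<ge> b' \<Longrightarrow> v0 \<cdot> s \<in> cone T"
    using ab unfolding absorbs_def by metis
  show ?thesis
  proof (rule nword_ext)
    fix w :: "dir list" assume w: "length w = b + b'"
    then have "u \<cdot> w \<in> cone T" "v \<cdot> w \<in> cone T"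
      using st b by (auto simp flip: nword_append)
    then obtain a c a' c' where ac: "a \<in> T" "u \<cdot> w = a \<cdot> c" "a' \<in> T" "v \<cdot> w = a' \<cdot> c'"
      by (auto elim!: coneE)
    have "rename \<rho> (u \<cdot> w) = rename \<rho> (v \<cdot> w)" using uv by simp
    then have "rename \<rho> a \<cdot> c = rename \<rho> a' \<cdot> c'" using ac by simp
    then have "rename \<rho> a = rename \<rho> a'" "c = c'"
      using T(1) ac unfolding independent_def by blast+
    then show "u \<cdot> w = v \<cdot> w" using T(2) ac by (auto dest: inj_onD)
  qed
qed

lemma absorbs_rename_independent:
  assumes ab: "absorbs S T" and T: "independent (rename \<rho> ` T)" "inj_on (rename \<rho>) T"
    and S: "independent S"
  shows "independent (rename \<rho> ` S)" "inj_on (rename \<rho>) S"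
proof -
  note inj = absorbs_rename_inj[OF ab T]
  show "inj_on (rename \<rho>) S"
    using inj coneI[of _ S "[]"] by (auto intro!: inj_onI)
  show "independent (rename \<rho> ` S)"
    unfolding independent_def
  proof (safe)
    fix u v t t' assume uv: "u \<in> S" "v \<in> S" "rename \<rho> u \<cdot> t = rename \<rho> v \<cdot> t'"
    have "u \<cdot> t = v \<cdot> t'"
      by (rule inj) (use uv in \<open>auto intro: coneI\<close>)
    then have "u = v \<and> t = t'" using S uv independentD by blast
    then show "rename \<rho> u = rename \<rho> v" "t = t'" by auto
  qed
qed

text \<open>With the elements of \<open>V\<close> numbered by atoms, \<open>f\<close> prescribes the
  images of these atoms. For infinite \<open>V\<close> the numbering exhausts all atoms, so nothing
  has to be placed beside the images of \<open>f\<close>, which may leave no room; for finite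
  \<open>V\<close> the remaining atoms go to atoms that meet none of these images.\<close>

lemma ex_renaming:
  assumes V: "countable V" and f: "inj_on f V" "independent (f ` V)"
    and e: "bij_betw e V (if finite V then {..<card V} else UNIV)"
  shows "\<exists>\<rho>. is_renaming \<rho> \<and> (\<forall>w\<in>V. \<rho> (e w) = f w)"
proof -
  have ind: "\<not> iota (f u) (f v)" if "u \<in> V" "v \<in> V" "u \<noteq> v" for u v
    using independentD[OF f(2)] that f(1) unfolding iota_def by (metis imageI inj_onD)
  have renamingI: "is_renaming \<rho>" if "\<And>x y. x \<noteq> y \<Longrightarrow> \<not> iota (\<rho> x) (\<rho> y)" for \<rho>
    using that iota_refl unfolding is_renaming_def inj_def by metis
  define g where "g = inv_into V e"
  have g: "g (e w) = w" if "w \<in> V" for w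
    using e that by (auto simp: g_def bij_betw_def)
  show ?thesis
  proof (cases "finite V")
    case False
    then have eU: "e ` V = UNIV" "inj_on e V" using e by (auto simp: bij_betw_def)
    have gV: "g x \<in> V" "e (g x) = x" for x
      using eU by (auto simp: g_def inv_into_into f_inv_into_f)
    have "is_renaming (f \<circ> g)"
      by (rule renamingI) (use gV ind in \<open>metis comp_apply\<close>)
    then show ?thesis using g by (intro exI[of _ "f \<circ> g"]) auto
  next
    case True
    then have eU: "e ` V = {..<card V}" using e by (auto simp: bij_betw_def)
    have gV: "g x \<in> V" "e (g x) = x" if "x < card V" for x
      using eU that by (auto simp: g_def inv_into_into f_inv_into_f)
    define A where "A = - (\<Union>u\<in>f ` V. {x. iota u (atom x)})"
    have "infinite A"
      unfolding A_def using True finite_iota_atoms by (simp add: Compl_eq_Diff_UNIV)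
    define \<rho> where "\<rho> x = (if x < card V then f (g x) else atom (Infinite_Set.enumerate A x))" for x
    have A: "\<not> iota (f u) (atom (Infinite_Set.enumerate A x))" if "u \<in> V" for u x
      using enumerate_in_set[OF \<open>infinite A\<close>, of x] that by (auto simp: A_def)
    have atoms: "\<not> iota (atom (Infinite_Set.enumerate A x)) (atom (Infinite_Set.enumerate A y))"
      if "x \<noteq> y" for x y
      using that strict_mono_enumerate[OF \<open>infinite A\<close>] strict_mono_eq by (auto simp: iota_def)
    have "is_renaming \<rho>"
    proof (rule renamingI)
      fix x y :: nat assume "x \<noteq> y"
      then have "g x \<noteq> g y" if "x < card V" "y < card V"
        using gV(2) that by metis
      then show "\<not> iota (\<rho> x) (\<rho> y)"
        using \<open>x \<noteq> y\<close> A[of "g x" y] A[of "g y" x] atoms[of x y] ind[of "g x" "g y"] gV[of x] gV[of y]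
        by (auto simp: \<rho>_def dest: iota_sym)
    qed
    moreover have "\<rho> (e w) = f w" if "w \<in> V" for w
      using that g eU by (auto simp: \<rho>_def)
    ultimately show ?thesis by blast
  qed
qed

lemma ex_enum:
  assumes "countable V"
  shows "\<exists>e :: _ \<Rightarrow> nat. bij_betw e V (if finite V then {..<card V} else UNIV)"
proof (cases "finite V")
  case True
  then show ?thesis by (auto simp: ex_bij_betw_finite_nat lessThan_atLeast0)
next
  case False
  then show ?thesis using assms by (metis to_nat_on_infinite)
qed

instance dir :: countable
  by countable_datatype

instance nterm :: countable
  by countable_datatype

lemma countable_names: "countable (V :: name set)"
proof -
  have "range abs_name = UNIV"
    by (metis Quotient_abs_rep Quotient_name surjI)
  then show ?thesis
    by (metis countable_image countable_subset countableI_type subset_UNIV)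
qed

section \<open>Walks, isomorphisms and disks\<close>

lemma gmap_simps [simp]:
  "verts (gmap f G) = f ` verts G"
  "edges (gmap f G) = image (map_prod f id) ` edges G"
  "vlabels (gmap f G) = map_prod f id ` vlabels G"
  "elabels (gmap f G) = map_prod (image (map_prod f id)) id ` elabels G"
  by (simp_all add: gmap_def)

lemma disk_simps [simp]:
  "verts (disk G n v) = gball G n v"
  "edges (disk G n v) = {e \<in> edges G. fst ` e \<subseteq> gball G n v}"
  "vlabels (disk G n v) = {(w, s) \<in> vlabels G. w \<in> gball G n v}"
  "elabels (disk G n v) = {(e, d) \<in> elabels G. fst ` e \<subseteq> gball G n v}"
  by (simp_all add: disk_def)

lemma graph_eqI:
  "verts G = verts H \<Longrightarrow> edges G = edges H \<Longrightarrow> vlabels G = vlabels H \<Longrightarrow>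
    elabels G = elabels H \<Longrightarrow> (G :: ('v, 'p, 's, 'd) graph) = H"
  by simp

lemma wf_edge_verts: "wf_graph G \<Longrightarrow> e \<in> edges G \<Longrightarrow> (u, a) \<in> e \<Longrightarrow> u \<in> verts G"
  unfolding wf_graph_def by blast

lemma wf_edge_sub: "wf_graph G \<Longrightarrow> e \<in> edges G \<Longrightarrow> e \<subseteq> verts G \<times> UNIV"
  unfolding wf_graph_def by blast

lemma wf_edge_eq:
  "wf_graph G \<Longrightarrow> e \<in> edges G \<Longrightarrow> e' \<in> edges G \<Longrightarrow> x \<in> e \<Longrightarrow> x \<in> e' \<Longrightarrow> e = e'"
  unfolding wf_graph_def by blast

lemma wf_edge_unique:
  "wf_graph G \<Longrightarrow> {(u, a), (w, b)} \<in> edges G \<Longrightarrow> {(u, a), (w', b)} \<in> edges G \<Longrightarrow> w = w'"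
  using wf_edge_eq[of G "{(u, a), (w, b)}" "{(u, a), (w', b)}" "(u, a)"]
  by (auto simp: doubleton_eq_iff)

lemma wf_edge_unique':
  assumes "wf_graph G" "{(u, a), (w, b)} \<in> edges G" "{(u, a), (w', b')} \<in> edges G"
  shows "w = w' \<and> b = b'"
proof -
  have eq: "{(u, a), (w, b)} = {(u, a), (w', b')}"
    by (rule wf_edge_eq[OF assms, of "(u, a)"]) auto
  have "card {(u, a), (w, b)} = 2" "card {(u, a), (w', b')} = 2"
    using assms unfolding wf_graph_def by blast+
  then have "(w, b) \<noteq> (u, a)" by auto
  with eq show ?thesis by (auto simp: doubleton_eq_iff)
qed

lemma wf_vlabels_sub: "wf_graph G \<Longrightarrow> vlabels G \<subseteq> verts G \<times> UNIV"
  unfolding wf_graph_def by blast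

lemma wf_elabels_sub: "wf_graph G \<Longrightarrow> elabels G \<subseteq> edges G \<times> UNIV"
  unfolding wf_graph_def by blast

lemma wf_connected: "wf_graph G \<Longrightarrow> u \<in> verts G \<Longrightarrow> v \<in> verts G \<Longrightarrow> \<exists>p. walk G u p v"
  unfolding wf_graph_def by blast

lemma walk_end: "walk G u p v \<Longrightarrow> v \<in> verts G"
  by (induction G u p v rule: walk.induct) auto

lemma walk_start:
  "\<Union>(edges G) \<subseteq> verts G \<times> UNIV \<Longrightarrow> walk G u p v \<Longrightarrow> u \<in> verts G"
  by (cases p) (auto 4 3)

lemma wf_edges_Union: "wf_graph G \<Longrightarrow> \<Union>(edges G) \<subseteq> verts G \<times> UNIV"
  using wf_edge_sub by blast

text \<open>Only the ends of edges are assumed to be vertices, because the rule serves to prove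
  disks and attached graphs connected, before they are known to be well-formed.\<close>

lemma walk_append_Union:
  assumes "\<Union>(edges G) \<subseteq> verts G \<times> UNIV"
  shows "walk G u (p @ q) v \<longleftrightarrow> (\<exists>w. walk G u p w \<and> walk G w q v)"
proof (induction p arbitrary: u)
  case Nil
  then show ?case using walk_start[OF assms] by auto
next
  case (Cons ab p)
  then show ?case by (cases ab) auto
qed

lemmas walk_append = walk_append_Union[OF wf_edges_Union]

lemma walk_mono:
  "verts G \<subseteq> verts H \<Longrightarrow> edges G \<subseteq> edges H \<Longrightarrow> walk G u p w \<Longrightarrow> walk H u p w"
  by (induction p arbitrary: u) (auto, blast)

lemma walk_det: "wf_graph G \<Longrightarrow> walk G u p v \<Longrightarrow> walk G u p v' \<Longrightarrow> v = v'"
proof (induction p arbitrary: u)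
  case (Cons ab p)
  obtain a b where [simp]: "ab = (a, b)" by (cases ab)
  from Cons.prems obtain w w' where w: "{(u, a), (w, b)} \<in> edges G" "walk G w p v"
    "{(u, a), (w', b)} \<in> edges G" "walk G w' p v'" by auto
  then have "w = w'" using wf_edge_unique Cons.prems(1) by metis
  with w Cons.IH Cons.prems(1) show ?case by blast
qed simp

lemma walk_rev_Union:
  assumes E: "\<Union>(edges G) \<subseteq> verts G \<times> UNIV"
  shows "walk G u p v \<Longrightarrow> walk G v (rev (map prod.swap p)) u"
proof (induction p arbitrary: u)
  case (Cons ab p)
  obtain a b where [simp]: "ab = (a, b)" by (cases ab)
  from Cons.prems obtain w where w: "{(u, a), (w, b)} \<in> edges G" "walk G w p v" by auto
  then have "walk G w [(b, a)] u"
    using E by (auto simp: insert_commute)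
  moreover have "walk G v (rev (map prod.swap p)) w" using Cons w by blast
  ultimately show ?case by (auto simp: walk_append_Union[OF E])
qed auto

lemma edge_gmap:
  assumes G: "wf_graph G" and f: "inj_on f (verts G)" and u: "u \<in> verts G"
  shows "{(f u, a), (z, b)} \<in> edges (gmap f G) \<longleftrightarrow> (\<exists>w. z = f w \<and> {(u, a), (w, b)} \<in> edges G)"
proof
  assume "{(f u, a), (z, b)} \<in> edges (gmap f G)"
  then obtain e where e: "e \<in> edges G" "{(f u, a), (z, b)} = map_prod f id ` e" by auto
  note sub = wf_edge_sub[OF G e(1)]
  have "(f u, a) \<in> map_prod f id ` e" "(z, b) \<in> map_prod f id ` e" using e(2) by blast+
  then obtain u' w where uw: "(u', a) \<in> e" "f u' = f u" "(w, b) \<in> e" "f w = z" by auto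
  then have [simp]: "u' = u" using f u sub by (auto dest: inj_onD)
  have "e = {(u, a), (w, b)}"
  proof
    show "e \<subseteq> {(u, a), (w, b)}"
    proof
      fix x assume x: "x \<in> e"
      obtain y c where [simp]: "x = (y, c)" by (cases x)
      have "map_prod f id x \<in> {(f u, a), (z, b)}" unfolding e(2) using x by blast
      then have "(f y, c) \<in> {(f u, a), (z, b)}" by simp
      moreover have "y \<in> verts G" "w \<in> verts G" using x sub uw by auto
      ultimately show "x \<in> {(u, a), (w, b)}" using f u uw by (auto dest: inj_onD)
    qed
  qed (use uw in auto)
  then show "\<exists>w. z = f w \<and> {(u, a), (w, b)} \<in> edges G" using e uw by auto
next
  assume "\<exists>w. z = f w \<and> {(u, a), (w, b)} \<in> edges G"
  then obtain w where "z = f w" "{(u, a), (w, b)} \<in> edges G" by blast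
  moreover from this have "{(f u, a), (z, b)} = map_prod f id ` {(u, a), (w, b)}" by simp
  ultimately show "{(f u, a), (z, b)} \<in> edges (gmap f G)"
    unfolding gmap_simps by blast
qed

lemma walk_gmap:
  assumes G: "wf_graph G" and f: "inj_on f (verts G)"
  shows "u \<in> verts G \<Longrightarrow> walk (gmap f G) (f u) p z \<longleftrightarrow> (\<exists>w. z = f w \<and> walk G u p w)"
proof (induction p arbitrary: u)
  case Nil
  then show ?case by auto
next
  case (Cons ab p)
  obtain a b where [simp]: "ab = (a, b)" by (cases ab)
  have v: "w \<in> verts G" if "{(u, a), (w, b)} \<in> edges G" for w
    using wf_edge_verts[OF G that, of w b] by simp
  have "walk (gmap f G) (f u) (ab # p) z \<longleftrightarrow>
      (\<exists>w. {(u, a), (w, b)} \<in> edges G \<and> walk (gmap f G) (f w) p z)"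
    using edge_gmap[OF G f Cons.prems] by (auto simp del: gmap_simps)
  also have "\<dots> \<longleftrightarrow> (\<exists>w. {(u, a), (w, b)} \<in> edges G \<and> (\<exists>x. z = f x \<and> walk G w p x))"
    using Cons.IH v by blast
  finally show ?case by auto
qed

lemma walk_gmap_iff:
  assumes "wf_graph G" "inj_on f (verts G)" "u \<in> verts G" "w \<in> verts G"
  shows "walk (gmap f G) (f u) p (f w) \<longleftrightarrow> walk G u p w"
  using walk_gmap[OF assms(1-3)] assms(2,4) by (auto dest: walk_end inj_onD)

lemma single_valued_map_prod:
  assumes "single_valued R" "inj_on f A" "R \<subseteq> A \<times> UNIV"
  shows "single_valued (map_prod f id ` R)"
proof (rule single_valuedI)
  fix x y z assume "(x, y) \<in> map_prod f id ` R" "(x, z) \<in> map_prod f id ` R"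
  then obtain a b where ab: "(a, y) \<in> R" "(b, z) \<in> R" "x = f a" "x = f b" by auto
  then have "a = b" using assms(2,3) by (metis inj_onD mem_Sigma_iff subsetD)
  then show "y = z" using ab assms(1) by (auto dest: single_valuedD)
qed

lemma wf_gmap:
  assumes G: "wf_graph G" and f: "inj_on f (verts G)"
  shows "wf_graph (gmap f G)"
  unfolding wf_graph_def
proof (intro conjI ballI impI)
  have inj: "inj_on (map_prod f id) (verts G \<times> UNIV)"
    using f by (simp add: map_prod_inj_on)
  fix e assume "e \<in> edges (gmap f G)"
  then obtain e0 where e0: "e0 \<in> edges G" "e = map_prod f id ` e0" by auto
  have sub: "e0 \<subseteq> verts G \<times> UNIV" using e0 wf_edge_sub[OF G] by blast
  then show "e \<subseteq> verts (gmap f G) \<times> UNIV" using e0 by auto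
  have "card e0 = 2" using G e0 unfolding wf_graph_def by blast
  then show "card e = 2" using e0 sub inj by (metis card_image inj_on_subset)
  fix e' assume "e' \<in> edges (gmap f G)" and ne: "e \<noteq> e'"
  then obtain e1 where e1: "e1 \<in> edges G" "e' = map_prod f id ` e1" by auto
  then have "e1 \<subseteq> verts G \<times> UNIV" using wf_edge_sub[OF G] by blast
  moreover have "e0 \<inter> e1 = {}" using e0 e1 ne G unfolding wf_graph_def by metis
  ultimately show "e \<inter> e' = {}" using inj_on_image_Int[OF inj sub] e0 e1 by (metis image_empty)
next
  show "vlabels (gmap f G) \<subseteq> verts (gmap f G) \<times> UNIV" using wf_vlabels_sub[OF G] by auto
  show "elabels (gmap f G) \<subseteq> edges (gmap f G) \<times> UNIV" using wf_elabels_sub[OF G] by auto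
  have "single_valued (vlabels G)" "single_valued (elabels G)"
    using G unfolding wf_graph_def by auto
  then show "single_valued (vlabels (gmap f G))"
    using single_valued_map_prod[OF _ f wf_vlabels_sub[OF G]] by simp
  have "inj_on (image (map_prod f id)) (edges G)"
  proof (rule inj_on_subset)
    show "inj_on (image (map_prod f id)) (Pow (verts G \<times> UNIV))"
      using f by (simp add: inj_on_image_Pow map_prod_inj_on)
  qed (use wf_edge_sub[OF G] in blast)
  then show "single_valued (elabels (gmap f G))"
    using single_valued_map_prod[OF \<open>single_valued (elabels G)\<close> _ wf_elabels_sub[OF G]] by simp
  fix x y assume "x \<in> verts (gmap f G)" "y \<in> verts (gmap f G)"
  then obtain u v where uv: "u \<in> verts G" "v \<in> verts G" "x = f u" "y = f v" by auto
  then show "\<exists>p. walk (gmap f G) x p y"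
    using walk_gmap[OF G f] wf_connected[OF G] by metis
qed

lemma gmap_gmap: "gmap g (gmap f G) = gmap (g \<circ> f) G"
  by (rule graph_eqI) (simp_all add: image_image map_prod_def split_def)

lemma gmap_cong:
  assumes G: "wf_graph G" and fg: "\<And>v. v \<in> verts G \<Longrightarrow> f v = g v"
  shows "gmap f G = gmap g G"
proof -
  have e: "map_prod f id ` e = map_prod g id ` e" if "e \<in> edges G" for e
    using wf_edge_sub[OF G that] fg by (intro image_cong) auto
  show ?thesis
  proof (rule graph_eqI)
    show "verts (gmap f G) = verts (gmap g G)" using fg by auto
    show "edges (gmap f G) = edges (gmap g G)" using e by auto
    show "vlabels (gmap f G) = vlabels (gmap g G)"
      unfolding gmap_simps using wf_vlabels_sub[OF G] fg by (intro image_cong) auto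
    show "elabels (gmap f G) = elabels (gmap g G)"
      unfolding gmap_simps using wf_elabels_sub[OF G] e by (intro image_cong) auto
  qed
qed

lemma gmap_id: "gmap id G = G"
  by (rule graph_eqI) (simp_all add: map_prod.id)

lemma gmap_inv:
  assumes "wf_graph G" "\<And>v. v \<in> verts G \<Longrightarrow> g (f v) = v"
  shows "gmap g (gmap f G) = G"
proof -
  have "gmap g (gmap f G) = gmap id G"
    unfolding gmap_gmap by (rule gmap_cong) (use assms in auto)
  then show ?thesis by (simp add: gmap_id)
qed

section \<open>Balls and disks\<close>

lemma gball_mono: "m \<le> n \<Longrightarrow> gball G m v \<subseteq> gball G n v"
  by (auto simp: gball_def)

lemma gball_alt: "gball G n v = {w. \<exists>p. walk G v p w \<and> length p \<le> n}"
  by (auto simp: gball_def dest: walk_end)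

lemma gball_sub: "gball G n v \<subseteq> verts G"
  by (auto simp: gball_def)

lemma gball_centre: "v \<in> verts G \<Longrightarrow> v \<in> gball G n v"
  by (auto simp: gball_def intro!: exI[of _ "[]"])

lemma gballI: "walk G v p w \<Longrightarrow> length p \<le> n \<Longrightarrow> w \<in> gball G n v"
  by (auto simp: gball_def walk_end)

lemma gball_step:
  assumes "wf_graph G" "u \<in> gball G j v" "{(u, a), (w, b)} \<in> edges G" 
  shows "w \<in> gball G (Suc j) v"
proof -
  obtain p where p: "walk G v p u" "length p \<le> j" using assms by (auto simp: gball_def)
  have "walk G u [(a, b)] w" using assms wf_edge_verts[OF assms(1,3), of w b] by auto
  then have "walk G v (p @ [(a, b)]) w" using walk_append[OF assms(1)] p by blast
  then show ?thesis using p by (intro gballI) auto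
qed

text \<open>\<open>j\<close> bounds the distance already travelled from the centre, so the budget
  \<open>j + length p\<close> keeps every step of the walk within radius \<open>r\<close>.\<close>

lemma walk_disk:
  assumes G: "wf_graph G"
  shows "walk G u p w \<Longrightarrow> u \<in> gball G j v \<Longrightarrow> j + length p \<le> r \<Longrightarrow> walk (disk G r v) u p w"
proof (induction p arbitrary: u j)
  case Nil
  then show ?case using gball_mono[of j r G v] by auto
next
  case (Cons ab p)
  obtain a b where [simp]: "ab = (a, b)" by (cases ab)
  from Cons.prems obtain x where x: "{(u, a), (x, b)} \<in> edges G" "walk G x p w" by auto
  have xb: "x \<in> gball G (Suc j) v" by (rule gball_step[OF G Cons.prems(2) x(1)])
  have "walk (disk G r v) x p w" using Cons.IH[OF x(2) xb] Cons.prems by simp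
  moreover have "u \<in> gball G r v" "x \<in> gball G r v"
    using xb Cons.prems gball_mono[of j r G v] gball_mono[of "Suc j" r G v] by auto
  ultimately show ?case using x by auto
qed

lemma disk_walk: "walk (disk G r v) u p w \<Longrightarrow> walk G u p w"
  by (induction p arbitrary: u) (auto simp: gball_def, blast)

lemma walk_disk_centre:
  assumes "wf_graph G" "v \<in> verts G" "length p \<le> r"
  shows "walk (disk G r v) v p w \<longleftrightarrow> walk G v p w"
  using walk_disk[OF assms(1), of v p w 0 v r] disk_walk gball_centre[OF assms(2)] assms(3) by auto

lemma wf_disk:
  assumes G: "wf_graph G" and v: "v \<in> verts G"
  shows "wf_graph (disk G r v)"
  unfolding wf_graph_def
proof (intro conjI ballI impI)
  have E: "\<Union>(edges (disk G r v)) \<subseteq> verts (disk G r v) \<times> UNIV" by force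
  fix u w assume "u \<in> verts (disk G r v)" "w \<in> verts (disk G r v)"
  then have "\<exists>p. walk (disk G r v) v p u" "\<exists>q. walk (disk G r v) v q w"
    using walk_disk_centre[OF G v] by (auto simp: gball_def)
  then show "\<exists>p. walk (disk G r v) u p w"
    using walk_rev_Union[OF E] walk_append_Union[OF E] by blast
next
  have sub: "edges (disk G r v) \<subseteq> edges G" "vlabels (disk G r v) \<subseteq> vlabels G"
    "elabels (disk G r v) \<subseteq> elabels G" by auto
  then show "single_valued (vlabels (disk G r v))" "single_valued (elabels (disk G r v))"
    using G single_valued_subset unfolding wf_graph_def by metis+
  show "vlabels (disk G r v) \<subseteq> verts (disk G r v) \<times> UNIV"
    "elabels (disk G r v) \<subseteq> edges (disk G r v) \<times> UNIV"
    using wf_elabels_sub[OF G] by auto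
  fix e assume "e \<in> edges (disk G r v)"
  then show "e \<subseteq> verts (disk G r v) \<times> UNIV" by force
  show "card e = 2" using \<open>e \<in> _\<close> G by (auto simp: wf_graph_def)
  fix e' assume "e' \<in> edges (disk G r v)" "e \<noteq> e'"
  then show "e \<inter> e' = {}" using \<open>e \<in> _\<close> G by (auto simp: wf_graph_def)
qed

lemma gball_disk:
  assumes "wf_graph G" "v \<in> verts G" "n \<le> r"
  shows "gball (disk G r v) n v = gball G n v"
proof -
  have "walk (disk G r v) v p w \<longleftrightarrow> walk G v p w" if "length p \<le> n" for p w
    using walk_disk_centre[OF assms(1,2)] that assms(3) by simp
  then show ?thesis using gball_mono[OF assms(3), of G v] by (auto simp: gball_def dest: walk_end)
qed

lemma disk_disk:
  assumes "wf_graph G" "v \<in> verts G" "n \<le> r"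
  shows "disk (disk G r v) n v = disk G n v"
  using gball_mono[OF assms(3), of G v] by (intro graph_eqI) (auto simp: gball_disk[OF assms])

lemma gball_gmap:
  assumes "wf_graph G" "inj_on f (verts G)" "v \<in> verts G"
  shows "gball (gmap f G) n (f v) = f ` gball G n v"
  using walk_gmap[OF assms] by (auto simp: gball_def dest: walk_end)

lemma disk_gmap:
  assumes G: "wf_graph G" and f: "inj_on f (verts G)" and v: "v \<in> verts G"
  shows "disk (gmap f G) n (f v) = gmap f (disk G n v)"
proof -
  note b = gball_gmap[OF assms]
  have mem: "f w \<in> f ` gball G n v \<longleftrightarrow> w \<in> gball G n v" if "w \<in> verts G" for w
    using inj_on_image_mem_iff[OF f that gball_sub] .
  have mem': "fst ` map_prod f id ` e \<subseteq> f ` gball G n v \<longleftrightarrow> fst ` e \<subseteq> gball G n v"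
    if "e \<in> edges G" for e
  proof -
    have "fst ` map_prod f id ` e = f ` fst ` e" by (auto simp: image_image)
    moreover have "fst ` e \<subseteq> verts G" using wf_edge_sub[OF G that] by auto
    moreover have "f ` A \<subseteq> f ` gball G n v \<longleftrightarrow> A \<subseteq> gball G n v" if "A \<subseteq> verts G" for A
      using mem that by (simp only: image_subset_iff subset_iff) blast
    ultimately show ?thesis by simp
  qed
  have "edges (disk (gmap f G) n (f v)) = edges (gmap f (disk G n v))"
    using mem' by (auto simp: b simp del: image_subset_iff)
  moreover have "vlabels (disk (gmap f G) n (f v)) = vlabels (gmap f (disk G n v))"
    using mem wf_vlabels_sub[OF G] by (auto simp: b) (force simp: image_iff)+
  moreover have "elabels (disk (gmap f G) n (f v)) = elabels (gmap f (disk G n v))"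
    using mem' wf_elabels_sub[OF G] by (auto simp: b simp del: image_subset_iff) (force simp: image_iff)+
  ultimately show ?thesis by (intro graph_eqI) (auto simp: b)
qed

text \<open>A walk is determined by its start and its ports, so finitely many ports give finitely
  many ends of walks of bounded length.\<close>

lemma finite_gball:
  fixes G :: "('v, 'p, 's, 'd) graph"
  assumes "wf_graph G" "finite (UNIV :: 'p set)"
  shows "finite (gball G n v)"
proof -
  have "finite (UNIV :: ('p \<times> 'p) set)" using assms(2) by (simp add: finite_prod)
  then have fin: "finite {p :: ('p \<times> 'p) list. length p \<le> n}"
    using finite_lists_length_le[of UNIV n] by simp
  have "gball G n v \<subseteq> (\<lambda>p. THE w. walk G v p w) ` {p. length p \<le> n}"
  proof
    fix w assume "w \<in> gball G n v"
    then obtain p where p: "walk G v p w" "length p \<le> n" by (auto simp: gball_def)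
    then have "(THE w. walk G v p w) = w" using walk_det[OF assms(1)] by blast
    then show "w \<in> (\<lambda>p. THE w. walk G v p w) ` {p. length p \<le> n}" using p by blast
  qed
  then show ?thesis using fin finite_surj by blast
qed

lemma finite_sub_gball:
  assumes "finite Z" "Z \<subseteq> verts K" "wf_graph K" "x \<in> verts K"
  shows "\<exists>n. Z \<subseteq> gball K n x"
  using assms(1,2)
proof (induction Z)
  case (insert z Z)
  then obtain n where n: "Z \<subseteq> gball K n x" by auto
  obtain p where p: "walk K x p z" using wf_connected[OF assms(3,4)] insert by blast
  have "z \<in> gball K (max n (length p)) x" using p by (rule gballI) simp
  moreover have "Z \<subseteq> gball K (max n (length p)) x" using n gball_mono[of n "max n (length p)" K x] by auto
  ultimately show ?case by blast
qed simp

section \<open>Pointed graphs modulo and their representatives\<close>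

text \<open>Connectedness provides a path and determinism gives it a unique end. Hence the vertices
  of a pointed graph modulo correspond one to one to those of any representative.\<close>

lemma path_between_inj:
  assumes "wf_graph K" "x \<in> verts K" "z \<in> verts K" "path_between K x z = path_between K x y"
  shows "z = y"
proof -
  obtain p where "walk K x p z" using wf_connected assms by metis
  then have "walk K x p y" using assms(4) by (auto simp: path_between_def)
  then show ?thesis using walk_det[OF assms(1) \<open>walk K x p z\<close>] by simp
qed

lemma path_between_gmap:
  assumes "wf_graph K" "inj_on f (verts K)" "x \<in> verts K" "y \<in> verts K"
  shows "path_between (gmap f K) (f x) (f y) = path_between K x y"
  using walk_gmap_iff[OF assms] by (simp add: path_between_def)

lemma tilde_gmap:
  assumes K: "wf_graph K" and f: "inj_on f (verts K)" and x: "x \<in> verts K"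
  shows "tilde (gmap f K, f x) = tilde (K, x)"
proof -
  have "\<exists>h. (gmap g (gmap f K), g (f x)) = (gmap h K, h x) \<and> inj_on h (verts K)"
    if "inj_on g (f ` verts K)" for g :: "_ \<Rightarrow> name"
    using that f by (intro exI[of _ "g \<circ> f"]) (simp add: gmap_gmap comp_inj_on)
  moreover have "\<exists>h. (gmap g K, g x) = (gmap h (gmap f K), h (f x)) \<and> inj_on h (f ` verts K)"
    if g: "inj_on g (verts K)" for g :: "_ \<Rightarrow> name"
  proof (intro exI[of _ "g \<circ> inv_into (verts K) f"] conjI)
    have "gmap (g \<circ> inv_into (verts K) f) (gmap f K) = gmap g K"
      unfolding gmap_gmap by (rule gmap_cong[OF K]) (simp add: f)
    then show "(gmap g K, g x) = (gmap (g \<circ> inv_into (verts K) f) (gmap f K), (g \<circ> inv_into (verts K) f) (f x))"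
      using f x by simp
    show "inj_on (g \<circ> inv_into (verts K) f) (f ` verts K)"
      using g f by (auto simp: inj_on_def)
  qed
  ultimately show ?thesis by (auto simp: tilde_def)
qed

text \<open>Classes collect only copies with vertices in \<open>name\<close>. For a vertex set
  without an injective naming the class is empty, and an equation between classes would carry no
  information.\<close>

definition namable :: "'v set \<Rightarrow> bool" where
  "namable V \<longleftrightarrow> (\<exists>f :: 'v \<Rightarrow> name. inj_on f V)"

lemma namable_subset: "namable V \<Longrightarrow> U \<subseteq> V \<Longrightarrow> namable U"
  unfolding namable_def by (meson inj_on_subset)

lemma tilde_eqD:
  assumes "namable (verts K)" "tilde (K, x) = tilde (K', x')"
  obtains f f' :: "_ \<Rightarrow> name"
  where "inj_on f (verts K)" "inj_on f' (verts K')" "gmap f K = gmap f' K'" "f x = f' x'"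
proof -
  obtain f where f: "inj_on (f :: _ \<Rightarrow> name) (verts K)" using assms by (auto simp: namable_def)
  then have "(gmap f K, f x) \<in> tilde (K, x)" by (auto simp: tilde_def)
  then have "(gmap f K, f x) \<in> tilde (K', x')" using assms(2) by simp
  then show ?thesis using f that by (auto simp: tilde_def)
qed

context
  fixes K :: "('v, 'p, 's, 'd) graph" and x :: 'v
  assumes K: "wf_graph K" and x: "x \<in> verts K" and nam: "namable (verts K)"
begin

lemma tilde_memE:
  assumes "(H, w) \<in> tilde (K, x)"
  obtains f where "inj_on f (verts K)" "H = gmap f K" "w = f x"
  using assms by (auto simp: tilde_def)

lemma tilde_mem_ex: "\<exists>f. inj_on f (verts K) \<and> (gmap f K, f x) \<in> tilde (K, x)"
  using nam by (auto simp: tilde_def namable_def)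

lemma paths_tilde: "paths (tilde (K, x)) = {p. \<exists>z. walk K x p z}"
proof -
  obtain f where f: "inj_on f (verts K)" "(gmap f K, f x) \<in> tilde (K, x)" using tilde_mem_ex by blast
  have "p \<in> paths (tilde (K, x))" if "walk K x p z" for p z
    using walk_gmap[OF K f(1) x] f(2) that unfolding paths_def by blast
  moreover have "\<exists>z. walk K x p z" if "p \<in> paths (tilde (K, x))" for p
  proof -
    obtain H v w where h: "(H, v) \<in> tilde (K, x)" "walk H v p w"
      using \<open>p \<in> _\<close> unfolding paths_def by blast
    then obtain g where "inj_on g (verts K)" "H = gmap g K" "v = g x" by (auto elim: tilde_memE)
    then show ?thesis using walk_gmap[OF K \<open>inj_on g (verts K)\<close> x] h(2) by blast
  qed
  ultimately show ?thesis by blast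
qed

lemma vtx_tilde:
  assumes "walk K x p z"
  shows "vtx (tilde (K, x)) p = path_between K x z"
proof -
  obtain f where f: "inj_on f (verts K)" "(gmap f K, f x) \<in> tilde (K, x)" using tilde_mem_ex by blast
  have "q \<in> vtx (tilde (K, x)) p" if "walk K x q z" for q
    using walk_gmap[OF K f(1) x] f(2) that assms unfolding vtx_def by blast
  moreover have "walk K x q z" if "q \<in> vtx (tilde (K, x)) p" for q
  proof -
    obtain H v w where h: "(H, v) \<in> tilde (K, x)" "walk H v p w" "walk H v q w"
      using \<open>q \<in> _\<close> unfolding vtx_def by blast
    then obtain g where g: "inj_on g (verts K)" "H = gmap g K" "v = g x" by (auto elim: tilde_memE)
    then obtain a b where "walk K x p a" "w = g a" "walk K x q b" "w = g b"
      using h walk_gmap[OF K g(1) x] by blast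
    moreover have "a = z" using calculation assms walk_det[OF K] by blast
    ultimately show ?thesis using g(1) by (metis inj_onD walk_end)
  qed
  ultimately show ?thesis by (auto simp: path_between_def)
qed

lemma pverts_tilde: "pverts (tilde (K, x)) = path_between K x ` verts K"
proof
  show "pverts (tilde (K, x)) \<subseteq> path_between K x ` verts K"
    using vtx_tilde by (auto simp: pverts_def paths_tilde dest: walk_end)
  show "path_between K x ` verts K \<subseteq> pverts (tilde (K, x))"
  proof
    fix c assume "c \<in> path_between K x ` verts K"
    then obtain z p where "c = path_between K x z" "walk K x p z" using wf_connected[OF K x] by blast
    then show "c \<in> pverts (tilde (K, x))" using vtx_tilde by (auto simp: pverts_def paths_tilde)
  qed
qed

lemma near_tilde: "near (tilde (K, x)) n = path_between K x ` gball K n x"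
  by (auto simp: near_def pverts_tilde path_between_def gball_def)

lemma shift_tilde:
  assumes z: "z \<in> verts K"
  shows "Defs.shift (tilde (K, x)) (path_between K x z) = tilde (K, z)"
proof (intro set_eqI iffI)
  fix Y assume "Y \<in> Defs.shift (tilde (K, x)) (path_between K x z)"
  then obtain H v w p where h: "Y = (H, w)" "(H, v) \<in> tilde (K, x)" "walk K x p z" "walk H v p w"
    by (auto simp: Defs.shift_def path_between_def)
  then obtain g where g: "inj_on g (verts K)" "H = gmap g K" "v = g x" by (auto elim: tilde_memE)
  then obtain a where "walk K x p a" "w = g a"
    using h walk_gmap[OF K g(1) x] by blast
  moreover have "a = z" using calculation h walk_det[OF K] by blast
  ultimately show "Y \<in> tilde (K, z)" using g h by (auto simp: tilde_def)
next
  fix Y assume "Y \<in> tilde (K, z)"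
  then obtain g where g: "inj_on g (verts K)" "Y = (gmap g K, g z)" by (auto simp: tilde_def)
  obtain p where p: "walk K x p z" using wf_connected[OF K x z] by blast
  have "(gmap g K, g x) \<in> tilde (K, x)" using g by (auto simp: tilde_def)
  moreover have "walk (gmap g K) (g x) p (g z)" using p walk_gmap[OF K g(1) x] by blast
  ultimately show "Y \<in> Defs.shift (tilde (K, x)) (path_between K x z)"
    using p g by (auto simp: Defs.shift_def path_between_def)
qed

lemma vconcat_tilde:
  assumes z: "z \<in> verts K" and y: "y \<in> verts K"
  shows "vconcat (tilde (K, x)) (path_between K x z) (path_between K z y) = path_between K x y"
proof -
  obtain p q where "walk K x p z" "walk K z q y" using wf_connected[OF K] x z y by metis
  moreover have "vtx (tilde (K, x)) (p @ q) = path_between K x y" if "walk K x p z" "walk K z q y" for p q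
    using that vtx_tilde walk_append[OF K] by blast
  ultimately show ?thesis by (auto simp: vconcat_def path_between_def)
qed

lemma pdisk_tilde: "pdisk (tilde (K, x)) n = tilde (disk K n x, x)"
proof -
  have *: "tilde (disk H n v, v) = tilde (disk K n x, x)" if "(H, v) \<in> tilde (K, x)" for H v
  proof -
    obtain f where f: "inj_on f (verts K)" "H = gmap f K" "v = f x"
      using \<open>(H, v) \<in> _\<close> by (rule tilde_memE)
    show ?thesis
      unfolding f disk_gmap[OF K f(1) x]
      by (rule tilde_gmap)
        (use f x in \<open>auto simp: wf_disk K gball_centre intro: inj_on_subset[OF _ gball_sub]\<close>)
  qed
  obtain f where f: "(gmap f K, f x) \<in> tilde (K, x)" using tilde_mem_ex by blast
  show ?thesis
    unfolding pdisk_def using * f by auto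
qed

end

section \<open>Attaching invisible matter\<close>

abbreviation vis :: "('v \<times> 'p) set \<Rightarrow> (('v \<times> dir list option) \<times> 'p xport) set" where
  "vis \<equiv> image (map_prod (\<lambda>u. (u, None)) VPort)"

lemma verts_attach [simp]: "verts (attach G) = verts G \<times> UNIV"
  by (simp add: attach_def Let_def)

lemma edges_attach:
  "edges (attach G) = vis ` edges G
     \<union> {{((u, None), PM), ((u, Some []), PM)} |u. u \<in> verts G}
     \<union> {{((u, Some s), dport d), ((u, Some (s @ [d])), PM)} |u s d. u \<in> verts G}"
  by (simp add: attach_def Let_def)

lemma vlabels_attach:
  "vlabels (attach G) = {((u, None), VLabel a) |u a. (u, a) \<in> vlabels G}
     \<union> {((u, Some s), Matter) |u s. u \<in> verts G}"
  by (simp add: attach_def Let_def)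

lemma elabels_attach: "elabels (attach G) = {(vis e, c) |e c. (e, c) \<in> elabels G}"
  by (simp add: attach_def Let_def)

lemma dport_simps [simp]:
  "dport d \<noteq> PM" "PM \<noteq> dport d" "dport d \<noteq> VPort a" "VPort a \<noteq> dport d"
  "dport d = dport d' \<longleftrightarrow> d = d'"
  by (cases d; cases d'; simp)+

lemma inj_vis: "inj (map_prod (\<lambda>u. (u, None)) VPort)"
  by (auto simp: inj_def)

lemma vis_eq_iff [simp]: "vis e = vis e' \<longleftrightarrow> e = e'"
  using inj_image_eq_iff[OF inj_vis] .

text \<open>The distance to the visible vertex; the edge from that vertex to the root of its tree
  accounts for the successor.\<close>

primrec depth :: "dir list option \<Rightarrow> nat" where
  "depth None = 0"
| "depth (Some s) = Suc (length s)"

primrec up :: "dir list option \<Rightarrow> ('p xport \<times> 'p xport) list" where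
  "up None = []"
| "up (Some s) = map (\<lambda>d. (PM, dport d)) (rev s) @ [(PM, PM)]"

lemma length_up [simp]: "length (up q) = depth q"
  by (cases q) auto

lemma vis_edge_iff: "{(x, \<alpha>), (y, \<beta>)} \<in> vis ` edges G \<longleftrightarrow>
  (\<exists>u w a b. x = (u, None) \<and> y = (w, None) \<and> \<alpha> = VPort a \<and> \<beta> = VPort b \<and> {(u, a), (w, b)} \<in> edges G)"
proof
  assume "{(x, \<alpha>), (y, \<beta>)} \<in> vis ` edges G"
  then obtain e where e: "e \<in> edges G" "vis e = {(x, \<alpha>), (y, \<beta>)}" by auto
  then have "(x, \<alpha>) \<in> vis e" "(y, \<beta>) \<in> vis e" by auto
  then obtain u a w b where uw: "(u, a) \<in> e" "x = (u, None)" "\<alpha> = VPort a"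
    "(w, b) \<in> e" "y = (w, None)" "\<beta> = VPort b" by auto
  then have "vis e = vis {(u, a), (w, b)}" using e by simp
  then have "e = {(u, a), (w, b)}" unfolding vis_eq_iff .
  then show "\<exists>u w a b. x = (u, None) \<and> y = (w, None) \<and> \<alpha> = VPort a \<and> \<beta> = VPort b \<and> {(u, a), (w, b)} \<in> edges G"
    using e(1) uw(2,3,5,6) by simp
next
  assume "\<exists>u w a b. x = (u, None) \<and> y = (w, None) \<and> \<alpha> = VPort a \<and> \<beta> = VPort b \<and> {(u, a), (w, b)} \<in> edges G"
  then obtain u w a b where e: "x = (u, None)" "y = (w, None)" "\<alpha> = VPort a" "\<beta> = VPort b"
    "{(u, a), (w, b)} \<in> edges G" by blast
  then have "{(x, \<alpha>), (y, \<beta>)} = vis {(u, a), (w, b)}" by simp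
  then show "{(x, \<alpha>), (y, \<beta>)} \<in> vis ` edges G" using e by blast
qed

fun tree_adj :: "dir list option \<Rightarrow> 'p xport \<Rightarrow> dir list option \<Rightarrow> 'p xport \<Rightarrow> bool" where
  "tree_adj None \<alpha> r \<beta> \<longleftrightarrow> \<alpha> = PM \<and> \<beta> = PM \<and> r = Some []"
| "tree_adj (Some s) \<alpha> None \<beta> \<longleftrightarrow> \<alpha> = PM \<and> \<beta> = PM \<and> s = []"
| "tree_adj (Some s) \<alpha> (Some t) \<beta> \<longleftrightarrow>
     (\<exists>d. \<alpha> = dport d \<and> \<beta> = PM \<and> t = s @ [d]) \<or> (\<exists>d. \<alpha> = PM \<and> \<beta> = dport d \<and> s = t @ [d])"

lemma edge_attach_iff:
  "{((u, q), \<alpha>), ((w, r), \<beta>)} \<in> edges (attach G) \<longleftrightarrow>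
     (q = None \<and> r = None \<and> (\<exists>a b. \<alpha> = VPort a \<and> \<beta> = VPort b \<and> {(u, a), (w, b)} \<in> edges G)) \<or>
     (u = w \<and> u \<in> verts G \<and> tree_adj q \<alpha> r \<beta>)"
  unfolding edges_attach Un_iff vis_edge_iff
  by (cases q; cases r) (auto simp: doubleton_eq_iff)

lemma depth_tree_adj: "tree_adj q \<alpha> r \<beta> \<Longrightarrow> depth q \<le> Suc (depth r)"
  by (cases q; cases r) auto

lemma tree_adj_det: "tree_adj q \<alpha> r \<beta> \<Longrightarrow> tree_adj q \<alpha> r' \<beta>' \<Longrightarrow> r = r' \<and> \<beta> = \<beta>'"
  by (cases q; cases r; cases r') auto

lemma tree_adj_VPort: "\<not> tree_adj q (VPort a) r \<beta>"
  by (cases q; cases r) auto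

lemma attach_edges_Union:
  "\<Union>(edges G) \<subseteq> verts G \<times> UNIV \<Longrightarrow> \<Union>(edges (attach G)) \<subseteq> verts (attach G) \<times> UNIV"
  unfolding edges_attach by (auto simp: subset_iff)

lemma walk_up: "u \<in> verts G \<Longrightarrow> walk (attach G) (u, q) (up q) (u, None)"
proof (cases q)
  case (Some s)
  assume u: "u \<in> verts G"
  have "walk (attach G) (u, Some s) (up (Some s)) (u, None)"
  proof (induction s rule: rev_induct)
    case Nil
    show ?case using u by (auto simp: edge_attach_iff)
  next
    case (snoc d s)
    have "{((u, Some (s @ [d])), PM), ((u, Some s), dport d)} \<in> edges (attach G)"
      using u by (auto simp: edge_attach_iff)
    then show ?case using snoc by auto
  qed
  then show ?thesis using Some by simp
qed simp

text \<open>A port \<open>PM\<close> answered by \<open>dport d\<close> or by \<open>PM\<close>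
  belongs to a tree edge, so the way out, read backwards from the visible vertex, fixes each
  position in turn. This recovers the place of the pointer in its tree from an isomorphism
  class.\<close>

lemma walk_up_unique:
  fixes G :: "('v, 'p, 's, 'd) graph"
  assumes "walk (attach G) (w, q') (up q) (u, None)"
  shows "q' = q \<and> u = w"
proof (cases q)
  case None
  then show ?thesis using assms by simp
next
  case (Some s)
  have "walk (attach G) (w, q') (up (Some s)) (u, None) \<Longrightarrow> q' = Some s \<and> u = w"
  proof (induction s arbitrary: q' rule: rev_induct)
    case Nil
    then show ?case by (cases q') (auto simp: edge_attach_iff)
  next
    case (snoc d s)
    then obtain r where r: "tree_adj q' PM r (dport d :: 'p xport)" "walk (attach G) (w, r) (up (Some s)) (u, None)"
      by (auto simp: edge_attach_iff)
    then have "r = Some s" "u = w" using snoc.IH by auto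
    then show ?case using r(1) by (cases q') auto
  qed
  then show ?thesis using Some assms by simp
qed

lemma walk_vis: "walk G u p w \<Longrightarrow> walk (attach G) (u, None) (map (map_prod VPort VPort) p) (w, None)"
proof (induction p arbitrary: u)
  case (Cons ab p)
  obtain a b where [simp]: "ab = (a, b)" by (cases ab)
  from Cons.prems obtain x where x: "{(u, a), (x, b)} \<in> edges G" "walk G x p w" by auto
  then have "{((u, None), VPort a), ((x, None), VPort b)} \<in> edges (attach G)"
    by (auto simp: edge_attach_iff)
  with Cons.IH[OF x(2)] show ?case by auto
qed simp

lemma walk_tree_path: "u \<in> verts G \<Longrightarrow> walk (attach G) (u, Some s) (tree_path t) (u, Some (s @ t))"
proof (induction t arbitrary: s)
  case (Cons d t)
  have "{((u, Some s), dport d), ((u, Some (s @ [d])), PM)} \<in> edges (attach G)"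
    using Cons by (auto simp: edge_attach_iff)
  moreover have "walk (attach G) (u, Some (s @ [d])) (tree_path t) (u, Some (s @ d # t))"
    using Cons.IH[of "s @ [d]"] Cons.prems by simp
  ultimately show ?case by (auto simp: tree_path_def)
qed (simp add: tree_path_def)

lemma wf_attach:
  assumes G: "wf_graph G"
  shows "wf_graph (attach G)"
  unfolding wf_graph_def
proof (intro conjI ballI impI)
  have U: "\<Union>(edges (attach G)) \<subseteq> verts (attach G) \<times> UNIV"
    by (rule attach_edges_Union[OF wf_edges_Union[OF G]])
  fix e assume e: "e \<in> edges (attach G)"
  then show "e \<subseteq> verts (attach G) \<times> UNIV" using U by blast
  have card2: "card e = 2" if "e \<in> edges (attach G)" for e
  proof -
    have "card e0 = 2" if "e0 \<in> edges G" for e0 using G that unfolding wf_graph_def by blast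
    then show ?thesis
      using that unfolding edges_attach by (auto simp: card_image[OF inj_on_subset[OF inj_vis]])
  qed
  then show "card e = 2" using e .
  fix e' assume e': "e' \<in> edges (attach G)" "e \<noteq> e'"
  show "e \<inter> e' = {}"
  proof (rule ccontr)
    assume "e \<inter> e' \<noteq> {}"
    then obtain u q \<alpha> where x: "((u, q), \<alpha>) \<in> e" "((u, q), \<alpha>) \<in> e'" by auto
    obtain w r \<beta> where y: "e = {((u, q), \<alpha>), ((w, r), \<beta>)}"
      using card2[OF e] x(1) by (auto simp: card_2_iff)
    obtain w' r' \<beta>' where y': "e' = {((u, q), \<alpha>), ((w', r'), \<beta>')}"
      using card2[OF e'(1)] x(2) by (auto simp: card_2_iff)
    have "w = w' \<and> r = r' \<and> \<beta> = \<beta>'"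
      using e e'(1) tree_adj_det[of q \<alpha> r \<beta> r' \<beta>'] wf_edge_unique'[OF G, of u _ w _ w']
      unfolding y y' edge_attach_iff by (auto simp: tree_adj_VPort)
    then show False using y y' e'(2) by simp
  qed
next
  show "vlabels (attach G) \<subseteq> verts (attach G) \<times> UNIV"
    using wf_vlabels_sub[OF G] by (auto simp: vlabels_attach)
  show "elabels (attach G) \<subseteq> edges (attach G) \<times> UNIV"
    using wf_elabels_sub[OF G] by (auto simp: elabels_attach edges_attach)
  have "single_valued (vlabels G)" "single_valued (elabels G)"
    using G unfolding wf_graph_def by auto
  then show "single_valued (vlabels (attach G))" "single_valued (elabels (attach G))"
    by (auto simp: vlabels_attach elabels_attach single_valued_def)
  have U: "\<Union>(edges (attach G)) \<subseteq> verts (attach G) \<times> UNIV"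
    by (rule attach_edges_Union[OF wf_edges_Union[OF G]])
  fix x y assume "x \<in> verts (attach G)" "y \<in> verts (attach G)"
  then obtain u q w r where xy: "x = (u, q)" "y = (w, r)" "u \<in> verts G" "w \<in> verts G" by auto
  then obtain p where "walk G u p w" using wf_connected[OF G] by blast
  then have "walk (attach G) (u, None) (map (map_prod VPort VPort) p) (w, None)" by (rule walk_vis)
  moreover have "walk (attach G) (u, q) (up q) (u, None)" using walk_up[OF xy(3)] .
  moreover have "walk (attach G) (w, None) (rev (map prod.swap (up r))) (w, r)"
    using walk_rev_Union[OF U walk_up[OF xy(4)]] .
  ultimately show "\<exists>p. walk (attach G) x p y"
    unfolding xy using walk_append_Union[OF U] by blast
qed

text \<open>Excursions into trees are dropped from the walk. One step lowers the depth by at most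
  one, so leaving the tree costs at least \<open>depth q\<close> steps.\<close>

lemma walk_attach_to_visible:
  assumes G: "wf_graph G"
  shows "walk (attach G) (v, q) p (u, None) \<Longrightarrow>
    \<exists>p'. walk G v p' u \<and> length p' + depth q \<le> length p"
proof (induction p arbitrary: v q)
  case Nil
  then show ?case by (auto intro: exI[of _ "[]"])
next
  case (Cons ab p)
  obtain \<alpha> \<beta> where [simp]: "ab = (\<alpha>, \<beta>)" by (cases ab)
  from Cons.prems obtain w r where w: "{((v, q), \<alpha>), ((w, r), \<beta>)} \<in> edges (attach G)"
    "walk (attach G) (w, r) p (u, None)" by auto
  obtain p' where p': "walk G w p' u" "length p' + depth r \<le> length p" using Cons.IH[OF w(2)] by blast
  from w(1) consider a b where "q = None" "r = None" "{(v, a), (w, b)} \<in> edges G"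
    | "v = w" "tree_adj q \<alpha> r \<beta>" by (auto simp: edge_attach_iff)
  then show ?case
  proof cases
    case 1
    then show ?thesis using p' by (intro exI[of _ "(a, b) # p'"]) auto
  next
    case 2
    then show ?thesis using p' depth_tree_adj[OF 2(2)] by (intro exI[of _ p']) auto
  qed
qed

lemma visible_gball_attach:
  assumes G: "wf_graph G" and v: "v \<in> verts G" and q: "depth q \<le> n"
  shows "(u, None) \<in> gball (attach G) n (v, q) \<longleftrightarrow> u \<in> gball G (n - depth q) v"
proof
  assume "(u, None) \<in> gball (attach G) n (v, q)"
  then obtain p where "walk (attach G) (v, q) p (u, None)" "length p \<le> n" by (auto simp: gball_def)
  then obtain p' where "walk G v p' u" "length p' + depth q \<le> n"
    using walk_attach_to_visible[OF G] by fastforce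
  then show "u \<in> gball G (n - depth q) v" by (intro gballI) auto
next
  assume "u \<in> gball G (n - depth q) v"
  then obtain p where p: "walk G v p u" "length p \<le> n - depth q" by (auto simp: gball_def)
  have "walk (attach G) (v, q) (up q @ map (map_prod VPort VPort) p) (u, None)"
    unfolding walk_append[OF wf_attach[OF G]] using walk_up[OF v] walk_vis[OF p(1)] by blast
  then show "(u, None) \<in> gball (attach G) n (v, q)" using p q by (intro gballI) auto
qed

lemma attach_disk_sub:
  "verts (attach (disk G k v)) \<subseteq> verts (attach G)" "edges (attach (disk G k v)) \<subseteq> edges (attach G)"
proof -
  show "verts (attach (disk G k v)) \<subseteq> verts (attach G)" using gball_sub[of G k v] by auto
  have "u \<in> verts G" if "u \<in> verts (disk G k v)" for u
    using that gball_sub[of G k v] by auto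
  moreover have "edges (disk G k v) \<subseteq> edges G" by auto
  ultimately show "edges (attach (disk G k v)) \<subseteq> edges (attach G)"
    unfolding edges_attach by (intro Un_mono image_mono) blast+
qed

text \<open>Only edges between visible vertices move away from the centre, and a walk that starts
  inside a tree must climb \<open>depth q0\<close> steps before using one. The truncated difference
  bounds the steps left for visible moves.\<close>

lemma walk_attach_disk:
  assumes G: "wf_graph G"
  shows "walk (attach G) (v0, q0) p z \<Longrightarrow> v0 \<in> gball G j v \<Longrightarrow> j + (length p - depth q0) \<le> k \<Longrightarrow>
    walk (attach (disk G k v)) (v0, q0) p z"
proof (induction p arbitrary: v0 q0 j)
  case Nil
  then show ?case using gball_mono[of j k G v] by auto
next
  case (Cons ab p)
  obtain \<alpha> \<beta> where [simp]: "ab = (\<alpha>, \<beta>)" by (cases ab)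
  from Cons.prems obtain w r where w: "{((v0, q0), \<alpha>), ((w, r), \<beta>)} \<in> edges (attach G)"
    "walk (attach G) (w, r) p z" by auto
  have v0: "v0 \<in> gball G k v" using Cons.prems gball_mono[of j k G v] by auto
  from w(1) consider a b where "q0 = None" "r = None" "{(v0, a), (w, b)} \<in> edges G" "\<alpha> = VPort a" "\<beta> = VPort b"
    | "v0 = w" "v0 \<in> verts G" "tree_adj q0 \<alpha> r \<beta>" by (auto simp: edge_attach_iff)
  then show ?case
  proof cases
    case 1
    have wj: "w \<in> gball G (Suc j) v" by (rule gball_step[OF G Cons.prems(2) 1(3)])
    have "walk (attach (disk G k v)) (w, r) p z"
      using Cons.prems 1 by (intro Cons.IH[OF w(2) wj]) auto
    moreover have "w \<in> gball G k v" using wj gball_mono[of "Suc j" k G v] Cons.prems 1 by auto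
    then have "{((v0, q0), \<alpha>), ((w, r), \<beta>)} \<in> edges (attach (disk G k v))"
      using 1 v0 by (simp add: edge_attach_iff)
    ultimately show ?thesis by auto
  next
    case 2
    have "walk (attach (disk G k v)) (w, r) p z"
      using Cons.prems depth_tree_adj[OF 2(3)] 2(1) by (intro Cons.IH[OF w(2), of j]) auto
    moreover have "{((v0, q0), \<alpha>), ((w, r), \<beta>)} \<in> edges (attach (disk G k v))"
      using 2 v0 by (simp add: edge_attach_iff)
    ultimately show ?thesis by auto
  qed
qed

text \<open>Seen from depth \<open>depth q\<close>, at most the visible radius
  \<open>n - depth q\<close> is within reach, and the trees over the disk are those over
  \<open>G\<close>. Locality of visible graphs thereby carries over to their invisible
  matter.\<close>

lemma disk_attach:
  assumes G: "wf_graph G" and v: "v \<in> verts G" and k: "n - depth q \<le> k"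
  shows "disk (attach (disk G k v)) n (v, q) = disk (attach G) n (v, q)"
proof -
  let ?D = "attach (disk G k v)"
  have w: "walk ?D (v, q) p z \<longleftrightarrow> walk (attach G) (v, q) p z" if "length p \<le> n" for p z
  proof -
    have "0 + (length p - depth q) \<le> k" using that k by simp
    from walk_attach_disk[OF G _ gball_centre[OF v] this] walk_mono[OF attach_disk_sub]
    show ?thesis by (rule iffI[rotated])
  qed
  have b: "gball ?D n (v, q) = gball (attach G) n (v, q)"
    unfolding gball_alt by (intro Collect_cong ex_cong1 iffI; elim conjE; simp add: w)
  have sub: "z \<in> verts ?D" if "z \<in> gball (attach G) n (v, q)" for z
    using that gball_sub[of ?D n "(v, q)"] unfolding b by (rule subsetD[rotated])
  have e: "e \<in> edges ?D" if e: "e \<in> edges (attach G)" "fst ` e \<subseteq> gball (attach G) n (v, q)" for e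
  proof -
    have fe: "fst ` e \<subseteq> verts ?D" using e sub by blast
    from e(1) consider e0 where "e0 \<in> edges G" "e = vis e0"
      | u where "e = {((u, None), PM), ((u, Some []), PM)}"
      | u s d where "e = {((u, Some s), dport d), ((u, Some (s @ [d])), PM)}"
      unfolding edges_attach by blast
    then show ?thesis
    proof cases
      case 1
      then have "fst ` e0 \<subseteq> gball G k v" using fe by (fastforce simp: image_image)
      then show ?thesis using 1 by (auto simp: edges_attach)
    next
      case 2
      then have "u \<in> verts (disk G k v)" using fe by auto
      then show ?thesis unfolding edges_attach 2 by blast
    next
      case 3
      then have "u \<in> verts (disk G k v)" using fe by auto
      then show ?thesis unfolding edges_attach 3 by blast
    qed
  qed
  have mem: "vis e \<in> edges ?D \<longleftrightarrow> e \<in> edges (disk G k v)" for e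
  proof -
    have "vis e \<noteq> {((u, None), PM), y}" "vis e \<noteq> {y, ((u, s), PM)}" for u y s
      by auto
    then show ?thesis unfolding edges_attach by (auto simp del: disk_simps)
  qed
  show ?thesis
  proof (rule graph_eqI)
    show "edges (disk ?D n (v, q)) = edges (disk (attach G) n (v, q))"
      using e attach_disk_sub(2)[of G k v] by (auto simp: b)
    show "vlabels (disk ?D n (v, q)) = vlabels (disk (attach G) n (v, q))"
      using sub gball_sub[of G k v] by (auto simp: b vlabels_attach)
    have "(e, c) \<in> elabels (disk ?D n (v, q))" if ec: "(e, c) \<in> elabels (disk (attach G) n (v, q))" for e c
    proof -
      obtain e0 where e0: "(e0, c) \<in> elabels G" "e = vis e0" "fst ` e \<subseteq> gball (attach G) n (v, q)"
        using ec by (auto simp: elabels_attach)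
      then have "e0 \<in> edges G" using wf_elabels_sub[OF G] by auto
      then have "vis e0 \<in> edges ?D" using e[of "vis e0"] e0 by (auto simp: edges_attach)
      then show ?thesis using e0 mem by (auto simp: b elabels_attach)
    qed
    then show "elabels (disk ?D n (v, q)) = elabels (disk (attach G) n (v, q))"
      by (auto simp: b elabels_attach)
  qed (simp add: b)
qed

lemma disk_attach_cong:
  assumes "wf_graph G" "wf_graph H" "c \<in> verts G" "c \<in> verts H" "disk G (n - depth q) c = disk H (n - depth q) c"
  shows "disk (attach G) n (c, q) = disk (attach H) n (c, q)"
  using disk_attach[OF assms(1,3) order.refl, of n q] disk_attach[OF assms(2,4) order.refl, of n q] assms(5)
  by simp

lemma attach_gmap:
  fixes G :: "('v, 'p, 's, 'd) graph"
  shows "attach (gmap f G) = gmap (map_prod f id) (attach G)"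
proof (rule graph_eqI)
  have v: "vis (map_prod f id ` e) = map_prod (map_prod f id) id ` vis e" for e
    by (auto simp: image_image map_prod_def split_def)
  show "verts (attach (gmap f G)) = verts (gmap (map_prod f id) (attach G))"
    by (auto simp: map_prod_def image_iff)
  have "vis ` edges (gmap f G) = image (map_prod (map_prod f id) id) ` vis ` edges G"
    unfolding gmap_simps image_image[of vis] image_image[of _ vis] v ..
  moreover have "{{((u, None), PM), ((u, Some [] :: dir list option), PM :: 'p xport)} |u. u \<in> f ` verts G} =
     image (map_prod (map_prod f id) id) ` {{((u, None), PM), ((u, Some []), PM)} |u. u \<in> verts G}"
    by (simp add: Setcompr_eq_image image_image)
  moreover have "{{((u, Some s), dport d), ((u, Some (s @ [d])), PM :: 'p xport)} |u s d. u \<in> f ` verts G} =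
     image (map_prod (map_prod f id) id) `
       {{((u, Some s), dport d), ((u, Some (s @ [d])), PM)} |u s d. u \<in> verts G}"
    (is "?A = image ?g ` ?B")
  proof -
    have "image ?g ` ?B = {?g ` {((u, Some s), dport d), ((u, Some (s @ [d])), PM)} |u s d. u \<in> verts G}"
      by blast
    also have "\<dots> = {{((f u, Some s), dport d), ((f u, Some (s @ [d])), PM)} |u s d. u \<in> verts G}"
      by simp
    also have "\<dots> = ?A" by blast
    finally show ?thesis ..
  qed
  ultimately show "edges (attach (gmap f G)) = edges (gmap (map_prod f id) (attach G))"
    unfolding edges_attach gmap_simps image_Un by (simp only:)
  show "vlabels (attach (gmap f G)) = vlabels (gmap (map_prod f id) (attach G))"
    unfolding vlabels_attach gmap_simps image_Un
    by (intro arg_cong2[of _ _ _ _ "(\<union>)"]) (force simp: image_iff)+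
  show "elabels (attach (gmap f G)) = elabels (gmap (map_prod f id) (attach G))"
    unfolding elabels_attach gmap_simps by (force simp: v[symmetric] image_iff)
qed

text \<open>Undoes \<open>attach\<close> by reading only labels and ports, so that it commutes with
  injective relabelling of the vertices.\<close>

definition visible_part :: "('v, 'p xport, 's xlabel, 'd) graph \<Rightarrow> ('v, 'p, 's, 'd) graph" where
  "visible_part K =
     \<lparr>verts = {x \<in> verts K. (x, Matter) \<notin> vlabels K},
      edges = {{(u, a). (u, VPort a) \<in> e} |e. e \<in> edges K \<and> snd ` e \<subseteq> range VPort},
      vlabels = {(u, a). (u, VLabel a) \<in> vlabels K},
      elabels = {({(u, a). (u, VPort a) \<in> e}, c) |e c. (e, c) \<in> elabels K \<and> snd ` e \<subseteq> range VPort}\<rparr>"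

lemma image_Collect_mem: "f ` {x \<in> A. P (f x)} = {y \<in> f ` A. P y}"
  by auto

lemma visible_part_gmap:
  assumes K: "wf_graph K" and f: "inj_on f (verts K)"
  shows "visible_part (gmap f K) = gmap f (visible_part K)"
proof -
  have s: "{(u, a). (u, VPort a) \<in> map_prod f id ` e} = map_prod f id ` {(u, a). (u, VPort a) \<in> e}" for e
    by (auto simp: image_iff) force
  have p: "snd ` map_prod f id ` e = snd ` e" for e :: "('a \<times> 'b xport) set"
    by (simp add: image_image)
  have m: "(f x, Matter) \<in> map_prod f id ` vlabels K \<longleftrightarrow> (x, Matter) \<in> vlabels K" if "x \<in> verts K" for x
  proof
    assume "(f x, Matter) \<in> map_prod f id ` vlabels K"
    then obtain y where y: "(y, Matter) \<in> vlabels K" "f x = f y" by auto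
    then have "y \<in> verts K" using wf_vlabels_sub[OF K] by auto
    then show "(x, Matter) \<in> vlabels K" using y that f by (auto dest: inj_onD)
  qed force
  show ?thesis
  proof (rule graph_eqI)
    show "verts (visible_part (gmap f K)) = verts (gmap f (visible_part K))"
    proof -
      have "f ` {x \<in> verts K. (x, Matter) \<notin> vlabels K} =
          f ` {x \<in> verts K. (f x, Matter) \<notin> map_prod f id ` vlabels K}"
        by (intro arg_cong[where f = "image f"] Collect_cong conj_cong HOL.refl) (simp only: m)
      also have "\<dots> = {y \<in> f ` verts K. (y, Matter) \<notin> map_prod f id ` vlabels K}"
        by (rule image_Collect_mem)
      finally show ?thesis by (simp add: visible_part_def)
    qed
    have "edges (visible_part (gmap f K)) =
        {map_prod f id ` {(u, a). (u, VPort a) \<in> e} |e. e \<in> edges K \<and> snd ` e \<subseteq> range VPort}"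
      (is "?A = ?B")
    proof
      show "?A \<subseteq> ?B"
      proof
        fix y assume "y \<in> ?A"
        then obtain e where "e \<in> edges K" "snd ` map_prod f id ` e \<subseteq> range VPort"
          "y = {(u, a). (u, VPort a) \<in> map_prod f id ` e}"
          by (auto simp: visible_part_def)
        then show "y \<in> ?B" unfolding p s by blast
      qed
      show "?B \<subseteq> ?A"
      proof
        fix y assume "y \<in> ?B"
        then obtain e where e: "e \<in> edges K" "snd ` map_prod f id ` e \<subseteq> range VPort"
          "y = {(u, a). (u, VPort a) \<in> map_prod f id ` e}"
          unfolding p s by blast
        then have "map_prod f id ` e \<in> edges (gmap f K)" by simp
        then show "y \<in> ?A" unfolding visible_part_def e(3) using e(2) by auto
      qed
    qed
    also have "\<dots> = edges (gmap f (visible_part K))"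
      unfolding visible_part_def by auto
    finally show "edges (visible_part (gmap f K)) = edges (gmap f (visible_part K))" .
    show "vlabels (visible_part (gmap f K)) = vlabels (gmap f (visible_part K))"
      unfolding visible_part_def by (auto simp: image_iff) force
    have "elabels (visible_part (gmap f K)) =
        {(map_prod f id ` {(u, a). (u, VPort a) \<in> e}, c) |e c. (e, c) \<in> elabels K \<and> snd ` e \<subseteq> range VPort}"
      (is "?A = ?B")
    proof
      show "?A \<subseteq> ?B"
      proof
        fix y assume "y \<in> ?A"
        then obtain e c where "(e, c) \<in> elabels K" "snd ` map_prod f id ` e \<subseteq> range VPort"
          "y = ({(u, a). (u, VPort a) \<in> map_prod f id ` e}, c)"
          by (auto simp: visible_part_def)
        then show "y \<in> ?B" unfolding p s by blast
      qed
      show "?B \<subseteq> ?A"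
      proof
        fix y assume "y \<in> ?B"
        then obtain e c where e: "(e, c) \<in> elabels K" "snd ` map_prod f id ` e \<subseteq> range VPort"
          "y = ({(u, a). (u, VPort a) \<in> map_prod f id ` e}, c)"
          unfolding p s by blast
        then have "(map_prod f id ` e, c) \<in> elabels (gmap f K)" by force
        then show "y \<in> ?A" unfolding visible_part_def e(3) using e(2) by (simp del: gmap_simps) blast
      qed
    qed
    also have "?B = map_prod (image (map_prod f id)) id ` {({(u, a). (u, VPort a) \<in> e}, c) |e c.
        (e, c) \<in> elabels K \<and> snd ` e \<subseteq> range VPort}" (is "_ = ?h ` ?C")
    proof
      show "?B \<subseteq> ?h ` ?C"
      proof
        fix y assume "y \<in> ?B"
        then obtain e c where e: "y = (map_prod f id ` {(u, a). (u, VPort a) \<in> e}, c)"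
          "(e, c) \<in> elabels K" "snd ` e \<subseteq> range VPort" by blast
        then have "({(u, a). (u, VPort a) \<in> e}, c) \<in> ?C" by blast
        from imageI[OF this, of ?h] show "y \<in> ?h ` ?C" unfolding e(1) by simp
      qed
      show "?h ` ?C \<subseteq> ?B" by (rule image_subsetI) auto
    qed
    also have "?h ` ?C = elabels (gmap f (visible_part K))"
      by (simp add: visible_part_def)
    finally show "elabels (visible_part (gmap f K)) = elabels (gmap f (visible_part K))" .
  qed
qed


text \<open>Whole graphs and disks are both of this form, so a single isomorphism lemma serves
  equality of classes and equality of their disks.\<close>

definition induced :: "('v, 'p, 's, 'd) graph \<Rightarrow> 'v set \<Rightarrow> ('v, 'p, 's, 'd) graph" where
  "induced G B =
     \<lparr>verts = B,
      edges = {e \<in> edges G. fst ` e \<subseteq> B},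
      vlabels = {(w, s) \<in> vlabels G. w \<in> B},
      elabels = {(e, d) \<in> elabels G. fst ` e \<subseteq> B}\<rparr>"

lemma disk_induced: "disk G n v = induced G (gball G n v)"
  by (simp add: disk_def induced_def)

lemma induced_verts: "wf_graph G \<Longrightarrow> induced G (verts G) = G"
  by (rule graph_eqI)
    (use wf_edge_sub[of G] wf_vlabels_sub[of G] wf_elabels_sub[of G] in \<open>force simp: induced_def\<close>)+

lemma visible_edge_attach:
  assumes "e \<in> edges (attach G)" "snd ` e \<subseteq> range VPort"
  obtains e0 where "e0 \<in> edges G" "e = vis e0"
  using assms unfolding edges_attach by auto

lemma visible_part_induced:
  assumes G: "wf_graph G" and B: "B \<subseteq> verts (attach G)"
  shows "visible_part (induced (attach G) B) = gmap (\<lambda>u. (u, None)) (induced G {u. (u, None) \<in> B})"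
proof -
  have s: "{(x, a). (x, VPort a) \<in> vis e} = map_prod (\<lambda>u. (u, None)) id ` e"
    for e :: "('a \<times> 'b) set" by force
  have b: "fst ` vis e \<subseteq> B \<longleftrightarrow> fst ` e \<subseteq> {u. (u, None) \<in> B}" for e :: "('a \<times> 'b) set" by force
  have p: "snd ` vis e \<subseteq> range VPort" for e :: "('a \<times> 'b) set" by force
  have Ge: "e \<in> edges G" if "vis e \<in> edges (attach G)" for e
    using that visible_edge_attach[OF _ p, of e G] by (metis vis_eq_iff)
  have eG: "vis e \<in> edges (attach G)" if "e \<in> edges G" for e
    using that by (auto simp: edges_attach)
  show ?thesis
  proof (rule graph_eqI)
    have "(x, Matter) \<in> vlabels (attach G) \<longleftrightarrow> snd x \<noteq> None" if "x \<in> B" for x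
      using that B by (cases x) (auto simp: vlabels_attach)
    then show "verts (visible_part (induced (attach G) B)) =
        verts (gmap (\<lambda>u. (u, None)) (induced G {u. (u, None) \<in> B}))"
      by (auto simp: visible_part_def induced_def)
    have "edges (visible_part (induced (attach G) B)) =
        {{(x, a). (x, VPort a) \<in> vis e} |e. e \<in> edges G \<and> fst ` vis e \<subseteq> B}" (is "?A = ?B")
    proof
      show "?A \<subseteq> ?B"
        unfolding visible_part_def induced_def by simp (blast elim: visible_edge_attach)
      show "?B \<subseteq> ?A"
      proof
        fix y assume "y \<in> ?B"
        then obtain e where e: "y = {(x, a). (x, VPort a) \<in> vis e}" "e \<in> edges G" "fst ` vis e \<subseteq> B" by blast
        have "vis e \<in> {e \<in> edges (attach G). fst ` e \<subseteq> B}" using e eG by blast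
        then show "y \<in> ?A" unfolding visible_part_def induced_def using e(1) p[of e] by auto
      qed
    qed
    also have "\<dots> = edges (gmap (\<lambda>u. (u, None)) (induced G {u. (u, None) \<in> B}))"
      unfolding s b induced_def by auto
    finally show "edges (visible_part (induced (attach G) B)) =
        edges (gmap (\<lambda>u. (u, None)) (induced G {u. (u, None) \<in> B}))" .
    show "vlabels (visible_part (induced (attach G) B)) =
        vlabels (gmap (\<lambda>u. (u, None)) (induced G {u. (u, None) \<in> B}))"
      unfolding visible_part_def induced_def vlabels_attach by (auto simp: image_iff)
    have "elabels (visible_part (induced (attach G) B)) =
        {({(x, a). (x, VPort a) \<in> vis e}, c) |e c. (e, c) \<in> elabels G \<and> fst ` vis e \<subseteq> B}" (is "?A = ?B")
    proof
      show "?A \<subseteq> ?B"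
        unfolding visible_part_def induced_def elabels_attach by auto
      show "?B \<subseteq> ?A"
      proof
        fix y assume "y \<in> ?B"
        then obtain e c where e: "y = ({(x, a). (x, VPort a) \<in> vis e}, c)" "(e, c) \<in> elabels G" "fst ` vis e \<subseteq> B"
          by blast
        have "(vis e, c) \<in> elabels (attach G)" using e(2) unfolding elabels_attach by blast
        then show "y \<in> ?A" unfolding visible_part_def induced_def using e(1,3) p[of e] by auto
      qed
    qed
    also have "\<dots> = elabels (gmap (\<lambda>u. (u, None)) (induced G {u. (u, None) \<in> B}))"
      unfolding s b induced_def by (auto simp: image_iff)
    finally show "elabels (visible_part (induced (attach G) B)) =
        elabels (gmap (\<lambda>u. (u, None)) (induced G {u. (u, None) \<in> B}))" .
  qed
qed

lemma induced_walk: "walk (induced G B) u p w \<Longrightarrow> B \<subseteq> verts G \<Longrightarrow> walk G u p w"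
  by (induction p arbitrary: u) (auto simp: induced_def, blast)

text \<open>The port path \<open>up q\<close> leading out of the invisible tree and the label \<open>Matter\<close> make the depth
  of the pointer and the visible graph isomorphism invariants.\<close>

lemma iso_attach_induced:
  fixes G :: "('v, 'p, 's, 'd) graph" and H :: "('w, 'p, 's, 'd) graph"
  assumes G: "wf_graph G" "B \<subseteq> verts (attach G)" "wf_graph (induced (attach G) B)"
    and H: "wf_graph H" "C \<subseteq> verts (attach H)" "wf_graph (induced (attach H) C)"
    and f: "inj_on f B" and f': "inj_on f' C"
    and eq: "gmap f (induced (attach G) B) = gmap f' (induced (attach H) C)" "f (v, q) = f' (w, q')"
    and v: "(v, q) \<in> B" and w: "(w, q') \<in> C"
    and up: "walk (induced (attach G) B) (v, q) (up q) (v, None)"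
  shows "q' = q" "f (v, None) = f' (w, None)" "(w, None) \<in> C"
    "gmap (\<lambda>u. f (u, None)) (induced G {u. (u, None) \<in> B}) =
     gmap (\<lambda>u. f' (u, None)) (induced H {u. (u, None) \<in> C})"
proof -
  let ?K = "induced (attach G) B" and ?L = "induced (attach H) C"
  have KV: "verts ?K = B" "verts ?L = C" by (simp_all add: induced_def)
  have "walk (gmap f ?K) (f (v, q)) (up q) (f (v, None))"
    using walk_gmap[OF G(3), of f "(v, q)"] up v f by (auto simp: KV)
  then have "walk (gmap f' ?L) (f' (w, q')) (up q) (f (v, None))" using eq by simp
  then obtain y where y: "walk ?L (w, q') (up q) y" "f' y = f (v, None)"
    using walk_gmap[OF H(3), of f' "(w, q')"] w f' by (auto simp: KV)
  obtain x r where xr: "y = (x, r)" by (cases y)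
  have yC: "y \<in> C" using walk_end[OF y(1)] KV by simp
  \<comment> \<open>If the climb ended in invisible matter of \<open>H\<close>, the label
    \<open>Matter\<close> found there would be carried back to a visible vertex of
    \<open>G\<close>.\<close>
  have "r = None"
  proof (rule ccontr)
    assume "r \<noteq> None"
    then have "(y, Matter) \<in> vlabels ?L" using yC H(2) xr by (auto simp: vlabels_attach induced_def)
    then have "(f (v, None), Matter) \<in> vlabels (gmap f' ?L)" using y(2) by force
    then have "(f (v, None), Matter) \<in> vlabels (gmap f ?K)" using eq by simp
    then obtain z where z: "(z, Matter) \<in> vlabels ?K" "f z = f (v, None)" by auto
    then have "z \<in> B" by (auto simp: induced_def)
    moreover have "(v, None) \<in> B" using walk_end[OF up] KV by simp
    ultimately have "z = (v, None)" using z(2) f by (auto dest: inj_onD)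
    then show False using z by (auto simp: induced_def vlabels_attach)
  qed
  then have "q' = q \<and> x = w"
    using walk_up_unique[of H w q' q x] induced_walk[OF y(1) H(2)] xr by simp
  then show "q' = q" "f (v, None) = f' (w, None)" "(w, None) \<in> C"
    using y xr yC \<open>r = None\<close> by auto
  have "gmap f (visible_part ?K) = gmap f' (visible_part ?L)"
    using visible_part_gmap[OF G(3), of f] visible_part_gmap[OF H(3), of f'] f f' eq KV by simp
  then show "gmap (\<lambda>u. f (u, None)) (induced G {u. (u, None) \<in> B}) =
     gmap (\<lambda>u. f' (u, None)) (induced H {u. (u, None) \<in> C})"
    unfolding visible_part_induced[OF G(1,2)] visible_part_induced[OF H(1,2)] gmap_gmap by (simp add: o_def)
qed

section \<open>Canonical names\<close>

definition shortest_walk :: "('v, 'p, 's, 'd) graph \<Rightarrow> 'v \<Rightarrow> 'v \<Rightarrow> ('p \<times> 'p) list \<Rightarrow> bool" where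
  "shortest_walk G v w p \<longleftrightarrow> walk G v p w \<and> (\<forall>p'. walk G v p' w \<longrightarrow> length p \<le> length p')"

text \<open>Shortest walks, unlike arbitrary ones, keep the name of a vertex of a disk unchanged
  when the graph outside the disk is cut off; the least code selects one of them. Atoms as names
  make the renamed graph well-named.\<close>

definition cname :: "('v, 'p :: countable, 's, 'd) graph \<Rightarrow> 'v \<Rightarrow> 'v \<Rightarrow> name" where
  "cname G v w = atom (LEAST i. \<exists>p. shortest_walk G v w p \<and> i = to_nat p)"

definition can :: "('v, 'p :: countable, 's, 'd) graph \<Rightarrow> 'v \<Rightarrow> ('p, 's, 'd) ngraph" where
  "can G v = gmap (cname G v) G"

lemma cname_ex:
  assumes "wf_graph G" "v \<in> verts G" "w \<in> verts G"
  obtains p where "shortest_walk G v w p" "cname G v w = atom (to_nat p)"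
proof -
  obtain p0 where "walk G v p0 w" using wf_connected assms by metis
  then have "\<exists>p. walk G v p w \<and> (\<forall>p'. walk G v p' w \<longrightarrow> length p \<le> length p')"
    by (rule ex_has_least_nat)
  then obtain p where "shortest_walk G v w p" unfolding shortest_walk_def by blast
  then have "\<exists>i. \<exists>p. shortest_walk G v w p \<and> i = to_nat p" by blast
  from LeastI_ex[OF this]
  obtain p where "shortest_walk G v w p" "(LEAST i. \<exists>p. shortest_walk G v w p \<and> i = to_nat p) = to_nat p"
    by (elim exE conjE)
  then show ?thesis by (intro that[of p]) (simp_all only: cname_def)
qed

lemma cname_centre:
  fixes G :: "('v, 'p :: countable, 's, 'd) graph"
  assumes "wf_graph G" "v \<in> verts G"
  shows "cname G v v = atom (to_nat ([] :: ('p \<times> 'p) list))"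
proof -
  have "walk G v [] v" using assms by simp
  then have "p = []" if "shortest_walk G v v p" for p
    using that unfolding shortest_walk_def by fastforce
  then show ?thesis using cname_ex[OF assms assms(2)] by metis
qed

lemma cname_inj:
  assumes G: "wf_graph G" and v: "v \<in> verts G"
  shows "inj_on (cname G v) (verts G)"
proof (rule inj_onI)
  fix x y assume xy: "x \<in> verts G" "y \<in> verts G" "cname G v x = cname G v y"
  obtain p where p: "shortest_walk G v x p" "cname G v x = atom (to_nat p)"
    using cname_ex[OF G v xy(1)] .
  obtain p' where p': "shortest_walk G v y p'" "cname G v y = atom (to_nat p')"
    using cname_ex[OF G v xy(2)] .
  have "p = p'" using p(2) p'(2) xy(3) by simp
  then show "x = y" using p(1) p'(1) walk_det[OF G] unfolding shortest_walk_def by blast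
qed

lemma cname_cong:
  assumes "\<And>p. shortest_walk G v w p \<longleftrightarrow> shortest_walk H v' w' p"
  shows "cname G v w = cname H v' w'"
  unfolding cname_def assms ..

lemma can_gmap:
  assumes G: "wf_graph G" and f: "inj_on f (verts G)" and v: "v \<in> verts G"
  shows "can (gmap f G) (f v) = can G v"
proof -
  have "cname (gmap f G) (f v) (f w) = cname G v w" if "w \<in> verts G" for w
    by (rule cname_cong) (simp only: shortest_walk_def walk_gmap_iff[OF G f v that])
  then show ?thesis unfolding can_def gmap_gmap by (intro gmap_cong[OF G]) simp
qed

lemma wf_can: "wf_graph G \<Longrightarrow> v \<in> verts G \<Longrightarrow> wf_graph (can G v)"
  unfolding can_def by (intro wf_gmap cname_inj)

lemma can_WN: "wf_graph G \<Longrightarrow> v \<in> verts G \<Longrightarrow> can G v \<in> WN"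
  using wf_can[of G v] by (auto simp: WN_def well_named_iff can_def cname_def intro!: independent_atoms)

lemma cname_disk:
  assumes G: "wf_graph G" and v: "v \<in> verts G" and w: "w \<in> gball G r v"
  shows "cname (disk G r v) v w = cname G v w"
proof (rule cname_cong)
  fix p
  obtain p0 where p0: "walk G v p0 w" "length p0 \<le> r" using w by (auto simp: gball_def)
  note d = walk_disk_centre[OF G v]
  have p0': "walk (disk G r v) v p0 w" using p0 d by blast
  show "shortest_walk (disk G r v) v w p \<longleftrightarrow> shortest_walk G v w p"
    unfolding shortest_walk_def using d p0 p0' by (meson disk_walk le_trans nle_le)
qed

lemma can_disk:
  assumes G: "wf_graph G" and v: "v \<in> verts G"
  shows "disk (can G v) r (cname G v v) = can (disk G r v) v"
  unfolding can_def disk_gmap[OF G cname_inj[OF G v] v]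
  by (rule gmap_cong[OF wf_disk[OF G v]]) (simp add: cname_disk[OF G v])

lemma tilde_attach_eqD:
  fixes G :: "('v, 'p :: countable, 's, 'd) graph" and H :: "('w, 'p, 's, 'd) graph"
  assumes G: "wf_graph G" "v \<in> verts G" and H: "wf_graph H" "w \<in> verts H"
    and nam: "namable (verts (attach G))"
    and eq: "tilde (attach G, (v, q)) = tilde (attach H, (w, q'))"
  shows "q = q'" "can G v = can H w"
proof -
  obtain f f' :: "_ \<Rightarrow> name" where f: "inj_on f (verts (attach G))" "inj_on f' (verts (attach H))"
    "gmap f (attach G) = gmap f' (attach H)" "f (v, q) = f' (w, q')"
    using tilde_eqD[OF nam eq] .
  note ind = induced_verts[OF wf_attach[OF G(1)]] induced_verts[OF wf_attach[OF H(1)]]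
  note iso = iso_attach_induced[OF G(1) order.refl _ H(1) order.refl, unfolded ind,
      OF wf_attach[OF G(1)] wf_attach[OF H(1)] f]
  have vis_all: "induced G {u. (u, None) \<in> verts (attach G)} = G"
    "induced H {u. (u, None) \<in> verts (attach H)} = H"
    using induced_verts[OF G(1)] induced_verts[OF H(1)] by simp_all
  show "q = q'" using iso(1) G(2) H(2) walk_up[OF G(2)] by simp
  have *: "f (v, None) = f' (w, None)"
    "gmap (\<lambda>u. f (u, None)) G = gmap (\<lambda>u. f' (u, None)) H"
    using iso(2,4) G(2) H(2) walk_up[OF G(2)] unfolding vis_all by auto
  have "can G v = can (gmap (\<lambda>u. f (u, None)) G) (f (v, None))"
    using can_gmap[OF G(1) _ G(2), of "\<lambda>u. f (u, None)"] f(1) by (auto simp: inj_on_def)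
  also have "\<dots> = can (gmap (\<lambda>u. f' (u, None)) H) (f' (w, None))" using * by simp
  also have "\<dots> = can H w"
    using can_gmap[OF H(1) _ H(2), of "\<lambda>u. f' (u, None)"] f(2) by (auto simp: inj_on_def)
  finally show "can G v = can H w" .
qed

text \<open>The pointer sits \<open>depth q\<close> below its visible vertex, so a disk of radius
  \<open>n\<close> determines the visible disk of radius \<open>n - depth q\<close>. The bound on
  \<open>depth q\<close> keeps the climb out of the tree inside the disk.\<close>

lemma tilde_disk_attach_eqD:
  fixes G :: "('v, 'p :: countable, 's, 'd) graph" and H :: "('w, 'p, 's, 'd) graph"
  assumes G: "wf_graph G" "v \<in> verts G" and H: "wf_graph H" "w \<in> verts H"
    and nam: "namable (verts (attach G))" and n: "depth q \<le> n"
    and eq: "tilde (disk (attach G) n (v, q), (v, q)) = tilde (disk (attach H) n (w, q'), (w, q'))"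
  shows "q = q'" "can (disk G (n - depth q) v) v = can (disk H (n - depth q) w) w"
proof -
  let ?B = "gball (attach G) n (v, q)" and ?C = "gball (attach H) n (w, q')"
  have "namable (verts (disk (attach G) n (v, q)))"
    using namable_subset[OF nam gball_sub] by simp
  then obtain f f' :: "_ \<Rightarrow> name" where f: "inj_on f ?B" "inj_on f' ?C"
    "gmap f (disk (attach G) n (v, q)) = gmap f' (disk (attach H) n (w, q'))" "f (v, q) = f' (w, q')"
    using tilde_eqD[OF _ eq] by auto
  have x: "(v, q) \<in> verts (attach G)" "(w, q') \<in> verts (attach H)" using G H by auto
  note wf = wf_disk[OF wf_attach[OF G(1)] x(1), of n] wf_disk[OF wf_attach[OF H(1)] x(2), of n]
  have up: "walk (disk (attach G) n (v, q)) (v, q) (up q) (v, None)"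
    using walk_disk_centre[OF wf_attach[OF G(1)] x(1)] walk_up[OF G(2)] n by (simp del: disk_simps)
  note iso = iso_attach_induced[OF G(1) gball_sub _ H(1) gball_sub, folded disk_induced, OF wf f]
  have iso: "q' = q" "f (v, None) = f' (w, None)"
    "gmap (\<lambda>u. f (u, None)) (induced G {u. (u, None) \<in> ?B}) =
     gmap (\<lambda>u. f' (u, None)) (induced H {u. (u, None) \<in> ?C})"
    using iso gball_centre[OF x(1)] gball_centre[OF x(2)] up by auto
  then show "q = q'" by simp
  let ?G = "disk G (n - depth q) v" and ?H = "disk H (n - depth q) w"
  have G': "induced G {u. (u, None) \<in> ?B} = ?G" "induced H {u. (u, None) \<in> ?C} = ?H"
    using visible_gball_attach[OF G n] visible_gball_attach[OF H n] unfolding disk_induced iso(1) by auto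
  have bG: "u \<in> verts ?G \<Longrightarrow> (u, None) \<in> ?B" for u
    using visible_gball_attach[OF G n] by simp
  have bH: "u \<in> verts ?H \<Longrightarrow> (u, None) \<in> ?C" for u
    using visible_gball_attach[OF H n] iso(1) by simp
  have iG: "inj_on (\<lambda>u. f (u, None)) (verts ?G)"
    by (rule inj_onI) (use bG f(1) in \<open>auto dest: inj_onD\<close>)
  have iH: "inj_on (\<lambda>u. f' (u, None)) (verts ?H)"
    by (rule inj_onI) (use bH f(2) in \<open>auto dest: inj_onD\<close>)
  have "can ?G v = can (gmap (\<lambda>u. f (u, None)) ?G) (f (v, None))"
    using can_gmap[OF wf_disk[OF G] iG, of v] gball_centre[OF G(2)] by simp
  also have "\<dots> = can (gmap (\<lambda>u. f' (u, None)) ?H) (f' (w, None))"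
    using iso(2,3) unfolding G' by simp
  also have "\<dots> = can ?H w"
    using can_gmap[OF wf_disk[OF H] iH, of w] gball_centre[OF H(2)] by simp
  finally show "can ?G v = can ?H w" .
qed

section \<open>The bijection between positions\<close>

text \<open>A position \<open>(u, q)\<close> of the invisible matter below \<open>u\<close> is identified with the point
  \<open>u \<cdot> eword q \<cdot> Rgt \<cdot> Rgt \<cdots>\<close> of the Cantor space. Names that cover the same part of that space have
  the same such points, whence a bijection between positions.\<close>

fun eword :: "dir list option \<Rightarrow> dir list" where
  "eword None = []"
| "eword (Some s) = s @ [Lft]"

text \<open>Coincidence of the two points, witnessed at finite depth. In this form it is an equation
  between names, which \<open>rename\<close> preserves.\<close>

definition matches :: "name \<times> dir list option \<Rightarrow> name \<times> dir list option \<Rightarrow> bool" where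
  "matches = (\<lambda>(u, q) (v, r). \<exists>j k. u \<cdot> (eword q @ replicate j Rgt) = v \<cdot> (eword r @ replicate k Rgt))"

definition rmap :: "name set \<Rightarrow> name \<times> dir list option \<Rightarrow> name \<times> dir list option" where
  "rmap T z = (THE y. y \<in> T \<times> UNIV \<and> matches z y)"

lemma replicate_Rgt_Lft_inj:
  "replicate j Rgt @ Lft # a = replicate k Rgt @ Lft # b \<Longrightarrow> a = b"
proof (induction j arbitrary: k)
  case 0
  then show ?case by (cases k) auto
next
  case (Suc j)
  then show ?case by (cases k) auto
qed

text \<open>The \<open>Lft\<close> closing \<open>eword (Some s)\<close> marks where the trailing
  letters \<open>Rgt\<close> begin, so the padding can be stripped without ambiguity.\<close>

lemma eword_inj:
  assumes "eword q @ replicate j Rgt = eword r @ replicate k Rgt"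
  shows "q = r"
proof (cases q; cases r)
  fix s t assume q: "q = Some s" and r: "r = Some t"
  have "rev (eword q @ replicate j Rgt) = rev (eword r @ replicate k Rgt)" using assms by simp
  then show ?thesis using q r replicate_Rgt_Lft_inj[of j "rev s" k "rev t"] by simp
next
  fix s assume "q = None" "r = Some s"
  then have "Lft \<in> set (replicate j Rgt)" using assms by simp
  then show ?thesis by simp
next
  fix s assume "q = Some s" "r = None"
  then have "Lft \<in> set (replicate k Rgt)" using assms[symmetric] by simp
  then show ?thesis by simp
qed simp

lemma eword_decomp: "\<exists>q k. w = eword q @ replicate k Rgt"
proof (induction w rule: rev_induct)
  case Nil
  show ?case by (intro exI[of _ None] exI[of _ 0]) simp
next
  case (snoc d w)
  then obtain q k where w: "w = eword q @ replicate k Rgt" by blast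
  show ?case
  proof (cases d)
    case Lft
    then show ?thesis by (intro exI[of _ "Some w"] exI[of _ 0]) simp
  next
    case Rgt
    then show ?thesis using w
      by (intro exI[of _ q] exI[of _ "Suc k"]) (simp add: replicate_append_same)
  qed
qed

lemma matches_sym: "matches z y \<Longrightarrow> matches y z"
  by (auto simp: matches_def split_beta) metis

lemma matches_trans:
  assumes "matches x y" "matches y z"
  shows "matches x z"
proof -
  obtain u q v r w s where [simp]: "x = (u, q)" "y = (v, r)" "z = (w, s)" by (cases x, cases y, cases z)
  obtain j k l m where
    1: "u \<cdot> (eword q @ replicate j Rgt) = v \<cdot> (eword r @ replicate k Rgt)" and
    2: "v \<cdot> (eword r @ replicate l Rgt) = w \<cdot> (eword s @ replicate m Rgt)"
    using assms by (auto simp: matches_def)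
  \<comment> \<open>The middle paddings \<open>k\<close> and \<open>l\<close> are both raised to
    \<open>k + l\<close>.\<close>
  have "u \<cdot> (eword q @ replicate (j + l) Rgt) = v \<cdot> (eword r @ replicate (k + l) Rgt)"
    using arg_cong[OF 1, of "\<lambda>a. a \<cdot> replicate l Rgt"]
    by (simp add: replicate_add flip: nword_append)
  also have "\<dots> = w \<cdot> (eword s @ replicate (m + k) Rgt)"
    using arg_cong[OF 2, of "\<lambda>a. a \<cdot> replicate k Rgt"]
    by (simp add: add.commute[of k] replicate_add flip: nword_append)
  finally show ?thesis by (auto simp: matches_def)
qed

lemma matches_unique:
  assumes "independent T" "y \<in> T \<times> UNIV" "y' \<in> T \<times> UNIV" "matches y y'"
  shows "y = y'"
proof -
  obtain u q v r where y: "y = (u, q)" "y' = (v, r)" by (cases y, cases y')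
  with assms obtain j k where "u \<cdot> (eword q @ replicate j Rgt) = v \<cdot> (eword r @ replicate k Rgt)"
    by (auto simp: matches_def)
  then have "u = v" "eword q @ replicate j Rgt = eword r @ replicate k Rgt"
    using assms y independentD[OF assms(1)] by blast+
  then show ?thesis using y eword_inj by simp
qed

text \<open>Going far enough to the right below the position enters the cone of \<open>T\<close>;
  stripping the trailing \<open>Rgt\<close> letters of the remainder leaves a position over
  \<open>T\<close>.\<close>

lemma matches_ex:
  assumes "absorbs S T" "z \<in> S \<times> UNIV"
  shows "\<exists>y\<in>T \<times> UNIV. matches z y"
proof -
  obtain v q where z: "z = (v, q)" "v \<in> S" using assms(2) by auto
  then obtain b where b: "\<And>s. length s \<ge> b \<Longrightarrow> v \<cdot> s \<in> cone T"
    using assms(1) unfolding absorbs_def by blast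
  have "v \<cdot> (eword q @ replicate b Rgt) \<in> cone T" by (rule b) simp
  then obtain u t where u: "u \<in> T" "v \<cdot> (eword q @ replicate b Rgt) = u \<cdot> t" by (auto elim: coneE)
  obtain r k where "t = eword r @ replicate k Rgt" using eword_decomp by blast
  then have "matches z (u, r)" using u z unfolding matches_def by auto
  then show ?thesis using u by blast
qed

lemma rmap_eqI:
  assumes "independent T" "y \<in> T \<times> UNIV" "matches z y"
  shows "rmap T z = y"
  unfolding rmap_def
proof (rule the_equality)
  fix y' assume "y' \<in> T \<times> UNIV \<and> matches z y'"
  then show "y' = y"
    using matches_unique[OF assms(1)] assms(2,3) matches_sym matches_trans by blast
qed (use assms in blast)

lemma rmap_props:
  assumes "independent T" "absorbs S T" "z \<in> S \<times> UNIV"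
  shows "rmap T z \<in> T \<times> UNIV" "matches z (rmap T z)"
proof -
  obtain y where y: "y \<in> T \<times> UNIV" "matches z y" using matches_ex[OF assms(2,3)] by blast
  then show "rmap T z \<in> T \<times> UNIV" "matches z (rmap T z)" using rmap_eqI[OF assms(1) y] by simp_all
qed

lemma rmap_inverse:
  assumes "independent S" "independent T" "absorbs S T" "z \<in> S \<times> UNIV"
  shows "rmap S (rmap T z) = z"
  using rmap_eqI[OF assms(1)] rmap_props[OF assms(2-4)] assms(4) matches_sym by blast

lemma bij_rmap:
  assumes "independent S" "independent T" "absorbs S T" "absorbs T S"
  shows "bij_betw (rmap T) (S \<times> UNIV) (T \<times> UNIV)"
  by (rule bij_betw_byWitness[where f' = "rmap S"])
    (use rmap_inverse rmap_props assms in \<open>blast+\<close>)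

lemma matches_iota: "matches (u, q) (v, r) \<Longrightarrow> iota u v"
  by (auto simp: matches_def intro: iotaI)

lemma matches_rename: "matches z y \<Longrightarrow> matches (map_prod (rename \<rho>) id z) (map_prod (rename \<rho>) id y)"
  by (auto simp: matches_def split_beta simp flip: rename_nword) metis

text \<open>Where two names share a word, the matching translates the whole subtree below it letter
  by letter. This is the source of quiescence.\<close>

lemma matches_below:
  assumes "u \<cdot> s = v \<cdot> s'"
  shows "matches (u, Some (s @ t)) (v, Some (s' @ t))"
  using arg_cong[OF assms, of "\<lambda>a. a \<cdot> (t @ [Lft])"] by (auto simp: matches_def nword_append)

section \<open>Names of positions\<close>

definition vname :: "name \<times> dir list option \<Rightarrow> name" where
  "vname = (\<lambda>(u, q). u \<cdot> eta q)"

lemma prime_gmap: "prime G = gmap vname (attach G)"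
  by (simp add: prime_def vname_def)

text \<open>On tree positions \<open>eta\<close> fixes every word containing \<open>Lft\<close> and
  lengthens the words made of \<open>Rgt\<close> alone by one letter, which frees the empty word for
  the visible vertex.\<close>

lemma inj_eta: "inj eta"
proof (rule injI)
  fix q r assume "eta q = eta r"
  moreover have "eta (Some s) \<noteq> []" for s by (cases s) auto
  moreover have "s = t" if "eta (Some s) = eta (Some t)" for s t
  proof (rule ccontr)
    assume "s \<noteq> t"
    have *: "w = replicate (length w) Rgt" if "w = replicate n Rgt" for w n
      using that by simp
    show False
      using that \<open>s \<noteq> t\<close> *[of t "Suc (length s)"] *[of s "Suc (length t)"]
      by (auto split: if_splits simp del: replicate_Suc)
  qed
  ultimately show "q = r" by (cases q; cases r) (metis eta.simps(1))+
qed

lemma surj_eta: "surj eta"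
proof (rule surjI[of eta "\<lambda>w. if w = [] then None else if w = replicate (length w) Rgt then Some (tl w) else Some w"])
  fix w :: "dir list"
  show "eta (if w = [] then None else if w = replicate (length w) Rgt then Some (tl w) else Some w) = w"
  proof (cases "w = []")
    case False
    then obtain d t where w: "w = d # t" by (cases w) auto
    then show ?thesis by (cases "w = replicate (length w) Rgt") auto
  qed simp
qed

lemma vname_inj:
  assumes "independent V"
  shows "inj_on vname (V \<times> UNIV)"
proof (rule inj_onI)
  fix x y assume xy: "x \<in> V \<times> (UNIV :: dir list option set)" "y \<in> V \<times> UNIV" "vname x = vname y"
  then obtain u q v r where "x = (u, q)" "y = (v, r)" "u \<in> V" "v \<in> V" by auto
  with xy(3) show "x = y"
    using independentD[OF assms, of u "eta q" v "eta r"] inj_eta by (auto simp: vname_def dest: injD)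
qed

lemma vname_image: "vname ` (V \<times> UNIV) = cone V"
proof -
  have "u \<cdot> t \<in> vname ` (V \<times> UNIV)" if "u \<in> V" for u t
  proof -
    obtain q where "t = eta q" using surj_eta by (rule surjE)
    then show ?thesis using that by (auto simp: vname_def intro!: image_eqI[of _ _ "(u, q)"])
  qed
  then show ?thesis by (auto simp: vname_def cone_def)
qed

lemma bij_vname: "independent V \<Longrightarrow> bij_betw vname (V \<times> UNIV) (cone V)"
  by (simp add: bij_betw_def vname_inj vname_image)

lemma WN_D: "G \<in> WN \<Longrightarrow> wf_graph G" "G \<in> WN \<Longrightarrow> independent (verts G)"
  by (auto simp: WN_def well_named_iff)

lemma WN_I: "wf_graph G \<Longrightarrow> independent (verts G) \<Longrightarrow> G \<in> WN"
  by (auto simp: WN_def well_named_iff)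

lemma namable_attach: "G \<in> WN \<Longrightarrow> namable (verts (attach G))"
  using vname_inj[OF WN_D(2)] by (auto simp: namable_def)

lemma disk_WN:
  assumes "G \<in> WN" "v \<in> verts G"
  shows "disk G n v \<in> WN"
  using wf_disk[OF WN_D(1)[OF assms(1)] assms(2)] independent_subset[OF WN_D(2)[OF assms(1)] gball_sub]
  by (intro WN_I) simp_all

section \<open>Locality of name-preserving dynamics\<close>

locale named_dynamics =
  fixes Fn :: "('p :: finite, 's :: finite, 'd :: finite) ngraph \<Rightarrow> ('p, 's, 'd) ngraph"
  assumes NCGD: "NCGD Fn" and finiteness: "preserves_finiteness Fn"
begin

lemma Fn_WN: "G \<in> WN \<Longrightarrow> Fn G \<in> WN"
  using NCGD by (auto simp: NCGD_def)

lemma Fn_iota: "G \<in> WN \<Longrightarrow> iota_set u (verts G) \<longleftrightarrow> iota_set u (verts (Fn G))"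
  using NCGD by (auto simp: NCGD_def name_preserving_def)

lemma finite_absorbs:
  assumes "G \<in> WN" "finite (verts G)"
  shows "absorbs (verts G) (verts (Fn G))" "absorbs (verts (Fn G)) (verts G)"
proof -
  have "finite (verts (Fn G))" using finiteness assms by (auto simp: preserves_finiteness_def)
  then show "absorbs (verts G) (verts (Fn G))" "absorbs (verts (Fn G)) (verts G)"
    using assms Fn_iota by (auto intro: finite_iota_absorbs)
qed

definition local_radius :: "('p, 's, 'd) ngraph \<Rightarrow> nat \<Rightarrow> nat \<Rightarrow> bool" where
  "local_radius G n m \<longleftrightarrow>
     (\<forall>H\<in>WN. \<forall>v\<in>verts G. \<forall>v'\<in>verts (Fn H). iota v v' \<longrightarrow> disk H m v = disk G m v \<longrightarrow>
        disk (Fn H) n v' = disk (Fn (disk G m v)) n v')"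

lemma ex_local_radius: "G \<in> WN \<Longrightarrow> \<exists>m. local_radius G n m"
  using NCGD unfolding NCGD_def named_continuous_def local_radius_def by blast

lemma disk_WN_finite:
  fixes G :: "('p, 's, 'd) ngraph"
  assumes "G \<in> WN" "v \<in> verts G"
  shows "disk G m v \<in> WN" "finite (verts (disk G m v))"
  using disk_WN[OF assms] finite_gball[OF WN_D(1)[OF assms(1)] finite_class.finite_UNIV] by auto

context
  fixes G n m H v
  assumes G: "G \<in> WN" and rad: "local_radius G n m" and H: "H \<in> WN" and v: "v \<in> verts G"
    and eq: "disk H m v = disk G m v"
begin

lemma local_centre: "v \<in> verts H"
proof -
  have "v \<in> verts (disk G m v)" using gball_centre[OF v] by simp
  then show ?thesis using gball_sub[of H m v] unfolding eq[symmetric] by auto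
qed

lemma local_disk:
  "v' \<in> verts (Fn H) \<Longrightarrow> iota v v' \<Longrightarrow> disk (Fn H) n v' = disk (Fn (disk G m v)) n v'"
  using rad H v eq unfolding local_radius_def by blast

text \<open>A disk contains its centre, so equality of disks transfers the vertex even at radius
  \<open>n = 0\<close>.\<close>

lemma local_vert:
  assumes "v' \<in> verts (Fn H)" "iota v v'"
  shows "v' \<in> verts (Fn (disk G m v))"
proof -
  have "v' \<in> verts (disk (Fn H) n v')" using gball_centre[OF assms(1)] by simp
  then show ?thesis
    unfolding local_disk[OF assms] using gball_sub[of "Fn (disk G m v)" n v'] by auto
qed

text \<open>Continuity speaks only of vertices of \<open>Fn H\<close>, so this direction needs name
  preservation: the word shared by \<open>v\<close> and \<open>v'\<close> meets some vertex
  \<open>v''\<close> of \<open>Fn H\<close>, which passes to the image of the disk, and independence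
  there forces \<open>v'' = v'\<close>.\<close>

lemma local_vert':
  assumes v': "v' \<in> verts (Fn (disk G m v))" and i: "iota v v'"
  shows "v' \<in> verts (Fn H)"
proof -
  obtain s t where st: "v \<cdot> s = v' \<cdot> t" using i by (auto simp: iota_def)
  have "iota_set (v \<cdot> s) (verts H)"
    using iota_setI[OF local_centre, of "v \<cdot> s" "[]" s] by simp
  then obtain v'' a c where v'': "v'' \<in> verts (Fn H)" "v \<cdot> s \<cdot> a = v'' \<cdot> c"
    unfolding Fn_iota[OF H] by (auto simp: iota_set_def iota_def)
  then have "iota v v''" using iotaI[of v "s @ a" v'' c] by (simp add: nword_append)
  then have "v'' \<in> verts (Fn (disk G m v))" using local_vert v'' by blast
  moreover have "v' \<cdot> (t @ a) = v'' \<cdot> c" using st v'' by (simp add: nword_append)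
  ultimately have "v' = v''"
    using independentD[OF WN_D(2)[OF Fn_WN[OF disk_WN_finite(1)[OF G v]]]] v' by blast
  then show ?thesis using v'' by simp
qed

end

lemma absorbs_forward:
  assumes G: "G \<in> WN"
  shows "absorbs (verts G) (verts (Fn G))"
  unfolding absorbs_def
proof
  fix v assume v: "v \<in> verts G"
  \<comment> \<open>Radius 0 is enough, as only the presence of \<open>v'\<close> among the vertices
    of \<open>Fn G\<close> has to be transferred.\<close>
  obtain m where m: "local_radius G 0 m" using ex_local_radius[OF G] by blast
  let ?D = "disk G m v"
  have "v \<in> verts ?D" using gball_centre[OF v] by simp
  then obtain b where b: "\<And>s. length s \<ge> b \<Longrightarrow> v \<cdot> s \<in> cone (verts (Fn ?D))"
    using finite_absorbs(1)[OF disk_WN_finite[OF G v]] unfolding absorbs_def by blast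
  have "v \<cdot> s \<in> cone (verts (Fn G))" if s: "length s \<ge> b" for s
  proof -
    obtain v' t where v': "v' \<in> verts (Fn ?D)" "v \<cdot> s = v' \<cdot> t" using b[OF s] by (rule coneE)
    have "v' \<in> verts (Fn G)"
      by (rule local_vert'[OF G m G v HOL.refl v'(1) iotaI[OF v'(2)]])
    then show ?thesis using v' by (simp add: coneI)
  qed
  then show "\<exists>b. \<forall>s. length s \<ge> b \<longrightarrow> v \<cdot> s \<in> cone (verts (Fn G))" by blast
qed

lemma absorbs_backward:
  assumes G: "G \<in> WN"
  shows "absorbs (verts (Fn G)) (verts G)"
  unfolding absorbs_def
proof
  fix v' assume v': "v' \<in> verts (Fn G)"
  have "iota_set v' (verts (Fn G))" using iota_refl v' by (auto simp: iota_set_def)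
  then obtain v where v: "v \<in> verts G" "iota v v'"
    unfolding Fn_iota[OF G, symmetric] by (auto simp: iota_set_def dest: iota_sym)
  obtain m where m: "local_radius G 0 m" using ex_local_radius[OF G] by blast
  let ?D = "disk G m v"
  have "v' \<in> verts (Fn ?D)" by (rule local_vert[OF G m G v(1) HOL.refl v' v(2)])
  then obtain b where b: "\<And>s. length s \<ge> b \<Longrightarrow> v' \<cdot> s \<in> cone (verts ?D)"
    using finite_absorbs(2)[OF disk_WN_finite[OF G v(1)]] unfolding absorbs_def by blast
  have "cone (verts ?D) \<subseteq> cone (verts G)" using gball_sub[of G m v] by (intro cone_mono) simp
  then show "\<exists>b. \<forall>s. length s \<ge> b \<longrightarrow> v' \<cdot> s \<in> cone (verts G)" using b by blast
qed

abbreviation rpos :: "('p, 's, 'd) ngraph \<Rightarrow> name \<times> dir list option \<Rightarrow> name \<times> dir list option" where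
  "rpos G \<equiv> rmap (verts (Fn G))"

lemma bij_rpos: "G \<in> WN \<Longrightarrow> bij_betw (rpos G) (verts (attach G)) (verts (attach (Fn G)))"
  unfolding verts_attach by (intro bij_rmap absorbs_forward absorbs_backward WN_D(2) Fn_WN)

lemma rpos_mem: "G \<in> WN \<Longrightarrow> z \<in> verts (attach G) \<Longrightarrow> rpos G z \<in> verts (attach (Fn G))"
  using bij_rpos bij_betwE by blast

lemma rpos_matches: "G \<in> WN \<Longrightarrow> z \<in> verts (attach G) \<Longrightarrow> matches z (rpos G z)"
  using rmap_props(2)[OF WN_D(2)[OF Fn_WN] absorbs_forward] by simp

lemma rpos_eqI: "G \<in> WN \<Longrightarrow> y \<in> verts (attach (Fn G)) \<Longrightarrow> matches z y \<Longrightarrow> rpos G z = y"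
  using rmap_eqI[OF WN_D(2)[OF Fn_WN]] by simp

definition outcome :: "('p, 's, 'd) ngraph \<Rightarrow> name \<times> dir list option \<Rightarrow> ('p xport, 's xlabel, 'd) pgm" where
  "outcome G z = tilde (attach (Fn G), rpos G z)"

definition route ::
  "('p, 's, 'd) ngraph \<Rightarrow> name \<times> dir list option \<Rightarrow> name \<times> dir list option \<Rightarrow> 'p xport vertex" where
  "route G x y = path_between (attach (Fn G)) (rpos G x) (rpos G y)"

text \<open>Injectivity is assumed on the vertices of \<open>G\<close> alone; it reaches those of
  \<open>Fn G\<close> because their deep words are words below \<open>G\<close>. Since
  \<open>rename\<close> preserves matching, uniqueness of the partner makes the bijection commute
  with it.\<close>

lemma transport_renaming:
  assumes G: "G \<in> WN" and \<rho>: "is_renaming \<rho>" and inj: "inj_on (rename \<rho>) (verts G)"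
    and G': "gmap (rename \<rho>) G \<in> WN"
  defines "r \<equiv> map_prod (rename \<rho>) (id :: dir list option \<Rightarrow> _)"
  shows "Fn (gmap (rename \<rho>) G) = gmap (rename \<rho>) (Fn G)"
    and "x \<in> verts (attach G) \<Longrightarrow> rpos (gmap (rename \<rho>) G) (r x) = r (rpos G x)"
    and "x \<in> verts (attach G) \<Longrightarrow> outcome (gmap (rename \<rho>) G) (r x) = outcome G x"
    and "x \<in> verts (attach G) \<Longrightarrow> y \<in> verts (attach G) \<Longrightarrow>
           route (gmap (rename \<rho>) G) (r x) (r y) = route G x y"
proof -
  let ?G = "gmap (rename \<rho>) G"
  show F: "Fn ?G = gmap (rename \<rho>) (Fn G)"
    using NCGD \<rho> G G' unfolding NCGD_def named_shift_invariant_def by blast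
  have "inj_on (rename \<rho>) (verts (Fn G))"
    using absorbs_rename_independent(2)[OF absorbs_backward[OF G] _ inj WN_D(2)[OF Fn_WN[OF G]]]
      WN_D(2)[OF G'] by simp
  then have rinj: "inj_on r (verts (attach (Fn G)))"
    unfolding r_def by (simp add: map_prod_inj_on)
  have aF: "attach (Fn ?G) = gmap r (attach (Fn G))" unfolding F attach_gmap r_def ..
  show rp: "rpos ?G (r x) = r (rpos G x)" if x: "x \<in> verts (attach G)" for x
  proof (rule rpos_eqI[OF G'])
    show "r (rpos G x) \<in> verts (attach (Fn ?G))"
      unfolding aF using rpos_mem[OF G x] by (simp del: verts_attach)
    show "matches (r x) (r (rpos G x))"
      unfolding r_def by (rule matches_rename[OF rpos_matches[OF G x]])
  qed
  note wf = wf_attach[OF WN_D(1)[OF Fn_WN[OF G]]]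
  show "outcome ?G (r x) = outcome G x" if x: "x \<in> verts (attach G)"
    unfolding outcome_def rp[OF x] aF by (rule tilde_gmap[OF wf rinj rpos_mem[OF G x]])
  show "route ?G (r x) (r y) = route G x y" if x: "x \<in> verts (attach G)" and y: "y \<in> verts (attach G)"
    unfolding route_def rp[OF x] rp[OF y] aF
    by (rule path_between_gmap[OF wf rinj rpos_mem[OF G x] rpos_mem[OF G y]])
qed

text \<open>The passage back from \<open>Fn G\<close> to \<open>G\<close> serves invertibility,
  where a renaming is first known to behave well on the image graph.\<close>

lemma transport_inverse_renaming:
  assumes G: "G \<in> WN" and \<rho>: "is_renaming \<rho>" and inj: "inj_on (rename \<rho>) (verts (Fn G))"
    and G': "gmap (rename \<rho>) (Fn G) \<in> WN"
  shows "gmap (rename \<rho>) G \<in> WN" "inj_on (rename \<rho>) (verts G)"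
proof -
  note ind = absorbs_rename_independent[OF absorbs_forward[OF G] _ inj WN_D(2)[OF G]]
  have "independent (rename \<rho> ` verts (Fn G))" using WN_D(2)[OF G'] by simp
  note ind = ind[OF this]
  show "inj_on (rename \<rho>) (verts G)" by (rule ind(2))
  then show "gmap (rename \<rho>) G \<in> WN"
    using ind(1) by (intro WN_I wf_gmap WN_D(1)[OF G]) simp_all
qed

end

text \<open>Canonical names need not leave room for a renaming onto a graph that uses all names, hence the
  detour through a graph named by an initial segment of the atoms.\<close>

lemma ex_common_renaming:
  assumes G: "G \<in> WN" and c: "inj_on c (verts G)" and cG: "gmap c G \<in> WN"
  obtains G1 \<rho>1 \<rho>2 where "G1 \<in> WN" "is_renaming \<rho>1" "is_renaming \<rho>2"
    "inj_on (rename \<rho>1) (verts G1)" "inj_on (rename \<rho>2) (verts G1)"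
    "gmap (rename \<rho>1) G1 = G" "gmap (rename \<rho>2) G1 = gmap c G"
    "\<And>w. w \<in> verts G1 \<Longrightarrow> rename \<rho>2 w = c (rename \<rho>1 w)"
proof -
  note wf = WN_D(1)[OF G]
  obtain e :: "name \<Rightarrow> nat" where e: "bij_betw e (verts G) (if finite (verts G) then {..<card (verts G)} else UNIV)"
    using ex_enum[OF countable_names] by blast
  obtain \<rho>1 where \<rho>1: "is_renaming \<rho>1" "\<And>w. w \<in> verts G \<Longrightarrow> \<rho>1 (e w) = w"
    using ex_renaming[OF countable_names _ _ e, of id] WN_D(2)[OF G] by auto
  obtain \<rho>2 where \<rho>2: "is_renaming \<rho>2" "\<And>w. w \<in> verts G \<Longrightarrow> \<rho>2 (e w) = c w"
    using ex_renaming[OF countable_names c _ e] WN_D(2)[OF cG] by auto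
  let ?a = "\<lambda>w. atom (e w)"
  define G1 where "G1 = gmap ?a G"
  have inj_a: "inj_on ?a (verts G)" using e by (auto simp: bij_betw_def inj_on_def)
  show ?thesis
  proof (rule that[of G1 \<rho>1 \<rho>2])
    show "G1 \<in> WN"
      unfolding G1_def by (intro WN_I wf_gmap wf inj_a independent_atoms) auto
    show "gmap (rename \<rho>1) G1 = G"
      unfolding G1_def by (rule gmap_inv[OF wf]) (simp add: \<rho>1)
    show "gmap (rename \<rho>2) G1 = gmap c G"
      unfolding G1_def gmap_gmap by (rule gmap_cong[OF wf]) (simp add: \<rho>2)
    show "inj_on (rename \<rho>1) (verts G1)" "inj_on (rename \<rho>2) (verts G1)"
      unfolding G1_def using \<rho>1 \<rho>2 c by (auto simp: inj_on_def)
    show "rename \<rho>2 w = c (rename \<rho>1 w)" if "w \<in> verts G1" for w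
      using that \<rho>1 \<rho>2 by (auto simp: G1_def)
  qed (use \<rho>1 \<rho>2 in blast)+
qed

lemma position_lift:
  assumes "x \<in> verts (attach (gmap f G))"
  obtains x1 where "x1 \<in> verts (attach G)" "x = map_prod f id x1"
  using assms unfolding attach_gmap by (auto simp del: verts_attach)

lemma map_prod_position:
  "x \<in> verts (attach G) \<Longrightarrow> (\<And>w. w \<in> verts G \<Longrightarrow> g w = c (f w)) \<Longrightarrow>
    map_prod g id x = map_prod c id (map_prod f id x)"
  by auto

context named_dynamics
begin

lemma transport_iso:
  assumes G: "G \<in> WN" and c: "inj_on c (verts G)" and cG: "gmap c G \<in> WN"
  defines "r \<equiv> map_prod c (id :: dir list option \<Rightarrow> _)"
  shows "x \<in> verts (attach G) \<Longrightarrow> outcome (gmap c G) (r x) = outcome G x"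
    and "x \<in> verts (attach G) \<Longrightarrow> y \<in> verts (attach G) \<Longrightarrow> route (gmap c G) (r x) (r y) = route G x y"
proof -
  obtain G1 \<rho>1 \<rho>2 where G1: "G1 \<in> WN" "is_renaming \<rho>1" "is_renaming \<rho>2"
    "inj_on (rename \<rho>1) (verts G1)" "inj_on (rename \<rho>2) (verts G1)"
    "gmap (rename \<rho>1) G1 = G" "gmap (rename \<rho>2) G1 = gmap c G"
    "\<And>w. w \<in> verts G1 \<Longrightarrow> rename \<rho>2 w = c (rename \<rho>1 w)"
    by (rule ex_common_renaming[OF G c cG]) blast
  note t1 = transport_renaming(3,4)[OF G1(1,2,4), unfolded G1(6), OF G]
  note t2 = transport_renaming(3,4)[OF G1(1,3,5), unfolded G1(7), OF cG]
  have lift: "\<exists>x1 \<in> verts (attach G1). x = map_prod (rename \<rho>1) id x1 \<and> r x = map_prod (rename \<rho>2) id x1"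
    if x: "x \<in> verts (attach G)" for x
  proof -
    obtain x1 where x1: "x1 \<in> verts (attach G1)" "x = map_prod (rename \<rho>1) id x1"
      using x position_lift unfolding G1(6)[symmetric] by blast
    moreover have "r x = map_prod (rename \<rho>2) id x1"
      unfolding r_def x1(2) by (rule map_prod_position[symmetric, OF x1(1)]) (rule G1(8))
    ultimately show ?thesis by blast
  qed
  show "outcome (gmap c G) (r x) = outcome G x" if "x \<in> verts (attach G)"
    using lift[OF that] t1(1) t2(1) by auto
  show "route (gmap c G) (r x) (r y) = route G x y"
    if "x \<in> verts (attach G)" "y \<in> verts (attach G)"
    using lift[OF that(1)] lift[OF that(2)] t1(2) t2(2) by auto
qed

text \<open>Isomorphic images have isomorphic sources. The atom-named graph \<open>A1\<close> that
  renames to both images has a preimage \<open>G1\<close>; the two renamings of \<open>G1\<close>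
  have the images \<open>Fn G\<close> and \<open>Fn G0\<close>, so injectivity of the dynamics
  identifies them with \<open>G\<close> and \<open>G0\<close>. The bijections on positions then
  identify the pointers.\<close>

lemma transport_iso_inverse:
  assumes bij: "bij_betw Fn WN WN" and G: "G \<in> WN" and c: "inj_on c (verts (Fn G))"
    and G0: "G0 \<in> WN" "Fn G0 = gmap c (Fn G)"
    and x: "x \<in> verts (attach G)" and x0: "x0 \<in> verts (attach G0)" "rpos G0 x0 = map_prod c id (rpos G x)"
  shows "tilde (attach G0, x0) = tilde (attach G, x)"
proof -
  have cG: "gmap c (Fn G) \<in> WN" using Fn_WN[OF G0(1)] G0(2) by simp
  obtain A1 \<rho>1 \<rho>2 where A1: "A1 \<in> WN" "is_renaming \<rho>1" "is_renaming \<rho>2"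
    "inj_on (rename \<rho>1) (verts A1)" "inj_on (rename \<rho>2) (verts A1)"
    "gmap (rename \<rho>1) A1 = Fn G" "gmap (rename \<rho>2) A1 = gmap c (Fn G)"
    "\<And>w. w \<in> verts A1 \<Longrightarrow> rename \<rho>2 w = c (rename \<rho>1 w)"
    by (rule ex_common_renaming[OF Fn_WN[OF G] c cG]) blast
  obtain G1 where G1: "G1 \<in> WN" "Fn G1 = A1"
    using bij A1(1) unfolding bij_betw_def by (metis imageE)
  note t1 = transport_inverse_renaming[OF G1(1) A1(2), unfolded G1(2), OF A1(4), unfolded A1(6), OF Fn_WN[OF G]]
  note t2 = transport_inverse_renaming[OF G1(1) A1(3), unfolded G1(2), OF A1(5), unfolded A1(7), OF cG]
  note s1 = transport_renaming(1,2)[OF G1(1) A1(2) t1(2,1)]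
  note s2 = transport_renaming(1,2)[OF G1(1) A1(3) t2(2,1)]
  have eq1: "gmap (rename \<rho>1) G1 = G"
    using bij t1(1) G s1(1) unfolding G1(2) A1(6) bij_betw_def by (blast dest: inj_onD)
  have eq2: "gmap (rename \<rho>2) G1 = G0"
    using bij t2(1) G0 s2(1) unfolding G1(2) A1(7) bij_betw_def by (metis inj_onD)
  obtain x1 where x1: "x1 \<in> verts (attach G1)" "x = map_prod (rename \<rho>1) id x1"
    using x position_lift unfolding eq1[symmetric] by blast
  have m2: "map_prod (rename \<rho>2) id x1 \<in> verts (attach G0)"
    unfolding eq2[symmetric] attach_gmap using x1(1) by (simp del: verts_attach)
  have "rpos G0 (map_prod (rename \<rho>2) id x1) = map_prod (rename \<rho>2) id (rpos G1 x1)"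
    using s2(2)[OF x1(1)] unfolding eq2 .
  also have "\<dots> = map_prod c id (map_prod (rename \<rho>1) id (rpos G1 x1))"
    using map_prod_position[OF rpos_mem[OF G1(1) x1(1)], of "rename \<rho>2" c "rename \<rho>1"] A1(8) G1(2) by simp
  also have "\<dots> = rpos G0 x0"
    using s1(2)[OF x1(1)] x1(2) x0(2) unfolding eq1 by simp
  finally have x0': "x0 = map_prod (rename \<rho>2) id x1"
    using bij_rpos[OF G0(1)] m2 x0(1) unfolding bij_betw_def by (metis inj_onD)
  have "tilde (attach G0, x0) = tilde (attach G1, x1)"
    unfolding x0' eq2[symmetric] attach_gmap
    by (rule tilde_gmap) (use wf_attach[OF WN_D(1)[OF G1(1)]] x1(1) t2(2) in \<open>auto simp: map_prod_inj_on\<close>)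
  also have "\<dots> = tilde (attach G, x)"
    unfolding x1(2) eq1[symmetric] attach_gmap
    by (rule tilde_gmap[symmetric]) (use wf_attach[OF WN_D(1)[OF G1(1)]] x1(1) t1(2) in \<open>auto simp: map_prod_inj_on\<close>)
  finally show ?thesis .
qed

end

section \<open>Compactness\<close>

text \<open>The limit is the union of the increasing chain. A walk, or a violation of
  well-formedness, involves finitely many vertices and edges and hence already lives in a single
  \<open>D k\<close>.\<close>

lemma ex_limit_graph:
  fixes D :: "nat \<Rightarrow> ('v, 'p, 's, 'd) graph"
  assumes wf: "\<And>r. wf_graph (D r)" and o: "\<And>r. c \<in> verts (D r)"
    and step: "\<And>r. disk (D (Suc r)) r c = D r"
  shows "\<exists>G. wf_graph G \<and> verts G = (\<Union>r. verts (D r)) \<and> (\<forall>r. disk G r c = D r)"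
proof -
  have disk: "disk (D k) r c = D r" if "r \<le> k" for r k
    using that
  proof (induction k rule: dec_induct)
    case base
    have "disk (D r) r c = disk (disk (D (Suc r)) r c) r c" by (simp only: step)
    also have "\<dots> = disk (D (Suc r)) r c" by (rule disk_disk[OF wf o]) simp
    finally show ?case by (simp only: step)
  next
    case (step n)
    have "disk (D (Suc n)) r c = disk (disk (D (Suc n)) n c) r c"
      using disk_disk[OF wf o, of r n "Suc n"] step(1) by simp
    then show ?case using step(3) by (simp only: assms(3))
  qed
  have sub: "verts (D r) \<subseteq> verts (D k)" "edges (D r) \<subseteq> edges (D k)"
    "vlabels (D r) \<subseteq> vlabels (D k)" "elabels (D r) \<subseteq> elabels (D k)" if "r \<le> k" for r k
    unfolding disk[OF that, symmetric] using gball_sub[of "D k" r c] by auto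
  define G where "G = \<lparr>verts = (\<Union>r. verts (D r)), edges = (\<Union>r. edges (D r)),
     vlabels = (\<Union>r. vlabels (D r)), elabels = (\<Union>r. elabels (D r))\<rparr>"
  have subG: "verts (D r) \<subseteq> verts G" "edges (D r) \<subseteq> edges G"
    "vlabels (D r) \<subseteq> vlabels G" "elabels (D r) \<subseteq> elabels G" for r
    by (auto simp: G_def)
  have common: "\<exists>k. x \<in> f (D k) \<and> y \<in> f (D k)"
    if "\<And>r k. r \<le> k \<Longrightarrow> f (D r) \<subseteq> f (D k)" "x \<in> f (D i)" "y \<in> f (D j)"
    for x y i j and f :: "('v, 'p, 's, 'd) graph \<Rightarrow> 'a set"
  proof (intro exI conjI)
    show "x \<in> f (D (max i j))" by (rule subsetD[OF that(1) that(2)]) simp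
    show "y \<in> f (D (max i j))" by (rule subsetD[OF that(1) that(3)]) simp
  qed
  have walkD: "\<exists>k\<ge>r. walk (D k) u p w" if "walk G u p w" for u p w r
    using that
  proof (induction p arbitrary: u)
    case Nil
    then obtain i where "w \<in> verts (D i)" "u = w" by (auto simp: G_def)
    then have "walk (D (max r i)) u [] w" using sub(1)[of i "max r i"] by auto
    then show ?case by (intro exI[of _ "max r i"] conjI) auto
  next
    case (Cons ab p)
    obtain a b where [simp]: "ab = (a, b)" by (cases ab)
    from Cons.prems obtain x where x: "{(u, a), (x, b)} \<in> edges G" "walk G x p w" by auto
    obtain i where i: "{(u, a), (x, b)} \<in> edges (D i)" using x(1) by (auto simp: G_def)
    obtain k where "k \<ge> r" "walk (D k) x p w" using Cons.IH[OF x(2)] by blast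
    note ik = i this
    have "walk (D (max i k)) x p w" by (rule walk_mono[OF sub(1,2) ik(3)]) auto
    moreover have "{(u, a), (x, b)} \<in> edges (D (max i k))" using ik(1) sub(2)[of i "max i k"] by auto
    ultimately show ?case using ik(2) by (intro exI[of _ "max i k"]) auto
  qed
  have ball: "gball G r c = verts (D r)" for r
  proof
    show "verts (D r) \<subseteq> gball G r c"
    proof
      fix w assume "w \<in> verts (D r)"
      then have "w \<in> gball (D r) r c" using arg_cong[OF disk[OF order.refl[of r]], of verts] by simp
      then obtain p where "walk (D r) c p w" "length p \<le> r" by (auto simp: gball_def)
      then show "w \<in> gball G r c" using walk_mono[OF subG(1,2)] by (blast intro: gballI)
    qed
    show "gball G r c \<subseteq> verts (D r)"
    proof
      fix w assume "w \<in> gball G r c"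
      then obtain p k where p: "length p \<le> r" "k \<ge> r" "walk (D k) c p w"
        using walkD[of c _ w r] by (fastforce simp: gball_def)
      then have "w \<in> gball (D k) r c" by (intro gballI)
      then show "w \<in> verts (D r)" using arg_cong[OF disk[OF p(2)], of verts] by simp
    qed
  qed
  have "disk G r c = D r" for r
  proof (rule graph_eqI)
    have in_D: "verts (D r) = gball (D k) r c" if "k \<ge> r" for k
      using arg_cong[OF disk[OF that], of verts] by simp
    show "verts (disk G r c) = verts (D r)" by (simp add: ball)
    show "edges (disk G r c) = edges (D r)"
    proof
      show "edges (D r) \<subseteq> edges (disk G r c)"
        using subG(2)[of r] wf_edge_sub[OF wf[of r]] by (fastforce simp: ball)
      show "edges (disk G r c) \<subseteq> edges (D r)"
      proof
        fix e assume "e \<in> edges (disk G r c)"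
        then have "e \<in> edges G" and e: "fst ` e \<subseteq> verts (D r)" by (auto simp: ball)
        then obtain i where i: "e \<in> edges (D i)" by (auto simp: G_def)
        then have "e \<in> edges (disk (D (max i r)) r c)"
          using e sub(2)[of i "max i r"] in_D[of "max i r"] by auto
        then show "e \<in> edges (D r)" by (simp only: disk max.cobounded2)
      qed
    qed
    show "vlabels (disk G r c) = vlabels (D r)"
    proof
      show "vlabels (D r) \<subseteq> vlabels (disk G r c)"
        using subG(3)[of r] wf_vlabels_sub[OF wf[of r]] by (auto simp: ball)
      show "vlabels (disk G r c) \<subseteq> vlabels (D r)"
      proof
        fix e assume "e \<in> vlabels (disk G r c)"
        then have "e \<in> vlabels G" and e: "fst e \<in> verts (D r)" by (auto simp: ball)
        then obtain i where i: "e \<in> vlabels (D i)" by (auto simp: G_def)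
        then have "e \<in> vlabels (disk (D (max i r)) r c)"
          using e sub(3)[of i "max i r"] in_D[of "max i r"] by auto
        then show "e \<in> vlabels (D r)" by (simp only: disk max.cobounded2)
      qed
    qed
    show "elabels (disk G r c) = elabels (D r)"
    proof
      show "elabels (D r) \<subseteq> elabels (disk G r c)"
        using subG(4)[of r] wf_elabels_sub[OF wf[of r]] wf_edge_sub[OF wf[of r]] by (fastforce simp: ball)
      show "elabels (disk G r c) \<subseteq> elabels (D r)"
      proof
        fix e assume "e \<in> elabels (disk G r c)"
        then have "e \<in> elabels G" and e: "fst ` fst e \<subseteq> verts (D r)"
          unfolding disk_simps ball by (cases e; simp)+
        then obtain i where i: "e \<in> elabels (D i)" by (auto simp: G_def)
        then have "e \<in> elabels (disk (D (max i r)) r c)"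
          using e sub(4)[of i "max i r"] in_D[of "max i r"] by (cases e) (simp, blast)
        then show "e \<in> elabels (D r)" by (simp only: disk max.cobounded2)
      qed
    qed
  qed
  moreover have "wf_graph G"
    unfolding wf_graph_def
  proof (intro conjI ballI impI)
    fix e assume e: "e \<in> edges G"
    then obtain i where i: "e \<in> edges (D i)" by (auto simp: G_def)
    show "e \<subseteq> verts G \<times> UNIV" using wf_edge_sub[OF wf i] subG(1)[of i] by auto
    show "card e = 2" using wf[of i] i unfolding wf_graph_def by blast
    fix e' assume "e' \<in> edges G" and ne: "e \<noteq> e'"
    then obtain j where "e' \<in> edges (D j)" by (auto simp: G_def)
    then obtain k where "e \<in> edges (D k)" "e' \<in> edges (D k)"
      using common[of edges, OF sub(2) i] by blast
    then show "e \<inter> e' = {}" using wf[of k] ne unfolding wf_graph_def by blast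
  next
    show "vlabels G \<subseteq> verts G \<times> UNIV" using wf_vlabels_sub[OF wf] by (fastforce simp: G_def)
    show "elabels G \<subseteq> edges G \<times> UNIV" using wf_elabels_sub[OF wf] by (fastforce simp: G_def)
    show "single_valued (vlabels G)"
    proof (rule single_valuedI)
      fix x y z assume "(x, y) \<in> vlabels G" "(x, z) \<in> vlabels G"
      then obtain i j where "(x, y) \<in> vlabels (D i)" "(x, z) \<in> vlabels (D j)" by (auto simp: G_def)
      then obtain k where "(x, y) \<in> vlabels (D k)" "(x, z) \<in> vlabels (D k)"
        using common[of vlabels, OF sub(3)] by blast
      then show "y = z" using wf[of k] unfolding wf_graph_def by (blast dest: single_valuedD)
    qed
    show "single_valued (elabels G)"
    proof (rule single_valuedI)
      fix x y z assume "(x, y) \<in> elabels G" "(x, z) \<in> elabels G"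
      then obtain i j where "(x, y) \<in> elabels (D i)" "(x, z) \<in> elabels (D j)" by (auto simp: G_def)
      then obtain k where "(x, y) \<in> elabels (D k)" "(x, z) \<in> elabels (D k)"
        using common[of elabels, OF sub(4)] by blast
      then show "y = z" using wf[of k] unfolding wf_graph_def by (blast dest: single_valuedD)
    qed
    fix u w assume "u \<in> verts G" "w \<in> verts G"
    then obtain i j where "u \<in> verts (D i)" "w \<in> verts (D j)" by (auto simp: G_def)
    then obtain k where "u \<in> verts (D k)" "w \<in> verts (D k)"
      using common[of verts, OF sub(1)] by blast
    then show "\<exists>p. walk G u p w" using wf_connected[OF wf] walk_mono[OF subG(1,2)] by blast
  qed
  moreover have "verts G = (\<Union>r. verts (D r))" by (simp add: G_def)
  ultimately show ?thesis by blast
qed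

text \<open>If every value \<open>y\<close> were missed at some level \<open>h y\<close>, all the
  finitely many values would be missed at the largest such level, which still contains an
  element.\<close>

lemma finite_pigeonhole:
  assumes ex: "\<And>b. \<exists>x\<in>B b. Q x" and anti: "\<And>b b'. b \<le> b' \<Longrightarrow> B b' \<subseteq> (B b :: 'a set)"
    and fin: "finite (f ` B (0 :: nat))"
  shows "\<exists>y. \<forall>b. \<exists>x\<in>B b. Q x \<and> f x = y"
proof (rule ccontr)
  assume "\<not> ?thesis"
  then obtain h where h: "\<And>y x. x \<in> B (h y) \<Longrightarrow> Q x \<Longrightarrow> f x \<noteq> y" by metis
  obtain x where x: "x \<in> B (Max (h ` f ` B 0))" "Q x" using ex by blast
  then have "f x \<in> f ` B 0" using anti[of 0] by blast
  then have "h (f x) \<le> Max (h ` f ` B 0)" using fin by simp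
  then show False using h x anti by blast
qed

text \<open>Koenig's lemma for the tree of disks around \<open>c\<close>.\<close>

lemma ex_coherent_disks:
  fixes B :: "nat \<Rightarrow> ('v, 'p, 's, 'd) graph set"
  assumes ne: "\<And>b. B b \<noteq> {}" and anti: "\<And>b b'. b \<le> b' \<Longrightarrow> B b' \<subseteq> B b"
    and wf: "\<And>G. G \<in> B 0 \<Longrightarrow> wf_graph G \<and> c \<in> verts G"
    and fin: "\<And>r. finite ((\<lambda>G. disk G r c) ` B 0)"
  shows "\<exists>D. (\<forall>r b. \<exists>G\<in>B b. disk G r c = D r) \<and> (\<forall>r. disk (D (Suc r)) r c = D r)"
proof -
  have "\<exists>D. \<forall>r. (\<forall>b. \<exists>G\<in>B b. disk G r c = D r) \<and> disk (D (Suc r)) r c = D r"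
  proof (rule dependent_nat_choice)
    show "\<exists>x. \<forall>b. \<exists>G\<in>B b. disk G 0 c = x"
      using finite_pigeonhole[of B "\<lambda>_. True" "\<lambda>G. disk G 0 c"] ne anti fin by (simp add: ex_in_conv)
    fix x r assume x: "\<forall>b. \<exists>G\<in>B b. disk G r c = x"
    \<comment> \<open>Among the graphs with the chosen disk of radius \<open>r\<close>, the next
      larger disk takes finitely many values, and one of these occurs at every level
      \<open>b\<close>.\<close>
    then obtain y where y: "\<And>b. \<exists>G\<in>B b. disk G r c = x \<and> disk G (Suc r) c = y"
      using finite_pigeonhole[of B "\<lambda>G. disk G r c = x" "\<lambda>G. disk G (Suc r) c"] anti fin by blast
    then obtain G where "G \<in> B 0" "disk G r c = x" "disk G (Suc r) c = y" by blast
    then have "disk y r c = x" using disk_disk[of G c r "Suc r"] wf by auto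
    then show "\<exists>y. (\<forall>b. \<exists>G\<in>B b. disk G (Suc r) c = y) \<and> disk y r c = x" using y by blast
  qed
  then show ?thesis by blast
qed

lemma finite_graphs:
  assumes "finite V" "finite (UNIV :: 'p set)" "finite (UNIV :: 's set)" "finite (UNIV :: 'd set)"
  shows "finite {G :: ('v, 'p, 's, 'd) graph. verts G \<subseteq> V \<and> wf_graph G}"
proof (rule finite_subset)
  let ?P = "V \<times> (UNIV :: 'p set)"
  let ?S = "Pow V \<times> Pow (Pow ?P) \<times> Pow (V \<times> (UNIV :: 's set)) \<times> Pow (Pow ?P \<times> (UNIV :: 'd set))"
  let ?g = "\<lambda>(A, E, L, M). \<lparr>verts = A, edges = E, vlabels = L, elabels = M\<rparr> :: ('v, 'p, 's, 'd) graph"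
  show "finite (?g ` ?S)" using assms by simp
  show "{G :: ('v, 'p, 's, 'd) graph. verts G \<subseteq> V \<and> wf_graph G} \<subseteq> ?g ` ?S"
  proof safe
    fix G :: "('v, 'p, 's, 'd) graph" assume G: "verts G \<subseteq> V" "wf_graph G"
    have E: "edges G \<subseteq> Pow ?P" using wf_edge_sub[OF G(2)] G(1) by fastforce
    have "(verts G, edges G, vlabels G, elabels G) \<in> ?S"
      using E G wf_vlabels_sub[OF G(2)] wf_elabels_sub[OF G(2)] by auto
    then show "G \<in> ?g ` ?S" by (rule image_eqI[rotated]) simp
  qed
qed

section \<open>Canonical graphs and the finiteness of their disks\<close>

lemma cname_short:
  fixes G :: "('v, 'p :: countable, 's, 'd) graph"
  assumes "wf_graph G" "v \<in> verts G" "w \<in> gball G r v"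
  shows "cname G v w \<in> (\<lambda>p :: ('p \<times> 'p) list. atom (to_nat p)) ` {p. length p \<le> r}"
proof -
  have "w \<in> verts G" by (rule subsetD[OF gball_sub assms(3)])
  then obtain p where p: "shortest_walk G v w p" "cname G v w = atom (to_nat p)"
    using cname_ex assms by metis
  moreover have "length p \<le> r" using p(1) assms(3) by (fastforce simp: shortest_walk_def gball_def)
  ultimately show ?thesis by blast
qed

definition canonical :: "('p :: countable, 's, 'd) ngraph \<Rightarrow> name \<Rightarrow> bool" where
  "canonical G c \<longleftrightarrow> (\<exists>(K :: ('p, 's, 'd) ngraph) v. wf_graph K \<and> v \<in> verts K \<and> G = can K v \<and> c = cname K v v)"

lemma canonical_can: "wf_graph K \<Longrightarrow> v \<in> verts K \<Longrightarrow> canonical (can K v) (cname K v v)"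
  for K :: "('p :: countable, 's, 'd) ngraph"
  unfolding canonical_def by blast

lemma canonical_WN: "canonical G c \<Longrightarrow> G \<in> WN"
  by (auto simp: canonical_def intro: can_WN)

lemma canonical_centre: "canonical G c \<Longrightarrow> c \<in> verts G"
  unfolding canonical_def can_def by auto

text \<open>The centre is always named by the code of the empty walk, so disks of different
  canonical graphs can be compared by plain equality.\<close>

lemma canonical_centre_eq:
  fixes G H :: "('p :: countable, 's, 'd) ngraph"
  shows "canonical G c \<Longrightarrow> canonical H c' \<Longrightarrow> c = c'"
  unfolding canonical_def using cname_centre by metis

lemma canonical_disk:
  assumes "canonical G c"
  shows "canonical (disk G r c) c"
proof -
  obtain K :: "('a, 'b, 'c) ngraph" and v where K: "wf_graph K" "v \<in> verts K" "G = can K v" "c = cname K v v"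
    using assms unfolding canonical_def by blast
  have "disk G r c = can (disk K r v) v" unfolding K(3,4) by (rule can_disk[OF K(1,2)])
  moreover have "c = cname (disk K r v) v v"
    unfolding K(4) using cname_disk[OF K(1,2) gball_centre[OF K(2)]] by simp
  moreover have "wf_graph (disk K r v)" "v \<in> verts (disk K r v)"
    using wf_disk[OF K(1,2)] gball_centre[OF K(2)] by auto
  ultimately show ?thesis unfolding canonical_def by blast
qed

lemma can_canonical:
  assumes "canonical G c"
  shows "can G c = G"
proof -
  obtain K :: "('a, 'b, 'c) ngraph" and v where K: "wf_graph K" "v \<in> verts K" "G = can K v" "c = cname K v v"
    using assms unfolding canonical_def by blast
  show ?thesis unfolding K(3,4) using can_gmap[OF K(1) cname_inj[OF K(1,2)] K(2)] by (simp add: can_def)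
qed

lemma canonical_atoms: "canonical G c \<Longrightarrow> verts G \<subseteq> range atom"
  unfolding canonical_def can_def cname_def by auto

text \<open>Vertices within distance \<open>r\<close> are named by walks of length at most
  \<open>r\<close>, of which there are finitely many; finite ports and labels then leave finitely
  many graphs on these names.\<close>

lemma finite_canonical_disks:
  "finite ((\<lambda>G. disk G r c) ` {G :: ('p :: finite, 's :: finite, 'd :: finite) ngraph. canonical G c})"
proof (rule finite_subset)
  let ?V = "(\<lambda>p :: ('p \<times> 'p) list. atom (to_nat p)) ` {p. length p \<le> r}"
  have "finite {p :: ('p \<times> 'p) list. length p \<le> r}"
    using finite_lists_length_le[of "UNIV :: ('p \<times> 'p) set" r] by simp
  then show "finite {G :: ('p, 's, 'd) ngraph. verts G \<subseteq> ?V \<and> wf_graph G}"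
    by (intro finite_graphs) auto
  show "(\<lambda>G. disk G r c) ` {G :: ('p, 's, 'd) ngraph. canonical G c} \<subseteq> {G. verts G \<subseteq> ?V \<and> wf_graph G}"
  proof safe
    fix G :: "('p, 's, 'd) ngraph" assume G: "canonical G c"
    show "wf_graph (disk G r c)"
      by (rule wf_disk[OF WN_D(1)[OF canonical_WN[OF G]] canonical_centre[OF G]])
    obtain K :: "('p, 's, 'd) ngraph" and v where K: "wf_graph K" "v \<in> verts K" "G = can K v" "c = cname K v v"
      using G unfolding canonical_def by blast
    fix w assume "w \<in> verts (disk G r c)"
    then have "w \<in> gball (gmap (cname K v) K) r (cname K v v)" unfolding K(3,4) can_def by simp
    then obtain u where "u \<in> gball K r v" "w = cname K v u"
      unfolding gball_gmap[OF K(1) cname_inj[OF K(1,2)] K(2)] by blast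
    then show "w \<in> ?V" using cname_short[OF K(1,2)] by simp
  qed
qed

context named_dynamics
begin

lemma uniform_absorption:
  "\<exists>b. \<forall>(G :: ('p, 's, 'd) ngraph) c s. canonical G c \<longrightarrow> length s \<ge> b \<longrightarrow> c \<cdot> s \<in> cone (verts (Fn G))"
proof (rule ccontr)
  assume neg: "\<not> ?thesis"
  define c where "c = atom (to_nat ([] :: ('p \<times> 'p) list))"
  have c: "c' = c" if "canonical G c'" for G :: "('p, 's, 'd) ngraph" and c'
    using that by (auto simp: canonical_def c_def cname_centre)
  \<comment> \<open>The counterexamples to depth \<open>b\<close>. These sets shrink as
    \<open>b\<close> grows and, by the assumption to be refuted, never become empty.\<close>
  define B :: "nat \<Rightarrow> ('p, 's, 'd) ngraph set"
    where "B b = {G. canonical G c \<and> (\<exists>s. length s \<ge> b \<and> c \<cdot> s \<notin> cone (verts (Fn G)))}" for b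
  have B: "canonical G c" if "G \<in> B b" for G b using that by (simp add: B_def)
  have "B b \<noteq> {}" for b using neg c unfolding B_def by blast
  moreover have "B b' \<subseteq> B b" if "b \<le> b'" for b b'
    unfolding B_def using that order.trans by blast
  moreover have "finite ((\<lambda>G. disk G r c) ` B 0)" for r
    by (rule finite_subset[OF image_mono finite_canonical_disks]) (use B in blast)
  moreover have "wf_graph G \<and> c \<in> verts G" if "G \<in> B 0" for G
    using WN_D(1)[OF canonical_WN[OF B[OF that]]] canonical_centre[OF B[OF that]] by blast
  ultimately have "\<exists>D. (\<forall>r b. \<exists>G\<in>B b. disk G r c = D r) \<and> (\<forall>r. disk (D (Suc r)) r c = D r)"
    by (intro ex_coherent_disks)
  then obtain D where D: "\<And>r b. \<exists>G\<in>B b. disk G r c = D r" "\<And>r. disk (D (Suc r)) r c = D r"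
    by blast
  have canD: "canonical (D r) c" for r
  proof -
    obtain G where "G \<in> B 0" "disk G r c = D r" using D(1) by blast
    then show ?thesis using canonical_disk[OF B] by metis
  qed
  obtain L where L: "wf_graph L" "verts L = (\<Union>r. verts (D r))" "\<And>r. disk L r c = D r"
    using ex_limit_graph[of D c, OF WN_D(1)[OF canonical_WN[OF canD]] canonical_centre[OF canD] D(2)] by blast
  have "verts L \<subseteq> range atom" using canonical_atoms[OF canD] unfolding L(2) by blast
  then have LW: "L \<in> WN" by (intro WN_I L(1) independent_atoms)
  have cL: "c \<in> verts L" using canonical_centre[OF canD] unfolding L(2) by blast
  obtain M where M: "local_radius L 0 M" using ex_local_radius[OF LW] by blast
  have cM: "c \<in> verts (disk L M c)" using gball_centre[OF cL] by simp
  obtain b where b: "\<And>s. length s \<ge> b \<Longrightarrow> c \<cdot> s \<in> cone (verts (Fn (disk L M c)))"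
    using finite_absorbs(1)[OF disk_WN_finite[OF LW cL]] cM unfolding absorbs_def by blast
  \<comment> \<open>The depth \<open>b\<close> was read off from the disk of radius \<open>M\<close>
    of the limit graph; this graph shares that disk and yet fails at depth \<open>b\<close>.\<close>
  obtain G where G: "G \<in> B b" "disk G M c = D M" using D(1) by blast
  then obtain s where s: "length s \<ge> b" "c \<cdot> s \<notin> cone (verts (Fn G))" by (auto simp: B_def)
  obtain v' t where v': "v' \<in> verts (Fn (disk L M c))" "c \<cdot> s = v' \<cdot> t" using b[OF s(1)] by (rule coneE)
  have "v' \<in> verts (Fn G)"
    by (rule local_vert'[OF LW M canonical_WN[OF B[OF G(1)]] cL _ v'(1) iotaI[OF v'(2)]])
      (use G L(3) in simp)
  then show False using s(2) v'(2) by (simp add: coneI)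
qed

end

section \<open>The induced dynamics\<close>

lemma tilde_attach_can:
  assumes G: "wf_graph G" and v: "v \<in> verts G" and z: "z \<in> verts (attach G)"
  shows "tilde (attach (can G v), map_prod (cname G v) id z) = tilde (attach G, z)"
proof -
  have "inj_on (map_prod (cname G v) (id :: dir list option \<Rightarrow> _)) (verts (attach G))"
    unfolding verts_attach by (rule map_prod_inj_on[OF cname_inj[OF G v]]) simp
  then show ?thesis unfolding can_def attach_gmap by (rule tilde_gmap[OF wf_attach[OF G] _ z])
qed

lemma IM_canonicalE:
  fixes X :: "('p :: countable xport, 's xlabel, 'd) pgm"
  assumes "X \<in> IM"
  obtains G c q where "canonical G c" "X = tilde (attach G, (c, q))"
proof -
  obtain K :: "('p, 's, 'd) ngraph" and v q where K: "X = tilde (attach K, (v, q))" "wf_graph K" "v \<in> verts K"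
    using assms by (auto simp: IM_def)
  have "X = tilde (attach (can K v), (cname K v v, q))"
    using tilde_attach_can[OF K(2,3), of "(v, q)"] K by simp
  then show ?thesis using that canonical_can[OF K(2,3)] by blast
qed

lemma IM_I:
  fixes G :: "('p, 's, 'd) ngraph"
  shows "G \<in> WN \<Longrightarrow> x \<in> verts (attach G) \<Longrightarrow> tilde (attach G, x) \<in> IM"
  unfolding IM_def using WN_D(1) by blast

lemma IM_E:
  fixes X :: "('p :: countable xport, 's xlabel, 'd) pgm"
  assumes "X \<in> IM"
  obtains G x where "G \<in> WN" "x \<in> verts (attach G)" "X = tilde (attach G, x)"
proof -
  obtain G c q where G: "canonical G c" "X = tilde (attach G, (c, q))" using IM_canonicalE[OF assms] .
  have "(c, q) \<in> verts (attach G)" using canonical_centre[OF G(1)] by simp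
  with canonical_WN[OF G(1)] show ?thesis using G(2) by (rule that)
qed

lemma finite_xport: "finite (UNIV :: 'p :: finite xport set)"
proof -
  have "x \<in> range VPort \<union> {PM, PL, PR}" for x :: "'p xport" by (cases x) auto
  then have "(UNIV :: 'p xport set) = range VPort \<union> {PM, PL, PR}" by blast
  moreover have "finite (range VPort \<union> {PM, PL, PR} :: 'p xport set)" by simp
  ultimately show ?thesis by simp
qed

context named_dynamics
begin

lemma outcome_canonical:
  assumes G: "G \<in> WN" and v: "v \<in> verts G" and x: "x \<in> verts (attach G)"
  shows "outcome (can G v) (map_prod (cname G v) id x) = outcome G x"
  unfolding can_def
  by (rule transport_iso(1)[OF G cname_inj[OF WN_D(1)[OF G] v] _ x])
    (use can_WN[OF WN_D(1)[OF G] v] in \<open>simp add: can_def\<close>)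

lemma route_canonical:
  assumes G: "G \<in> WN" and v: "v \<in> verts G" and x: "x \<in> verts (attach G)" and y: "y \<in> verts (attach G)"
  shows "route (can G v) (map_prod (cname G v) id x) (map_prod (cname G v) id y) = route G x y"
  unfolding can_def
  by (rule transport_iso(2)[OF G cname_inj[OF WN_D(1)[OF G] v] _ x y])
    (use can_WN[OF WN_D(1)[OF G] v] in \<open>simp add: can_def\<close>)

text \<open>Both pointed graphs are moved to their common canonical graph, where the pointers
  coincide; equal sets of paths then identify the two target positions as well.\<close>

lemma outcome_well_defined:
  assumes G: "G \<in> WN" "x \<in> verts (attach G)" and H: "H \<in> WN" "y \<in> verts (attach H)"
    and eq: "tilde (attach G, x) = tilde (attach H, y)"
  shows "outcome G x = outcome H y"
    and "x' \<in> verts (attach G) \<Longrightarrow> y' \<in> verts (attach H) \<Longrightarrow>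
      path_between (attach G) x x' = path_between (attach H) y y' \<Longrightarrow> route G x x' = route H y y'"
proof -
  obtain v q w r where x: "x = (v, q)" "v \<in> verts G" and y: "y = (w, r)" "w \<in> verts H"
    using G H by auto
  note wfG = WN_D(1)[OF G(1)] and wfH = WN_D(1)[OF H(1)]
  have qr: "q = r" and can_eq: "can G v = can H w"
    using tilde_attach_eqD[OF wfG x(2) wfH y(2) namable_attach[OF G(1)]] eq x y by blast+
  let ?c = "map_prod (cname G v) id :: _ \<times> dir list option \<Rightarrow> _"
    and ?d = "map_prod (cname H w) id :: _ \<times> dir list option \<Rightarrow> _"
  have xy: "?c x = ?d y"
    using x y qr cname_centre[OF wfG x(2)] cname_centre[OF wfH y(2)] by simp
  show "outcome G x = outcome H y"
    using outcome_canonical[OF G(1) x(2) G(2)] outcome_canonical[OF H(1) y(2) H(2)] can_eq xy by simp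
  assume x': "x' \<in> verts (attach G)" and y': "y' \<in> verts (attach H)"
    and p: "path_between (attach G) x x' = path_between (attach H) y y'"
  have injc: "inj_on ?c (verts (attach G))" and injd: "inj_on ?d (verts (attach H))"
    unfolding verts_attach by (intro map_prod_inj_on cname_inj wfG wfH x y; simp)+
  have aG: "attach (can G v) = gmap ?c (attach G)" and aH: "attach (can H w) = gmap ?d (attach H)"
    unfolding can_def attach_gmap by simp_all
  have "path_between (attach (can G v)) (?c x) (?c x') = path_between (attach (can G v)) (?c x) (?d y')"
    using path_between_gmap[OF wf_attach[OF wfG] injc G(2) x']
      path_between_gmap[OF wf_attach[OF wfH] injd H(2) y'] p
    by (simp only: aG[symmetric] aH[symmetric] can_eq xy)
  moreover have "?c x \<in> verts (attach (can G v))" "?c x' \<in> verts (attach (can G v))"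
    using G(2) x' unfolding aG by (simp_all del: verts_attach)
  ultimately have x'y': "?c x' = ?d y'"
    using path_between_inj[OF wf_attach[OF wf_can[OF wfG x(2)]]] by blast
  show "route G x x' = route H y y'"
    using route_canonical[OF G(1) x(2) G(2) x'] route_canonical[OF H(1) y(2) H(2) y'] can_eq xy x'y' by simp
qed

text \<open>A choice among representatives, made harmless by \<open>outcome_well_defined\<close>;
  values outside \<open>IM\<close> are left unspecified.\<close>

definition gmove :: "('p xport, 's xlabel, 'd) gfun" where
  "gmove X = (SOME Y. \<exists>G\<in>WN. \<exists>x\<in>verts (attach G). X = tilde (attach G, x) \<and> Y = outcome G x)"

definition vmove :: "('p xport, 's xlabel, 'd) vfun" where
  "vmove X c = (SOME e. \<exists>G\<in>WN. \<exists>x\<in>verts (attach G). \<exists>y\<in>verts (attach G).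
     X = tilde (attach G, x) \<and> c = path_between (attach G) x y \<and> e = route G x y)"

lemma gmove_tilde:
  assumes "G \<in> WN" "x \<in> verts (attach G)"
  shows "gmove (tilde (attach G, x)) = tilde (attach (Fn G), rpos G x)"
  unfolding gmove_def outcome_def[symmetric]
proof (rule some_equality)
  fix Y assume "\<exists>H\<in>WN. \<exists>y\<in>verts (attach H). tilde (attach G, x) = tilde (attach H, y) \<and> Y = outcome H y"
  then show "Y = outcome G x" using outcome_well_defined(1)[OF assms] by metis
qed (use assms in blast)

lemma vmove_tilde:
  assumes "G \<in> WN" "x \<in> verts (attach G)" "y \<in> verts (attach G)"
  shows "vmove (tilde (attach G, x)) (path_between (attach G) x y) =
    path_between (attach (Fn G)) (rpos G x) (rpos G y)"
  unfolding vmove_def route_def[symmetric]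
proof (rule some_equality)
  fix e assume "\<exists>H\<in>WN. \<exists>z\<in>verts (attach H). \<exists>z'\<in>verts (attach H).
    tilde (attach G, x) = tilde (attach H, z) \<and>
    path_between (attach G) x y = path_between (attach H) z z' \<and> e = route H z z'"
  then show "e = route G x y" using outcome_well_defined(2)[OF assms(1,2)] assms(3) by metis
qed (use assms in blast)

text \<open>Vertices of \<open>prime G\<close> are named through \<open>eta\<close>, whereas
  positions are matched through \<open>eword\<close>; conjugation by \<open>vname\<close> mediates
  between the two encodings.\<close>

definition name_map :: "('p, 's, 'd) ngraph \<Rightarrow> name \<Rightarrow> name" where
  "name_map G = vname \<circ> rpos G \<circ> inv_into (verts (attach G)) vname"

lemma name_map_vname:
  "G \<in> WN \<Longrightarrow> x \<in> verts (attach G) \<Longrightarrow> name_map G (vname x) = vname (rpos G x)"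
  using inv_into_f_f[OF vname_inj[OF WN_D(2)], of G x] by (simp add: name_map_def)

lemma bij_name_map:
  assumes G: "G \<in> WN"
  shows "bij_betw (name_map G) (cone (verts G)) (cone (verts (Fn G)))"
proof -
  have 1: "bij_betw vname (verts (attach G)) (cone (verts G))"
    "bij_betw vname (verts (attach (Fn G))) (cone (verts (Fn G)))"
    using bij_vname[OF WN_D(2)[OF G]] bij_vname[OF WN_D(2)[OF Fn_WN[OF G]]] by simp_all
  show ?thesis
    unfolding name_map_def
    by (intro bij_betw_trans[OF bij_betw_inv_into[OF 1(1)]] bij_betw_trans[OF bij_rpos[OF G]] 1)
qed

lemma tilde_prime:
  assumes "G \<in> WN" "x \<in> verts (attach G)"
  shows "tilde (prime G, vname x) = tilde (attach G, x)"
  unfolding prime_gmap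
  by (rule tilde_gmap[OF wf_attach[OF WN_D(1)[OF assms(1)]] _ assms(2)])
    (use vname_inj[OF WN_D(2)[OF assms(1)]] in simp)

lemma path_between_prime:
  assumes "G \<in> WN" "x \<in> verts (attach G)" "y \<in> verts (attach G)"
  shows "path_between (prime G) (vname x) (vname y) = path_between (attach G) x y"
  unfolding prime_gmap
  by (rule path_between_gmap[OF wf_attach[OF WN_D(1)[OF assms(1)]] _ assms(2,3)])
    (use vname_inj[OF WN_D(2)[OF assms(1)]] in simp)

lemma induced_by_moves: "induced_by Fn name_map gmove vmove"
  unfolding induced_by_def
proof (intro ballI conjI allI impI)
  fix G :: "('p, 's, 'd) ngraph" and a assume G: "G \<in> WN" and a: "a \<in> cone (verts G)"
  note wf = wf_attach[OF WN_D(1)[OF G]]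
  obtain x where x: "x \<in> verts (attach G)" "a = vname x"
    using a unfolding vname_image[symmetric] verts_attach by blast
  show "gmove (tilde (prime G, a)) = tilde (prime (Fn G), name_map G a)"
    unfolding x(2) name_map_vname[OF G x(1)] tilde_prime[OF G x(1)]
      tilde_prime[OF Fn_WN[OF G] rpos_mem[OF G x(1)]]
    by (rule gmove_tilde[OF G x(1)])
  fix p b assume w: "walk (prime G) a p b"
  then obtain y where y: "b = vname y" "walk (attach G) x p y"
    using walk_gmap[OF wf _ x(1), of vname p b] vname_inj[OF WN_D(2)[OF G]]
    unfolding prime_gmap x(2) verts_attach by blast
  have y': "y \<in> verts (attach G)" using walk_end[OF y(2)] .
  have vt: "vtx (tilde (prime G, a)) p = path_between (attach G) x y"
    unfolding x(2) tilde_prime[OF G x(1)]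
    by (rule vtx_tilde[OF wf x(1) namable_attach[OF G] y(2)])
  show "vmove (tilde (prime G, a)) (vtx (tilde (prime G, a)) p) =
      path_between (prime (Fn G)) (name_map G a) (name_map G b)"
    unfolding vt unfolding x(2) y(1) name_map_vname[OF G x(1)] name_map_vname[OF G y']
      path_between_prime[OF Fn_WN[OF G] rpos_mem[OF G x(1)] rpos_mem[OF G y']] tilde_prime[OF G x(1)]
    by (rule vmove_tilde[OF G x(1) y'])
qed

context
  fixes G :: "('p, 's, 'd) ngraph" and x
  assumes G: "G \<in> WN" and x: "x \<in> verts (attach G)"
begin

lemmas rep = wf_attach[OF WN_D(1)[OF G]] x namable_attach[OF G]

lemmas image_rep =
  wf_attach[OF WN_D(1)[OF Fn_WN[OF G]]] rpos_mem[OF G x] namable_attach[OF Fn_WN[OF G]]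

lemma vmove_image:
  "vmove (tilde (attach G, x)) ` pverts (tilde (attach G, x)) = pverts (gmove (tilde (attach G, x)))"
  unfolding gmove_tilde[OF G x] pverts_tilde[OF rep] pverts_tilde[OF image_rep] image_image
    bij_betw_imp_surj_on[OF bij_rpos[OF G], symmetric]
  by (intro image_cong HOL.refl) (simp only: vmove_tilde[OF G x])

lemma vmove_inj: "inj_on (vmove (tilde (attach G, x))) (pverts (tilde (attach G, x)))"
proof (rule inj_onI)
  fix c d assume "c \<in> pverts (tilde (attach G, x))" "d \<in> pverts (tilde (attach G, x))"
    and eq: "vmove (tilde (attach G, x)) c = vmove (tilde (attach G, x)) d"
  then obtain y z where y: "y \<in> verts (attach G)" "c = path_between (attach G) x y"
    and z: "z \<in> verts (attach G)" "d = path_between (attach G) x z"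
    unfolding pverts_tilde[OF rep] by blast
  have "path_between (attach (Fn G)) (rpos G x) (rpos G y) = path_between (attach (Fn G)) (rpos G x) (rpos G z)"
    using eq unfolding y z vmove_tilde[OF G x y(1)] vmove_tilde[OF G x z(1)] .
  then have "rpos G y = rpos G z"
    by (rule path_between_inj[OF image_rep(1,2) rpos_mem[OF G y(1)]])
  then show "c = d"
    using y z bij_rpos[OF G] unfolding bij_betw_def by (metis inj_onD)
qed

end

section \<open>The conditions on dynamics over invisible matter graphs\<close>

lemma dynamics: "dynamics_over IM gmove vmove"
  unfolding dynamics_over_def
proof (intro ballI conjI)
  fix X :: "('p xport, 's xlabel, 'd) pgm" assume "X \<in> IM"
  then obtain G x where G: "G \<in> WN" "x \<in> verts (attach G)" "X = tilde (attach G, x)" by (rule IM_E)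
  show "gmove X \<in> IM"
    unfolding G(3) gmove_tilde[OF G(1,2)] by (rule IM_I[OF Fn_WN[OF G(1)] rpos_mem[OF G(1,2)]])
  show "vmove X ` pverts X \<subseteq> pverts (gmove X)"
    unfolding G(3) vmove_image[OF G(1,2)] by (rule order.refl)
qed

lemma vertex_pres: "vertex_preserving IM gmove vmove"
  unfolding vertex_preserving_def bij_betw_def
proof (intro ballI conjI)
  fix X :: "('p xport, 's xlabel, 'd) pgm" assume "X \<in> IM"
  then obtain G x where G: "G \<in> WN" "x \<in> verts (attach G)" "X = tilde (attach G, x)" by (rule IM_E)
  show "inj_on (vmove X) (pverts X)" unfolding G(3) by (rule vmove_inj[OF G(1,2)])
  show "vmove X ` pverts X = pverts (gmove X)" unfolding G(3) by (rule vmove_image[OF G(1,2)])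
qed

lemma bounded: "bounded_dyn IM gmove vmove"
  unfolding bounded_dyn_def
\<comment> \<open>As \<open>vmove\<close> is onto, each vertex of the image serves as its own base
  point, reached by the empty path; hence the bound 0.\<close>
proof (intro exI[of _ 0] ballI)
  fix X :: "('p xport, 's xlabel, 'd) pgm" and w assume X: "X \<in> IM" and w: "w \<in> pverts (gmove X)"
  obtain G x where G: "G \<in> WN" "x \<in> verts (attach G)" "X = tilde (attach G, x)" using X by (rule IM_E)
  note rep = image_rep[OF G(1,2)]
  have w': "w \<in> vmove X ` pverts X" using w vmove_image[OF G(1,2)] G(3) by simp
  obtain y where y: "y \<in> verts (attach (Fn G))" "w = path_between (attach (Fn G)) (rpos G x) y"
    using w unfolding G(3) gmove_tilde[OF G(1,2)] pverts_tilde[OF rep] by blast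
  show "\<exists>u\<in>vmove X ` pverts X. \<exists>v\<in>near (Defs.shift (gmove X) u) 0. w = vconcat (gmove X) u v"
  proof (intro bexI)
    show "w = vconcat (gmove X) w (path_between (attach (Fn G)) y y)"
      unfolding G(3) gmove_tilde[OF G(1,2)] y(2) vconcat_tilde[OF rep y(1) y(1)] ..
    show "path_between (attach (Fn G)) y y \<in> near (Defs.shift (gmove X) w) 0"
      unfolding G(3) gmove_tilde[OF G(1,2)] y(2) shift_tilde[OF rep y(1)] near_tilde[OF rep(1) y(1) rep(3)]
      by (rule imageI[OF gball_centre[OF y(1)]])
  qed (rule w')
qed

text \<open>The bijection \<open>rpos G\<close> does not depend on the pointer, so moving the
  pointer merely changes the start of all paths.\<close>

lemma shift_inv: "shift_invariant IM gmove vmove"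
  unfolding shift_invariant_def
proof (intro ballI conjI)
  fix X :: "('p xport, 's xlabel, 'd) pgm" and u assume X: "X \<in> IM" and u: "u \<in> pverts X"
  obtain G x where G: "G \<in> WN" "x \<in> verts (attach G)" "X = tilde (attach G, x)" using X by (rule IM_E)
  note rep = rep[OF G(1,2)] and irep = image_rep[OF G(1,2)]
  obtain y where y: "y \<in> verts (attach G)" "u = path_between (attach G) x y"
    using u unfolding G(3) pverts_tilde[OF rep] by blast
  note ry = rpos_mem[OF G(1) y(1)]
  have sh: "Defs.shift X u = tilde (attach G, y)" unfolding G(3) y(2) by (rule shift_tilde[OF rep y(1)])
  show "gmove (Defs.shift X u) = Defs.shift (gmove X) (vmove X u)"
    unfolding sh unfolding G(3) y(2) gmove_tilde[OF G(1) y(1)] gmove_tilde[OF G(1,2)]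
      vmove_tilde[OF G(1,2) y(1)] shift_tilde[OF irep ry] ..
  fix v assume "v \<in> pverts (Defs.shift X u)"
  then obtain z where z: "z \<in> verts (attach G)" "v = path_between (attach G) y z"
    unfolding sh pverts_tilde[OF rep(1) y(1) rep(3)] by blast
  show "vmove X (vconcat X u v) = vconcat (gmove X) (vmove X u) (vmove (Defs.shift X u) v)"
    unfolding sh unfolding G(3) y(2) z(2) vconcat_tilde[OF rep y(1) z(1)] gmove_tilde[OF G(1,2)]
      vmove_tilde[OF G(1,2) y(1)] vmove_tilde[OF G(1,2) z(1)] vmove_tilde[OF G(1) y(1) z(1)]
      vconcat_tilde[OF irep ry rpos_mem[OF G(1) z(1)]] ..
qed

text \<open>From depth \<open>b\<close> on, the word \<open>c.s\<close> lies below a vertex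
  \<open>v\<close> of the image, so the subtree at the pointer is translated rigidly into the tree
  of \<open>v\<close>. The canonical copy makes the bound from \<open>uniform_absorption\<close>
  applicable to any graph.\<close>

lemma quiescent: "IM_quiescent gmove vmove"
proof -
  obtain b where b: "\<And>(G :: ('p, 's, 'd) ngraph) c s. canonical G c \<Longrightarrow> length s \<ge> b \<Longrightarrow>
      c \<cdot> s \<in> cone (verts (Fn G))"
    using uniform_absorption by blast
  show ?thesis
    unfolding IM_quiescent_def Let_def
  proof (intro exI[of _ b] allI impI)
    fix K :: "('p, 's, 'd) ngraph" and u and s t :: "dir list"
    assume K: "wf_graph K" "u \<in> verts K" and s: "b \<le> length s"
    define G c where "G = can K u" and "c = cname K u u"
    have can: "canonical G c" unfolding G_def c_def by (rule canonical_can[OF K])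
    note GW = canonical_WN[OF can] and cG = canonical_centre[OF can]
    have X: "tilde (attach K, (u, Some s)) = tilde (attach G, (c, Some s))"
      using tilde_attach_can[OF K, of "(u, Some s)"] K(2) by (simp add: G_def c_def)
    obtain v t' where v: "v \<in> verts (Fn G)" "c \<cdot> s = v \<cdot> t'" using b[OF can s] by (rule coneE)
    have r: "rpos G (c, Some (s @ w)) = (v, Some (t' @ w))" for w
      by (rule rpos_eqI[OF GW]) (use v matches_below[OF v(2)] in auto)
    have x: "(c, Some (s @ w)) \<in> verts (attach G)" for w using cG by simp
    have x0: "(c, Some s) \<in> verts (attach G)" using x[of "[]"] by simp
    have r0: "rpos G (c, Some s) = (v, Some t')" using r[of "[]"] by simp
    note rep = rep[OF GW x0] and irep = image_rep[OF GW x0]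
    show "vmove (tilde (attach K, (u, Some s))) (vtx (tilde (attach K, (u, Some s))) (tree_path t)) =
        vtx (gmove (tilde (attach K, (u, Some s)))) (tree_path t)"
      unfolding X vtx_tilde[OF rep walk_tree_path[OF cG]] vmove_tilde[OF GW x0 x] gmove_tilde[OF GW x0]
        vtx_tilde[OF irep, unfolded r0, OF walk_tree_path[OF v(1)]] r r0 ..
  qed
qed

section \<open>Locality of the bijection and continuity\<close>

context
  fixes G H :: "('p, 's, 'd) ngraph" and m M c and q :: "dir list option"
  assumes G: "G \<in> WN" and M: "local_radius G m M" and H: "H \<in> WN" and c: "c \<in> verts G"
    and eq: "disk H M c = disk G M c"
begin

text \<open>The vertex carrying the partner of \<open>(c, q)\<close> meets \<open>c\<close>, hence
  belongs to the image of the disk; uniqueness of partners there gives the equation.\<close>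

lemma local_rpos: "rpos H (c, q) = rpos (disk G M c) (c, q)"
  "rpos H (c, q) \<in> verts (attach (Fn (disk G M c)))"
proof -
  have cH: "(c, q) \<in> verts (attach H)" using local_centre[OF G M H c eq] by simp
  obtain v r where vr: "rpos H (c, q) = (v, r)" by (cases "rpos H (c, q)")
  have "matches (c, q) (v, r)" using rpos_matches[OF H cH] vr by simp
  moreover have "v \<in> verts (Fn H)" using rpos_mem[OF H cH] vr by simp
  ultimately have "v \<in> verts (Fn (disk G M c))"
    using local_vert[OF G M H c eq] matches_iota by blast
  then show m: "rpos H (c, q) \<in> verts (attach (Fn (disk G M c)))" using vr by simp
  show "rpos H (c, q) = rpos (disk G M c) (c, q)"
    by (rule rpos_eqI[symmetric, OF disk_WN_finite(1)[OF G c] m rpos_matches[OF H cH]])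
qed

lemma local_image_disk:
  "disk (attach (Fn H)) m (rpos H (c, q)) = disk (attach (Fn (disk G M c))) m (rpos H (c, q))"
proof -
  have cH: "(c, q) \<in> verts (attach H)" using local_centre[OF G M H c eq] by simp
  obtain v r where vr: "rpos H (c, q) = (v, r)" by (cases "rpos H (c, q)")
  have i: "iota c v" using rpos_matches[OF H cH] vr matches_iota by metis
  have v: "v \<in> verts (Fn H)" using rpos_mem[OF H cH] vr by simp
  have v': "v \<in> verts (Fn (disk G M c))" using local_vert[OF G M H c eq v i] .
  note wf = WN_D(1)[OF Fn_WN[OF H]] WN_D(1)[OF Fn_WN[OF disk_WN_finite(1)[OF G c]]]
  show ?thesis
    unfolding vr disk_attach[OF wf(1) v, of m r m, symmetric, OF diff_le_self]
      disk_attach[OF wf(2) v', of m r m, symmetric, OF diff_le_self]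
      local_disk[OF G M H c eq v i] ..
qed

text \<open>The bijection of the disk is onto, so the image of \<open>z\<close> has a preimage
  \<open>z'\<close> over the disk. Matching does not mention the graph, so \<open>z'\<close> is also
  a preimage in \<open>H\<close>, and injectivity gives \<open>z' = z\<close>.\<close>

lemma local_preimage:
  assumes z: "z \<in> verts (attach H)" and zm: "rpos H z \<in> gball (attach (Fn H)) m (rpos H (c, q))"
  shows "z \<in> verts (attach (disk G M c))" "rpos (disk G M c) z = rpos H z"
    "rpos H z \<in> gball (attach (Fn (disk G M c))) m (rpos H (c, q))"
proof -
  let ?D = "disk G M c"
  note DW = disk_WN_finite(1)[OF G c]
  show g: "rpos H z \<in> gball (attach (Fn ?D)) m (rpos H (c, q))"
    using arg_cong[OF local_image_disk, of verts] zm by simp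
  then have "rpos H z \<in> verts (attach (Fn ?D))" by (rule subsetD[OF gball_sub])
  then obtain z' where z': "z' \<in> verts (attach ?D)" "rpos ?D z' = rpos H z"
    using bij_rpos[OF DW] unfolding bij_betw_def by (metis imageE)
  have "verts ?D \<subseteq> verts H" unfolding eq[symmetric] using gball_sub[of H M c] by simp
  then have z'H: "z' \<in> verts (attach H)" using z'(1) by auto
  have "matches z' (rpos H z)" using rpos_matches[OF DW z'(1)] z'(2) by simp
  then have "rpos H z' = rpos H z" by (rule rpos_eqI[OF H rpos_mem[OF H z]])
  then have "z' = z" using bij_rpos[OF H] z z'H unfolding bij_betw_def by (metis inj_onD)
  then show "z \<in> verts (attach ?D)" "rpos ?D z = rpos H z" using z' by simp_all
qed

end

lemma continuous: "continuous_dyn IM gmove vmove"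
  unfolding continuous_dyn_def
proof (intro ballI allI)
  fix X :: "('p xport, 's xlabel, 'd) pgm" and m assume "X \<in> IM"
  then obtain G c q where can: "canonical G c" and X: "X = tilde (attach G, (c, q))" by (rule IM_canonicalE)
  note GW = canonical_WN[OF can] and cG = canonical_centre[OF can]
  obtain M where M: "local_radius G m M" using ex_local_radius[OF GW] by blast
  let ?D = "disk G M c" and ?x = "(c, q)"
  note DW = disk_WN_finite(1)[OF GW cG]
  define y where "y = rpos ?D ?x"
  \<comment> \<open>The positions over the disk that are sent within \<open>m\<close> of the image
    of the pointer. Balls are finite and the bijection is injective, so \<open>Z\<close> is finite
    and lies within some radius \<open>n0\<close>.\<close>
  define Z where "Z = {z \<in> verts (attach ?D). rpos ?D z \<in> gball (attach (Fn ?D)) m y}"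
  have cD: "?x \<in> verts (attach ?D)" using gball_centre[OF cG] by simp
  have "finite (gball (attach (Fn ?D)) m y)"
    by (rule finite_gball[OF wf_attach[OF WN_D(1)[OF Fn_WN[OF DW]]] finite_xport])
  moreover have "rpos ?D ` Z \<subseteq> gball (attach (Fn ?D)) m y" by (auto simp: Z_def)
  moreover have "inj_on (rpos ?D) Z"
    using bij_rpos[OF DW] unfolding bij_betw_def by (rule inj_on_subset[OF conjunct1]) (auto simp: Z_def)
  ultimately have "finite Z" using finite_imageD finite_subset by blast
  then obtain n0 where n0: "Z \<subseteq> gball (attach ?D) n0 ?x"
    using finite_sub_gball[OF _ _ wf_attach[OF WN_D(1)[OF DW]] cD] by (auto simp: Z_def)
  \<comment> \<open>\<open>n0\<close> covers \<open>Z\<close>, and \<open>M + depth q\<close>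
    ensures that the visible disk of radius \<open>M\<close> survives after the climb of
    \<open>depth q\<close> steps.\<close>
  define n where "n = n0 + M + depth q"
  have Zn: "Z \<subseteq> gball (attach ?D) n ?x"
    using n0 gball_mono[of n0 n "attach ?D" ?x] by (auto simp: n_def)
  have xG: "?x \<in> verts (attach G)" using cG by simp
  note repG = rep[OF GW xG] and irepG = image_rep[OF GW xG]
  \<comment> \<open>Stated for any \<open>H\<close> with the same disk, because it is applied both
    to \<open>G\<close> itself and to the representative of \<open>X'\<close>.\<close>
  have main: "disk (attach (Fn H)) m y = disk (attach (Fn ?D)) m y \<and> rpos H ?x = y \<and>
     (\<forall>u\<in>pverts (tilde (attach H, ?x)). vmove (tilde (attach H, ?x)) u \<in> near (gmove (tilde (attach H, ?x))) m
        \<longrightarrow> u \<in> near (tilde (attach H, ?x)) n)"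
    if H: "H \<in> WN" and eq: "disk H M c = disk G M c" for H
  proof (intro conjI ballI impI)
    have cH: "c \<in> verts H" by (rule local_centre[OF GW M H cG eq])
    then have xH: "?x \<in> verts (attach H)" by simp
    note repH = rep[OF H xH] and irepH = image_rep[OF H xH]
    show y: "rpos H ?x = y" unfolding y_def by (rule local_rpos(1)[OF GW M H cG eq])
    show "disk (attach (Fn H)) m y = disk (attach (Fn ?D)) m y"
      using local_image_disk[OF GW M H cG eq, of q] unfolding y .
    fix u assume "u \<in> pverts (tilde (attach H, ?x))"
      and nr: "vmove (tilde (attach H, ?x)) u \<in> near (gmove (tilde (attach H, ?x))) m"
    then obtain z where z: "z \<in> verts (attach H)" "u = path_between (attach H) ?x z"
      unfolding pverts_tilde[OF repH] by blast
    obtain w where w: "w \<in> gball (attach (Fn H)) m (rpos H ?x)"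
      "path_between (attach (Fn H)) (rpos H ?x) (rpos H z) = path_between (attach (Fn H)) (rpos H ?x) w"
      using nr unfolding z(2) vmove_tilde[OF H xH z(1)] gmove_tilde[OF H xH] near_tilde[OF irepH] by blast
    have "rpos H z = w" by (rule path_between_inj[OF irepH(1,2) rpos_mem[OF H z(1)] w(2)])
    then have zm: "rpos H z \<in> gball (attach (Fn H)) m (rpos H ?x)" using w(1) by simp
    have "z \<in> Z"
      unfolding Z_def using local_preimage[OF GW M H cG eq z(1) zm] unfolding y by simp
    then have "z \<in> gball (attach ?D) n ?x" using Zn by blast
    then obtain p where "walk (attach ?D) ?x p z" "length p \<le> n" by (auto simp: gball_def)
    then have "z \<in> gball (attach H) n ?x"
      using walk_mono[OF attach_disk_sub[of H M c]] unfolding eq by (blast intro: gballI)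
    then show "u \<in> near (tilde (attach H, ?x)) n" unfolding z(2) near_tilde[OF repH] by (rule imageI)
  qed
  show "\<exists>n. \<forall>X'\<in>IM. pdisk X' n = pdisk X n \<longrightarrow>
        pdisk (gmove X') m = pdisk (gmove X) m \<and>
        (\<forall>x\<in>pverts X. vmove X x \<in> near (gmove X) m \<longrightarrow> x \<in> near X n) \<and>
        (\<forall>x\<in>pverts X'. vmove X' x \<in> near (gmove X') m \<longrightarrow> x \<in> near X' n) \<and>
        (\<forall>p\<in>paths (pdisk X n). \<forall>q\<in>paths (pdisk (gmove X) m).
           (vmove X (vtx X p) = vtx (gmove X) q) = (vmove X' (vtx X' p) = vtx (gmove X') q))"
  proof (intro exI[of _ n] ballI impI)
    fix X' :: "('p xport, 's xlabel, 'd) pgm" assume "X' \<in> IM" and pd: "pdisk X' n = pdisk X n"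
    then obtain H c' q' where can': "canonical H c'" and X': "X' = tilde (attach H, (c', q'))" by (auto elim: IM_canonicalE)
    have c': "c' = c" by (rule canonical_centre_eq[OF can' can])
    note can' = can'[unfolded c']
    note HW = canonical_WN[OF can'] and cH = canonical_centre[OF can']
    have xH': "(c, q') \<in> verts (attach H)" using cH by simp
    have eqt: "tilde (disk (attach G) n (c, q), (c, q)) = tilde (disk (attach H) n (c, q'), (c, q'))"
      using pd pdisk_tilde[OF repG, of n] pdisk_tilde[OF rep[OF HW xH'], of n] unfolding X X' c' by simp
    note eqs = tilde_disk_attach_eqD[OF WN_D(1)[OF GW] cG WN_D(1)[OF HW] cH namable_attach[OF GW] _ eqt]
    have qq: "q' = q" and can_eq: "can (disk G (n - depth q) c) c = can (disk H (n - depth q) c) c"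
      using eqs by (simp_all add: n_def)
    have dk: "disk G (n - depth q) c = disk H (n - depth q) c"
      using can_eq can_canonical[OF canonical_disk[OF can]] can_canonical[OF canonical_disk[OF can']] by metis
    have dM: "disk H M c = disk G M c"
      using disk_disk[OF WN_D(1)[OF GW] cG, of M "n - depth q"] disk_disk[OF WN_D(1)[OF HW] cH, of M "n - depth q"] dk
      by (simp add: n_def)
    have xH: "?x \<in> verts (attach H)" using cH by simp
    note repH = rep[OF HW xH] and irepH = image_rep[OF HW xH]
    note mG = main[OF GW HOL.refl] and mH = main[OF HW dM]
    have XH: "X' = tilde (attach H, ?x)" unfolding X' c' qq ..
    have rG: "rpos G ?x = y" and rH: "rpos H ?x = y" using mG mH by blast+
    have img: "disk (attach (Fn H)) m y = disk (attach (Fn G)) m y" using mG mH by metis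
    have src: "disk (attach G) n ?x = disk (attach H) n ?x"
      by (rule disk_attach_cong[OF WN_D(1)[OF GW] WN_D(1)[OF HW] cG cH dk])
    have FX: "gmove X = tilde (attach (Fn G), y)" "gmove X' = tilde (attach (Fn H), y)"
      unfolding X XH gmove_tilde[OF GW xG] gmove_tilde[OF HW xH] rG rH by simp_all
    note irG = irepG[unfolded rG] and irH = irepH[unfolded rH]
    have near_X: "\<forall>x\<in>pverts X. vmove X x \<in> near (gmove X) m \<longrightarrow> x \<in> near X n" using mG unfolding X by blast
    have near_X': "\<forall>x\<in>pverts X'. vmove X' x \<in> near (gmove X') m \<longrightarrow> x \<in> near X' n" using mH unfolding XH by blast
    have pd_im: "pdisk (gmove X') m = pdisk (gmove X) m"
      unfolding FX pdisk_tilde[OF irG] pdisk_tilde[OF irH] img ..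
    have paths_eq: "(vmove X (vtx X p) = vtx (gmove X) r) = (vmove X' (vtx X' p) = vtx (gmove X') r)"
      if p: "p \<in> paths (pdisk X n)" and r: "r \<in> paths (pdisk (gmove X) m)" for p r
    proof -
      have wfd: "wf_graph (disk (attach G) n ?x)" "?x \<in> verts (disk (attach G) n ?x)" "namable (verts (disk (attach G) n ?x))"
        using wf_disk[OF repG(1,2)] gball_centre[OF repG(2)] namable_subset[OF repG(3) gball_sub] by simp_all
      obtain z where z: "walk (disk (attach G) n ?x) ?x p z"
        using p unfolding X pdisk_tilde[OF repG] paths_tilde[OF wfd] by blast
      have zG: "walk (attach G) ?x p z" and zH: "walk (attach H) ?x p z"
        using disk_walk[OF z] disk_walk[OF z[unfolded src]] by blast+
      have wfd': "wf_graph (disk (attach (Fn G)) m y)" "y \<in> verts (disk (attach (Fn G)) m y)"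
        "namable (verts (disk (attach (Fn G)) m y))"
        using wf_disk[OF irG(1,2)] gball_centre[OF irG(2)] namable_subset[OF irG(3) gball_sub] by simp_all
      obtain w where w: "walk (disk (attach (Fn G)) m y) y r w"
        using r unfolding FX pdisk_tilde[OF irG] paths_tilde[OF wfd'] by blast
      have wG: "walk (attach (Fn G)) y r w" and wH: "walk (attach (Fn H)) y r w"
        using disk_walk[OF w] disk_walk[OF w[folded img]] by blast+
      have "vmove X (vtx X p) = vtx (gmove X) r \<longleftrightarrow> rpos G z = w"
        unfolding FX unfolding X vtx_tilde[OF repG zG] vtx_tilde[OF irG wG] vmove_tilde[OF GW xG walk_end[OF zG]] rG
        using path_between_inj[OF irG(1,2) rpos_mem[OF GW walk_end[OF zG]]] by blast
      \<comment> \<open>\<open>matches z w\<close> mentions neither graph, and the positions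
        \<open>z\<close> and \<open>w\<close> are common to both sides, so the equation passes from
        \<open>G\<close> to \<open>H\<close>.\<close>
      also have "\<dots> \<longleftrightarrow> matches z w"
        using rpos_matches[OF GW walk_end[OF zG]] rpos_eqI[OF GW walk_end[OF wG]] by blast
      also have "\<dots> \<longleftrightarrow> rpos H z = w"
        using rpos_matches[OF HW walk_end[OF zH]] rpos_eqI[OF HW walk_end[OF wH]] by blast
      also have "\<dots> \<longleftrightarrow> vmove X' (vtx X' p) = vtx (gmove X') r"
        unfolding FX unfolding XH vtx_tilde[OF repH zH] vtx_tilde[OF irH wH] vmove_tilde[OF HW xH walk_end[OF zH]] rH
        using path_between_inj[OF irH(1,2) rpos_mem[OF HW walk_end[OF zH]]] by blast
      finally show ?thesis .
    qed
    show "pdisk (gmove X') m = pdisk (gmove X) m \<and>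
        (\<forall>x\<in>pverts X. vmove X x \<in> near (gmove X) m \<longrightarrow> x \<in> near X n) \<and>
        (\<forall>x\<in>pverts X'. vmove X' x \<in> near (gmove X') m \<longrightarrow> x \<in> near X' n) \<and>
        (\<forall>p\<in>paths (pdisk X n). \<forall>q\<in>paths (pdisk (gmove X) m).
           (vmove X (vtx X p) = vtx (gmove X) q) = (vmove X' (vtx X' p) = vtx (gmove X') q))"
      using pd_im near_X near_X' paths_eq by blast
  qed
qed

lemma IMCGD_moves: "IMCGD gmove vmove"
  unfolding IMCGD_def CGD_over_def
  by (intro conjI dynamics shift_inv continuous bounded vertex_pres quiescent)

text \<open>Surjectivity lifts from named graphs through representatives and the bijection of
  positions. Injectivity is the harder half, since equal classes only provide isomorphic images, not
  equal ones.\<close>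

lemma invertible_moves:
  assumes bij: "bij_betw Fn WN WN"
  shows "bij_betw gmove IM IM"
  unfolding bij_betw_def
proof
  show "inj_on gmove IM"
  proof (rule inj_onI)
    fix X Y :: "('p xport, 's xlabel, 'd) pgm" assume X: "X \<in> IM" and Y: "Y \<in> IM" and eq: "gmove X = gmove Y"
    obtain G x where G: "G \<in> WN" "x \<in> verts (attach G)" "X = tilde (attach G, x)" using X by (rule IM_E)
    obtain H z where H: "H \<in> WN" "z \<in> verts (attach H)" "Y = tilde (attach H, z)" using Y by (rule IM_E)
    obtain v q where v: "rpos G x = (v, q)" "v \<in> verts (Fn G)" using rpos_mem[OF G(1,2)] by auto
    obtain w r where w: "rpos H z = (w, r)" "w \<in> verts (Fn H)" using rpos_mem[OF H(1,2)] by auto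
    note wf = WN_D(1)[OF Fn_WN[OF G(1)]] WN_D(1)[OF Fn_WN[OF H(1)]]
    have qr: "q = r" and can_eq: "can (Fn G) v = can (Fn H) w"
      using tilde_attach_eqD[OF wf(1) v(2) wf(2) w(2) namable_attach[OF Fn_WN[OF G(1)]], of q r]
        eq gmove_tilde[OF G(1,2)] gmove_tilde[OF H(1,2)] G(3) H(3) v(1) w(1) by simp_all
    \<comment> \<open>The canonical form shared by the two images has a preimage \<open>G0\<close>,
      with which both sources are compared.\<close>
    obtain G0 where G0: "G0 \<in> WN" "Fn G0 = can (Fn G) v"
      using bij can_WN[OF wf(1) v(2)] unfolding bij_betw_def by (metis imageE)
    have "map_prod (cname (Fn G) v) id (rpos G x) \<in> verts (attach (Fn G0))"
      using v by (auto simp: G0 can_def)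
    then obtain x0 where x0: "x0 \<in> verts (attach G0)" "rpos G0 x0 = map_prod (cname (Fn G) v) id (rpos G x)"
      using bij_rpos[OF G0(1)] unfolding bij_betw_def by (metis imageE)
    have "map_prod (cname (Fn G) v) id (rpos G x) = map_prod (cname (Fn H) w) id (rpos H z)"
      using v w qr cname_centre[OF wf(1) v(2)] cname_centre[OF wf(2) w(2)] by simp
    then have x0': "rpos G0 x0 = map_prod (cname (Fn H) w) id (rpos H z)" using x0(2) by simp
    have "tilde (attach G0, x0) = X"
      unfolding G(3)
      by (rule transport_iso_inverse[OF bij G(1) cname_inj[OF wf(1) v(2)] G0(1) _ G(2) x0])
        (simp add: G0 can_def)
    moreover have "tilde (attach G0, x0) = Y"
      unfolding H(3)
      by (rule transport_iso_inverse[OF bij H(1) cname_inj[OF wf(2) w(2)] G0(1) _ H(2) x0(1) x0'])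
        (simp add: G0 can_eq, simp add: can_def)
    ultimately show "X = Y" by simp
  qed
  show "gmove ` IM = IM"
  proof
    show "gmove ` IM \<subseteq> IM" using dynamics unfolding dynamics_over_def by blast
    show "IM \<subseteq> gmove ` IM"
    proof
      fix Y :: "('p xport, 's xlabel, 'd) pgm" assume "Y \<in> IM"
      then obtain A y where A: "A \<in> WN" "y \<in> verts (attach A)" "Y = tilde (attach A, y)" by (rule IM_E)
      obtain G where G: "G \<in> WN" "Fn G = A" using bij A(1) unfolding bij_betw_def by (metis imageE)
      obtain x where x: "x \<in> verts (attach G)" "rpos G x = y"
        using bij_rpos[OF G(1)] A(2) unfolding G(2) bij_betw_def by (metis imageE)
      have "Y = gmove (tilde (attach G, x))" unfolding gmove_tilde[OF G(1) x(1)] x(2) using A(3) G(2) by simp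
      then show "Y \<in> gmove ` IM" using IM_I[OF G(1) x(1)] by blast
    qed
  qed
qed

end

theorem theorem8:
  fixes Fn :: "(name, 'p::finite, 's::finite, 'd::finite) graph \<Rightarrow> (name, 'p, 's, 'd) graph"
  assumes "NCGD Fn"
    and "preserves_finiteness Fn"
  shows "\<exists>Rn :: (name, 'p, 's, 'd) graph \<Rightarrow> name \<Rightarrow> name.
           (\<forall>G\<in>WN. bij_betw (Rn G) (cone (verts G)) (cone (verts (Fn G)))) \<and>
           (\<exists>F R. induced_by Fn Rn F R \<and> IMCGD F R \<and>
                  (NCGD_invertible Fn \<longrightarrow> invertible_over IM F R))"
proof -
  interpret named_dynamics Fn using assms by unfold_locales
  show ?thesis
    using bij_name_map induced_by_moves IMCGD_moves invertible_moves
    unfolding NCGD_invertible_def invertible_over_def by blast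
qed

end
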